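(* Let $T$ be a spider with bipartition $X$ and $Y$, and let $t=\max\{|X|,|Y|\}$. Then every $3$-connected bipartite graph $G$ with minimum degree $\delta(G)\geq t+3$ contains a subgraph $T'$ that is a spider isomorphic to $T$ and such that $G-V(T')$ is still $3$-connected.
   Context: All graphs are finite and undirected, without loops or multiple edges. $\delta(G)$ is the minimum degree of $G$. For $S\subseteq V(G)$, $G-S$ is the graph obtained from $G$ by deleting the vertices of $S$ (and all incident edges). The connectivity $\kappa(G)$ is the minimum size of a vertex set $S$ such that $G-S$ is disconnected or has only one vertex; $G$ is $k$-connected if $\kappa(G)\geq k$. A spider is a tree with at most one vertex of degree more than $2$. The bipartition $X,Y$ of a tree is its partition into two independent sets. *)

theory Defs
  imports Graph_Theory.Graph_Theory
begin

text \<open>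
  Following the graph library, a finite simple undirected graph is a finite symmetric loop-free
  digraph (locale \<^locale>\<open>pair_graph\<close>, where arcs are pairs of vertices): the edge \<open>uv\<close> is
  represented by the two arcs \<open>(u, v)\<close> and \<open>(v, u)\<close>.
\<close>

definition delete_verts :: "('a, 'b) pre_digraph \<Rightarrow> 'a set \<Rightarrow> ('a, 'b) pre_digraph" where
  "delete_verts G S = G \<restriction> (verts G - S)"

text \<open>
  In a symmetric digraph without multiple arcs, the out-degree of a vertex is the number of its
  neighbours, i.e. its degree as a vertex of the undirected graph.
\<close>

definition degree :: "('a, 'b) pre_digraph \<Rightarrow> 'a \<Rightarrow> nat" where
  "degree G v = out_degree G v"

definition min_degree :: "('a, 'b) pre_digraph \<Rightarrow> nat" where
  "min_degree G = Min (degree G ` verts G)"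

text \<open>
  The library's \<^const>\<open>connected\<close> requires a nonempty vertex set, so the graph without vertices
  counts as disconnected and has connectivity 0. For a nonempty graph, this convention does not
  affect the minimum: if deleting all vertices is allowed, then so is the smaller set that leaves
  exactly one vertex.
\<close>

definition connectivity :: "('a, 'b) pre_digraph \<Rightarrow> nat" where
  "connectivity G = (LEAST k. \<exists>S \<subseteq> verts G. card S = k \<and>
     (\<not> connected (delete_verts G S) \<or> card (verts (delete_verts G S)) = 1))"

definition k_connected :: "nat \<Rightarrow> ('a, 'b) pre_digraph \<Rightarrow> bool" where
  "k_connected k G \<longleftrightarrow> k \<le> connectivity G"

text \<open>
  The library's \<^const>\<open>tree\<close> is not usable for symmetric digraphs, since there each edge already
  forms a directed cycle of length 2. The directed cycles of length at least 3 are exactly the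
  traversals of the cycles of the undirected graph.
\<close>

definition undirected_tree :: "('a, 'b) pre_digraph \<Rightarrow> bool" where
  "undirected_tree G \<longleftrightarrow> connected G \<and> \<not> (\<exists>p. pre_digraph.cycle G p \<and> 3 \<le> length p)"

definition spider :: "('a, 'b) pre_digraph \<Rightarrow> bool" where
  "spider G \<longleftrightarrow> undirected_tree G \<and> card {v \<in> verts G. 2 < degree G v} \<le> 1"

definition independent :: "('a, 'b) pre_digraph \<Rightarrow> 'a set \<Rightarrow> bool" where
  "independent G X \<longleftrightarrow> X \<subseteq> verts G \<and> (\<forall>u \<in> X. \<forall>v \<in> X. \<not> u \<rightarrow>\<^bsub>G\<^esub> v)"

text \<open>One of the two classes may be empty, as it is for the tree with a single vertex.\<close>

definition bipartition :: "('a, 'b) pre_digraph \<Rightarrow> 'a set \<Rightarrow> 'a set \<Rightarrow> bool" where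
  "bipartition G X Y \<longleftrightarrow> X \<union> Y = verts G \<and> X \<inter> Y = {} \<and> independent G X \<and> independent G Y"

definition bipartite :: "('a, 'b) pre_digraph \<Rightarrow> bool" where
  "bipartite G \<longleftrightarrow> (\<exists>X Y. bipartition G X Y)"

end

theory Submission
  imports Defs
begin

text \<open>
  Call a vertex of an induced subgraph \<open>U\<close> big if its degree in \<open>U\<close> is at least 3. The subgraphs that
  are kept disjoint from a copy of \<open>T\<close> are essentially subdivisions of 3-connected graphs: a set of
  vertices with at most two neighbours outside either contains no big vertex or has all of them in its
  closed neighbourhood. Among all pairs of such a good \<open>U\<close> and a copy of \<open>T\<close> outside \<open>U\<close>, take one that
  maximises \<open>\<Sum>u\<in>U. deg u - 2\<close> and then minimises \<open>|U|\<close>. If \<open>U\<close> and the copy cover \<open>G\<close>, all vertices of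
  \<open>U\<close> are big and \<open>U\<close> is 3-connected. Otherwise a vertex outside \<open>U\<close> that some copy avoids
  has at most one neighbour in \<open>U\<close>, or the same two neighbours as some vertex of \<open>U\<close> of degree 2: anything
  else could be added to \<open>U\<close> or swapped in. Hence degrees in \<open>G - U\<close> are at least \<open>t + 1\<close> off any copy, and
  then a spider has so many embeddings into \<open>G - U\<close> that no vertex lies in all of them, so this bound
  applies to all vertices. By 3-connectivity there is an ear of \<open>U\<close> whose ends are not on one
  subdivided edge; a shortest one leaves degrees at least \<open>t\<close> in the rest of \<open>G - U\<close>, which therefore
  still contains a copy of \<open>T\<close>, and adding the ear to \<open>U\<close> contradicts maximality. A first pair
  \<open>U\<close>, \<open>T\<close> comes from induction on \<open>T\<close>: remove a copy of \<open>T\<close> minus a leaf, and if removing one more vertex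
  destroys 3-connectivity, a minimal fragment of the remainder together with a path joining its two
  attachment vertices is good.
\<close>

section \<open>Subdivisions of 3-connected graphs\<close>

text \<open>Subgraphs that are themselves 3-connected are too rigid to grow: adding a path to one
  rarely keeps 3-connectivity. Admitting vertices of degree 2 makes the class closed under ears, and
  the potential does not see how often an edge is subdivided. Bipartiteness enters twice. A vertex
  has neighbours in only one colour class of a copy, hence at most \<open>t\<close> of them, and
  there are no triangles. The 3 in \<open>t + 3\<close> is what the growing subgraph may cost: at
  most two neighbours in \<open>U\<close> leave \<open>t + 1\<close>, at most three in
  \<open>U\<close> plus a shortest ear leave \<open>t\<close>, which is the greedy bound for
  embedding the spider. It also leaves minimum degree 3 beside any copy, as the starting subgraph
  requires. The obstacle is that a vertex contained in every copy escapes the degree argument. The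
  surplus of \<open>t + 1\<close> over \<open>t\<close> removes it: the vertices common to all
  copies would form an initial part of the legs of each copy, a vertex outside a copy would see only
  the tips of that part, and a new copy could be centred beside it.\<close>

locale bip_graph =
  fixes V :: "'v set" and adj :: "'v \<Rightarrow> 'v \<Rightarrow> bool" and col :: "'v \<Rightarrow> bool"
  assumes finite_V: "finite V"
    and adj_sym: "adj u v \<Longrightarrow> adj v u"
    and adj_col: "adj u v \<Longrightarrow> col u \<noteq> col v"
begin

definition nb :: "'v set \<Rightarrow> 'v \<Rightarrow> 'v set" where
  "nb U v = {u \<in> U. adj v u}"

definition bd :: "'v set \<Rightarrow> 'v set \<Rightarrow> 'v set" where
  "bd U A = {u \<in> U - A. \<exists>a\<in>A. adj a u}"

definition big :: "'v set \<Rightarrow> 'v set" where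
  "big U = {u \<in> U. 3 \<le> card (nb U u)}"

text \<open>A thread consists of inner vertices of one subdivided edge.\<close>

definition thr :: "'v set \<Rightarrow> 'v set \<Rightarrow> bool" where
  "thr U F \<longleftrightarrow> F \<subseteq> U \<and> F \<noteq> {} \<and> F \<inter> big U = {} \<and> card (bd U F) \<le> 2"

text \<open>Besides its size bound: no cut vertex; a separation by two vertices has all big vertices
  in one closed side; and no vertex attaches twice to a thread. As a thread need not be connected,
  the last clause forbids two disjoint threads with the same two ends.\<close>

definition good :: "'v set \<Rightarrow> bool" where
  "good U \<longleftrightarrow> U \<subseteq> V \<and> 3 \<le> card (big U) \<and>
    (\<forall>F. F \<subseteq> U \<longrightarrow> F \<noteq> {} \<longrightarrow> card (bd U F) \<le> 1 \<longrightarrow> F \<union> bd U F = U) \<and>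
    (\<forall>F. F \<subseteq> U \<longrightarrow> card (bd U F) \<le> 2 \<longrightarrow> F \<inter> big U = {} \<or> big U \<subseteq> F \<union> bd U F) \<and>
    (\<forall>F x. thr U F \<longrightarrow> x \<in> U - F \<longrightarrow> card (nb F x) \<le> 1)"

text \<open>Twice the number of edges minus twice the number of vertices of the induced subgraph.
  Vertices of degree 2 contribute nothing, so the lengths of threads do not matter; integers avoid
  truncated subtraction.\<close>

definition pot :: "'v set \<Rightarrow> int" where
  "pot U = (\<Sum>u\<in>U. int (card (nb U u)) - 2)"

section \<open>Boundaries and threads: elementary facts\<close>

lemma fin: "U \<subseteq> V \<Longrightarrow> finite U"
  using finite_V finite_subset by blast

lemma finite_nb: "finite U \<Longrightarrow> finite (nb U v)"
  by (simp add: nb_def)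

lemma finite_bd: "finite U \<Longrightarrow> finite (bd U A)"
  by (simp add: bd_def)

lemma nb_mono: "U \<subseteq> U' \<Longrightarrow> nb U v \<subseteq> nb U' v"
  by (auto simp: nb_def)

lemma big_mono: "U \<subseteq> U' \<Longrightarrow> finite U' \<Longrightarrow> big U \<subseteq> big U'"
  using card_mono[OF finite_nb nb_mono] order_trans unfolding big_def by blast

lemma goodD:
  assumes "good U"
  shows "U \<subseteq> V" "finite U" "3 \<le> card (big U)"
    "\<And>F. F \<subseteq> U \<Longrightarrow> F \<noteq> {} \<Longrightarrow> card (bd U F) \<le> 1 \<Longrightarrow> F \<union> bd U F = U"
    "\<And>F. F \<subseteq> U \<Longrightarrow> card (bd U F) \<le> 2 \<Longrightarrow> F \<inter> big U = {} \<or> big U \<subseteq> F \<union> bd U F"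
    "\<And>F x. thr U F \<Longrightarrow> x \<in> U - F \<Longrightarrow> card (nb F x) \<le> 1"
  using assms unfolding good_def by (simp_all add: fin)

lemma bd_compl: "bd U (U - A - bd U A) \<subseteq> bd U A"
  using adj_sym by (auto simp: bd_def)

text \<open>Uncrossing: a vertex in either boundary on the left lies in \<open>bd U A\<close> or
  \<open>bd U B\<close>, and a vertex in both of them lies in both.\<close>

lemma bd_submodular:
  assumes "finite U"
  shows "card (bd U (A \<union> B)) + card (bd U (A \<inter> B)) \<le> card (bd U A) + card (bd U B)"
proof -
  have f: "finite (bd U X)" for X by (simp add: assms finite_bd)
  have "card (bd U (A \<union> B)) + card (bd U (A \<inter> B))
      = card (bd U (A \<union> B) \<union> bd U (A \<inter> B)) + card (bd U (A \<union> B) \<inter> bd U (A \<inter> B))"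
    by (rule card_Un_Int) (use f in auto)
  also have "\<dots> \<le> card (bd U A \<union> bd U B) + card (bd U A \<inter> bd U B)"
    by (intro add_mono card_mono) (use f in \<open>auto simp: bd_def\<close>)
  also have "\<dots> = card (bd U A) + card (bd U B)"
    by (rule card_Un_Int[symmetric]) (use f in auto)
  finally show ?thesis .
qed

text \<open>With a boundary of at most one vertex the set and its boundary would be all of
  \<open>U\<close>, so that single vertex would have to account for all of the at least three big
  vertices.\<close>

lemma nobig_bd:
  assumes "good U" "F \<subseteq> U" "F \<noteq> {}" "F \<inter> big U = {}"
  shows "2 \<le> card (bd U F)"
proof (rule ccontr)
  assume n: "\<not> 2 \<le> card (bd U F)"
  then have "F \<union> bd U F = U" using goodD(4)[OF assms(1-3)] by simp
  then have "big U \<subseteq> bd U F" using assms(4) unfolding big_def by blast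
  then have "card (big U) \<le> card (bd U F)" using card_mono finite_bd goodD(2)[OF assms(1)] by blast
  then show False using n goodD(3)[OF assms(1)] by simp
qed

lemma thr_bd: "good U \<Longrightarrow> thr U F \<Longrightarrow> card (bd U F) = 2"
  using nobig_bd unfolding thr_def by (simp add: le_antisym)

text \<open>The intersection is free of big vertices and so has boundary at least 2; submodularity
  leaves at most 2 + 2 - 2 for the union.\<close>

lemma thr_Un:
  assumes "good U" "thr U A" "thr U B" "A \<inter> B \<noteq> {}"
  shows "thr U (A \<union> B)"
proof -
  have "2 \<le> card (bd U (A \<inter> B))"
    by (rule nobig_bd) (use assms in \<open>auto simp: thr_def\<close>)
  then have "card (bd U (A \<union> B)) \<le> 2"
    using bd_submodular[of U A B] thr_bd[OF assms(1,2)] thr_bd[OF assms(1,3)] goodD(2)[OF assms(1)]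
    by simp
  then show ?thesis using assms by (auto simp: thr_def)
qed

text \<open>An end of degree 2 has one neighbour in the thread, hence at most one outside. Absorbing
  it exchanges one boundary vertex for at most one other.\<close>

lemma thr_insert:
  assumes g: "good U" and t: "thr U F" and f: "f \<in> bd U F" "f \<notin> big U"
  shows "thr U (insert f F)"
proof -
  have fU: "finite U" using g goodD by blast
  have fu: "f \<in> U" using f by (auto simp: bd_def)
  have c2: "card (nb U f) \<le> 2" using f fu unfolding big_def by auto
  obtain a where a: "a \<in> F" "adj f a" using f adj_sym unfolding bd_def by blast
  have "a \<in> nb U f" using a t unfolding nb_def thr_def by auto
  then have "card (nb U f - {a}) \<le> 1" using c2 fU by (simp add: finite_nb)
  moreover have "card (nb U f - F) \<le> card (nb U f - {a})"
    using a fU by (intro card_mono) (auto simp: finite_nb)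
  ultimately have c1: "card (nb U f - F) \<le> 1" by simp
  have "card (bd U F - {f}) = 1" using thr_bd[OF g t] f fU finite_bd by simp
  moreover have "card (bd U (insert f F)) \<le> card ((bd U F - {f}) \<union> (nb U f - F))"
    using fU by (intro card_mono) (auto simp: bd_def nb_def)
  ultimately have "card (bd U (insert f F)) \<le> 2"
    using c1 card_Un_le[of "bd U F - {f}" "nb U f - F"] by linarith
  then show ?thesis using t f fu by (auto simp: thr_def)
qed

lemma good_deg2:
  assumes "good U" "u \<in> U"
  shows "2 \<le> card (nb U u)"
proof (cases "u \<in> big U")
  case True then show ?thesis by (simp add: big_def)
next
  case False
  have "card (bd U {u}) \<le> card (nb U u)"
    using goodD(2)[OF assms(1)] by (intro card_mono finite_nb) (auto simp: bd_def nb_def)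
  moreover have "2 \<le> card (bd U {u})"
    by (rule nobig_bd[OF assms(1)]) (use False assms in auto)
  ultimately show ?thesis by simp
qed

text \<open>The path \<open>v 1, \<dots>, v l\<close> is an ear attached to \<open>U\<close> at \<open>v 0\<close> and \<open>v (l + 1)\<close>.\<close>

lemma path_fragment:
  assumes U': "U' = U \<union> v ` {1..l}" and fU: "finite U"
    and P: "\<And>i. 1 \<le> i \<Longrightarrow> i \<le> l \<Longrightarrow> v i \<notin> U" and e: "v 0 \<in> U" "v (Suc l) \<in> U"
    and step: "\<And>i. i \<le> l \<Longrightarrow> adj (v i) (v (Suc i))" and inj: "inj_on v {0..Suc l}"
    and ind: "\<And>i j. 1 \<le> i \<Longrightarrow> i \<le> l \<Longrightarrow> j \<le> Suc l \<Longrightarrow> adj (v i) (v j) \<Longrightarrow> j = Suc i \<or> i = Suc j"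
    and Z: "Z \<subseteq> v ` {1..l}" "Z \<noteq> {}"
  shows "2 \<le> card (bd U' Z)"
    and "card (bd U' Z) \<le> 2 \<Longrightarrow> Z \<inter> big U' = {}"
    and "card (bd U' Z) \<le> 2 \<Longrightarrow> x \<in> U' - Z \<Longrightarrow> card (nb Z x) \<le> 1"
proof -
  have injD: "a = b" if "v a = v b" "a \<le> Suc l" "b \<le> Suc l" for a b
    using inj that unfolding inj_on_def by simp
  define I where "I = {i \<in> {1..l}. v i \<in> Z}"
  have ZI: "Z = v ` I" using Z unfolding I_def by auto
  have I: "finite I" "I \<noteq> {}" using Z unfolding I_def by auto
  \<comment> \<open>The predecessor of the first index in \<open>Z\<close> and the successor of the
    last one are two distinct boundary vertices. A boundary of size at most 2 therefore consists of
    these, so vertices of \<open>Z\<close> have all their neighbours on the path.\<close>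
  define i where "i = Min I"
  define j where "j = Max I"
  have i: "i \<in> I" "\<And>k. k \<in> I \<Longrightarrow> i \<le> k" and j: "j \<in> I" "\<And>k. k \<in> I \<Longrightarrow> k \<le> j"
    using I unfolding i_def j_def by auto
  have Il: "1 \<le> k" "k \<le> l" "v k \<in> Z" if "k \<in> I" for k using that unfolding I_def by auto
  have ij: "1 \<le> i" "i \<le> j" "j \<le> l" using i(2)[OF j(1)] Il(1)[OF i(1)] Il(2)[OF j(1)] by auto
  have inU: "v k \<in> U'" if "k \<le> Suc l" for k
  proof -
    consider "k = 0" | "k = Suc l" | "k \<in> {1..l}" using \<open>k \<le> Suc l\<close> by fastforce
    then show ?thesis using e unfolding U' by cases auto
  qed
  have notZ: "v k \<notin> Z" if k: "k \<le> Suc l" "k \<notin> I" for k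
  proof
    assume "v k \<in> Z"
    then obtain m where m: "m \<in> I" "v k = v m" unfolding ZI by auto
    then have "k = m" using injD k(1) Il(2)[OF m(1)] by simp
    then show False using m k by simp
  qed
  have s1: "adj (v i) (v (i - 1))" using step[of "i - 1"] ij adj_sym by simp
  have s2: "adj (v j) (v (Suc j))" using step[of j] ij by simp
  have n1: "i - 1 \<notin> I" using i(2)[of "i - 1"] ij by linarith
  have n2: "Suc j \<notin> I" using j(2)[of "Suc j"] by linarith
  have b1: "v (i - 1) \<in> bd U' Z"
    using inU[of "i - 1"] notZ[OF _ n1] s1 Il(3)[OF i(1)] ij unfolding bd_def by fastforce
  have b2: "v (Suc j) \<in> bd U' Z"
    using inU[of "Suc j"] notZ[OF _ n2] s2 Il(3)[OF j(1)] ij unfolding bd_def by fastforce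
  have ne: "v (i - 1) \<noteq> v (Suc j)" using injD[of "i - 1" "Suc j"] ij by linarith
  have fU': "finite U'" using fU U' by simp
  have fb: "finite (bd U' Z)" using fU' by (rule finite_bd)
  have c2: "card {v (i - 1), v (Suc j)} = 2" using ne by simp
  have sub: "{v (i - 1), v (Suc j)} \<subseteq> bd U' Z" using b1 b2 by simp
  show "2 \<le> card (bd U' Z)" using card_mono[OF fb sub] c2 by simp
  have beq: "bd U' Z = {v (i - 1), v (Suc j)}" if "card (bd U' Z) \<le> 2"
    using card_seteq[OF fb sub] that c2 by simp
  show "Z \<inter> big U' = {}" if le: "card (bd U' Z) \<le> 2"
  proof -
    have "card (nb U' z) \<le> 2" if z: "z \<in> Z" for z
    proof -
      obtain k where k: "k \<in> I" "z = v k" using z ZI by auto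
      have "nb U' z \<subseteq> {v (k - 1), v (Suc k)}"
      proof
        fix y assume y: "y \<in> nb U' z"
        then have "y \<in> Z \<union> bd U' Z" using z unfolding nb_def bd_def by auto
        then have "\<exists>m \<le> Suc l. y = v m"
        proof
          assume "y \<in> Z"
          then obtain m where "m \<in> I" "y = v m" using ZI by auto
          then show ?thesis using Il(2)[of m] le_SucI by blast
        next
          assume "y \<in> bd U' Z"
          then have "y = v (i - 1) \<or> y = v (Suc j)" using beq[OF le] by blast
          moreover have "i - 1 \<le> Suc l" "Suc j \<le> Suc l" using ij by auto
          ultimately show ?thesis by blast
        qed
        then obtain m where m: "m \<le> Suc l" "y = v m" by auto
        have "adj (v k) (v m)" using y k m unfolding nb_def by auto
        then show "y \<in> {v (k - 1), v (Suc k)}" using ind[OF Il(1,2)[OF k(1)] m(1)] m by auto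
      qed
      then have "card (nb U' z) \<le> card {v (k - 1), v (Suc k)}" by (intro card_mono) auto
      also have "\<dots> \<le> 2" by (simp add: card_insert_if)
      finally show ?thesis .
    qed
    then show ?thesis unfolding big_def by fastforce
  qed
  show "card (nb Z x) \<le> 1" if le: "card (bd U' Z) \<le> 2" and x: "x \<in> U' - Z"
  proof (cases "nb Z x = {}")
    case False
    then obtain z where z: "z \<in> nb Z x" by auto
    then have "x \<in> bd U' Z" using x adj_sym unfolding nb_def bd_def by auto
    then have "x = v (i - 1) \<or> x = v (Suc j)" using beq[OF le] by blast
    then have "nb Z x \<subseteq> {v i} \<or> nb Z x \<subseteq> {v j}"
    proof
      assume 1: "x = v (i - 1)"
      have "nb Z x \<subseteq> {v i}"
      proof
        fix y assume "y \<in> nb Z x"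
        then obtain k where k: "k \<in> I" "y = v k" "adj (v k) (v (i - 1))"
          using 1 adj_sym unfolding nb_def ZI by auto
        have "i - 1 = Suc k \<or> k = Suc (i - 1)"
          by (rule ind[OF Il(1,2)[OF k(1)] _ k(3)]) (use ij in linarith)
        then have "k = i" using i(2)[OF k(1)] ij by linarith
        then show "y \<in> {v i}" using k by simp
      qed
      then show ?thesis by simp
    next
      assume 2: "x = v (Suc j)"
      have "nb Z x \<subseteq> {v j}"
      proof
        fix y assume "y \<in> nb Z x"
        then obtain k where k: "k \<in> I" "y = v k" "adj (v k) (v (Suc j))"
          using 2 adj_sym unfolding nb_def ZI by auto
        have "Suc j = Suc k \<or> k = Suc (Suc j)"
          by (rule ind[OF Il(1,2)[OF k(1)] _ k(3)]) (use ij in linarith)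
        then have "k = j" using j(2)[OF k(1)] by linarith
        then show "y \<in> {v j}" using k by simp
      qed
      then show ?thesis by simp
    qed
    then show ?thesis using card_mono[of "{v i}" "nb Z x"] card_mono[of "{v j}" "nb Z x"] by auto
  qed simp
qed

section \<open>Two operations that preserve goodness: adding an ear, replacing a thread\<close>

lemma bd_Int_sub: "U \<subseteq> U' \<Longrightarrow> bd U (A \<inter> U) \<subseteq> bd U' A \<inter> U"
  by (auto simp: bd_def)

text \<open>Consider a separation of \<open>U'\<close> by at most two vertices. If at most one of
  them lies in \<open>U\<close>, then one side lies inside the path and \<open>path_fragment\<close>
  applies. Otherwise both lie in \<open>U\<close>, the path is on one side, and the trace on
  \<open>U\<close> is a separation of \<open>U\<close>. Path vertices may have further neighbours in
  \<open>U\<close>, so \<open>nothr\<close> speaks of neighbours of any of them.\<close>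

lemma ear_good:
  assumes g: "good U" and U': "U' = U \<union> v ` {1..l}" and l: "1 \<le> l"
    and P: "\<And>i. 1 \<le> i \<Longrightarrow> i \<le> l \<Longrightarrow> v i \<in> V - U" and e: "v 0 \<in> U" "v (Suc l) \<in> U"
    and step: "\<And>i. i \<le> l \<Longrightarrow> adj (v i) (v (Suc i))" and inj: "inj_on v {0..Suc l}"
    and ind: "\<And>i j. 1 \<le> i \<Longrightarrow> i \<le> l \<Longrightarrow> j \<le> Suc l \<Longrightarrow> adj (v i) (v j) \<Longrightarrow> j = Suc i \<or> i = Suc j"
    and nothr: "\<And>F. thr U F \<Longrightarrow> \<exists>u\<in>U. \<exists>i. 1 \<le> i \<and> i \<le> l \<and> adj (v i) u \<and> u \<notin> F \<union> bd U F"
  shows "good U'" and "pot U < pot U'"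
proof -
  let ?P = "v ` {1..l}"
  have fU: "finite U" and UV: "U \<subseteq> V" using goodD[OF g] by auto
  have sub: "U \<subseteq> U'" and fU': "finite U'" and PU: "?P \<inter> U = {}" using fU U' P by auto
  have P': "\<And>i. 1 \<le> i \<Longrightarrow> i \<le> l \<Longrightarrow> v i \<notin> U" using P by blast
  have pf1: "2 \<le> card (bd U' Z)" if "Z \<subseteq> ?P" "Z \<noteq> {}" for Z
    by (rule path_fragment(1)[of U' U v l, OF U' fU P' e step inj ind that])
  have pf2: "Z \<inter> big U' = {}" if "Z \<subseteq> ?P" "card (bd U' Z) \<le> 2" for Z
  proof (cases "Z = {}")
    case False
    show ?thesis by (rule path_fragment(2)[of U' U v l, OF U' fU P' e step inj ind that(1) False that(2)])
  qed simp
  have pf3: "card (nb Z x) \<le> 1" if "Z \<subseteq> ?P" "card (bd U' Z) \<le> 2" "x \<in> U' - Z" for Z x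
  proof (cases "Z = {}")
    case False
    show ?thesis by (rule path_fragment(3)[of U' U v l, OF U' fU P' e step inj ind that(1) False that(2,3)])
  qed (simp add: nb_def)
  have bigm: "big U \<subseteq> big U'" using big_mono[OF sub fU'] .
  have fb: "finite (bd U' A)" for A using fU' finite_bd by blast
  have bs: "bd U (A \<inter> U) \<subseteq> bd U' A \<inter> U" for A using bd_Int_sub[OF sub] .
  have cbs: "card (bd U (A \<inter> U)) \<le> card (bd U' A \<inter> U)" for A
    using bs fb by (simp add: card_mono)
  have conn: "?P \<subseteq> A" if A: "A \<inter> ?P \<noteq> {}" "bd U' A \<inter> ?P = {}" for A
  proof -
    obtain k0 where k0: "1 \<le> k0" "k0 \<le> l" "v k0 \<in> A" using A by auto
    have nxt: "v y \<in> A" if "v x \<in> A" "adj (v x) (v y)" "1 \<le> y" "y \<le> l" for x y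
    proof (rule ccontr)
      assume "v y \<notin> A"
      then have "v y \<in> bd U' A \<inter> ?P" using that unfolding bd_def U' by auto
      then show False using A by blast
    qed
    have up: "k \<le> l \<Longrightarrow> v k \<in> A" if "k0 \<le> k" for k
      using that
    proof (induction k rule: dec_induct)
      case (step n) then show ?case using nxt[of n "Suc n"] assms(7)[of n] k0 by simp
    qed (use k0 in simp)
    have down: "1 \<le> k \<Longrightarrow> v k \<in> A" if "k \<le> k0" for k
      using that
    proof (induction k rule: inc_induct)
      case (step n) then show ?case using nxt[of "Suc n" n] adj_sym[OF assms(7)[of n]] k0 by simp
    qed (use k0 in simp)
    show ?thesis using up down by (meson atLeastAtMost_iff image_subsetI nle_le)
  qed
  have one: "A \<inter> U = {} \<or> (U' - A - bd U' A) \<inter> U = {}" if "card (bd U' A \<inter> U) \<le> 1" for A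
  proof (cases "A \<inter> U = {}")
    case False
    then have "A \<inter> U \<union> bd U (A \<inter> U) = U"
      using goodD(4)[OF g, of "A \<inter> U"] cbs[of A] that by simp
    then show ?thesis using bs[of A] by blast
  qed simp
  have cc: "card (bd U' (U' - A - bd U' A)) \<le> card (bd U' A)" for A
    by (intro card_mono fb bd_compl)
  have two: "bd U' A \<subseteq> U" if "\<not> card (bd U' A \<inter> U) \<le> 1" "card (bd U' A) \<le> 2" for A
  proof -
    have "card (bd U' A) \<le> card (bd U' A \<inter> U)" using that by simp
    then have "bd U' A \<inter> U = bd U' A" using card_seteq[OF fb, of "bd U' A \<inter> U" A] by simp
    then show ?thesis by blast
  qed
  \<comment> \<open>A side that contains the path and has no big vertex of \<open>U\<close> would
    leave on \<open>U\<close> a thread with the same boundary, whereas \<open>nothr\<close> provides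
    an edge from the path to a vertex outside the closure of that thread.\<close>
  have thread: "False" if A: "?P \<subseteq> A" "bd U' A \<subseteq> U" "card (bd U' A) \<le> 2" "A \<inter> U \<inter> big U = {}"
      "A \<inter> U \<noteq> {}" for A
  proof -
    have t: "thr U (A \<inter> U)"
      unfolding thr_def using A cbs[of A] card_mono[OF fb, of "bd U' A \<inter> U" A] by auto
    then have "card (bd U (A \<inter> U)) = 2" by (rule thr_bd[OF g])
    moreover have "bd U (A \<inter> U) \<subseteq> bd U' A" using bs by blast
    ultimately have eq: "bd U (A \<inter> U) = bd U' A" using card_seteq[OF fb] A(3) by simp
    obtain u i where u: "u \<in> U" "1 \<le> i" "i \<le> l" "adj (v i) u" "u \<notin> A \<inter> U \<union> bd U (A \<inter> U)"
      using nothr[OF t] by blast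
    have "v i \<in> ?P" using u by simp
    then have "v i \<in> A" using A(1) by blast
    then have "u \<in> A \<union> bd U' A" using u sub unfolding bd_def by auto
    then show False using u eq by auto
  qed
  have PA: "?P \<subseteq> A \<or> ?P \<inter> A = {}" if "bd U' A \<subseteq> U" for A
    using conn[of A] that PU by blast
  have G1: "A \<union> bd U' A = U'" if A: "A \<subseteq> U'" "A \<noteq> {}" "card (bd U' A) \<le> 1" for A
  proof (rule ccontr)
    assume n: "A \<union> bd U' A \<noteq> U'"
    let ?B = "U' - A - bd U' A"
    have "?B \<noteq> {}" using n A by (auto simp: bd_def)
    have "card (bd U' A \<inter> U) \<le> 1" using A(3) card_mono[OF fb, of "bd U' A \<inter> U" A] by simp
    then consider "A \<inter> U = {}" | "?B \<inter> U = {}" using one by blast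
    then show False
    proof cases
      case 1
      then have "A \<subseteq> ?P" using A U' by blast
      then show False using pf1[of A] A by simp
    next
      case 2
      then have "?B \<subseteq> ?P" using U' by blast
      then show False using pf1[of ?B] \<open>?B \<noteq> {}\<close> cc[of A] A(3) by simp
    qed
  qed
  have G2: "A \<inter> big U' = {} \<or> big U' \<subseteq> A \<union> bd U' A" if A: "A \<subseteq> U'" "card (bd U' A) \<le> 2" for A
  proof (rule ccontr)
    assume n: "\<not> ?thesis"
    let ?B = "U' - A - bd U' A"
    have B: "?B \<inter> big U' \<noteq> {}" using n by (auto simp: big_def)
    show False
    proof (cases "card (bd U' A \<inter> U) \<le> 1")
      case True
      then consider "A \<inter> U = {}" | "?B \<inter> U = {}" using one by blast
      then show False
      proof cases
        case 1
        then have "A \<subseteq> ?P" using A U' by blast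
        then show False using pf2[of A] A n by blast
      next
        case 2
        then have "?B \<subseteq> ?P" using U' by blast
        then show False using pf2[of ?B] B cc[of A] A(2) by simp
      qed
    next
      case False
      \<comment> \<open>Stated for an arbitrary side \<open>Z\<close> that contains the path, since
        this can be \<open>A\<close> or the part of \<open>U'\<close> beyond its boundary.\<close>
      have key: False if Z: "Z \<subseteq> U'" "?P \<subseteq> Z" "bd U' Z \<subseteq> U" "card (bd U' Z) \<le> 2"
          "Z \<inter> big U' \<noteq> {}" "(U' - Z - bd U' Z) \<inter> big U' \<noteq> {}" for Z
      proof -
        let ?Z' = "U' - Z - bd U' Z"
        have Z'U: "?Z' \<subseteq> U" using Z U' by blast
        obtain z where z: "z \<in> ?Z'" "z \<in> big U'" using Z by blast
        have zU: "z \<in> U" using z Z'U by blast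
        \<comment> \<open>Beyond the boundary of \<open>Z\<close> there are no edges to the path, so
          a vertex there that is big in \<open>U'\<close> was already big in
          \<open>U\<close>.\<close>
        have "nb U' z \<subseteq> nb U z"
        proof
          fix y assume y: "y \<in> nb U' z"
          then have "y \<notin> Z" using z adj_sym unfolding nb_def bd_def by blast
          then show "y \<in> nb U z" using y Z U' unfolding nb_def by blast
        qed
        then have "card (nb U' z) \<le> card (nb U z)" using card_mono[OF finite_nb[OF fU]] by blast
        then have zb: "z \<in> big U" using z zU unfolding big_def by simp
        have "z \<notin> (Z \<inter> U) \<union> bd U (Z \<inter> U)" using z bs[of Z] by blast
        moreover have "card (bd U (Z \<inter> U)) \<le> 2"
          using cbs[of Z] card_mono[OF fb, of "bd U' Z \<inter> U" Z] Z(4) by simp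
        ultimately have nb: "Z \<inter> U \<inter> big U = {}" using goodD(5)[OF g, of "Z \<inter> U"] zb by blast
        show False
        proof (cases "Z \<inter> U = {}")
          case True
          then have "Z \<subseteq> ?P" using Z U' by blast
          then show False using pf2[of Z] Z by blast
        next
          case False
          then show False using thread[of Z] Z nb by blast
        qed
      qed
      have S: "bd U' A \<subseteq> U" using two[OF False A(2)] .
      from PA[OF S] show False
      proof
        assume "?P \<subseteq> A"
        then show False using key[of A] A S n B by blast
      next
        assume "?P \<inter> A = {}"
        then have PB: "?P \<subseteq> ?B" using S PU U' by blast
        have bB: "bd U' ?B \<subseteq> bd U' A" by (rule bd_compl)
        have "A \<subseteq> U' - ?B - bd U' ?B"
        proof
          fix a assume a: "a \<in> A"
          then have "a \<notin> bd U' A" by (auto simp: bd_def)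
          then show "a \<in> U' - ?B - bd U' ?B" using a A bB by blast
        qed
        then have "(U' - ?B - bd U' ?B) \<inter> big U' \<noteq> {}" using n by blast
        then show False using key[of ?B] PB bB S cc[of A] A(2) B by auto
      qed
    qed
  qed
  have G3: "card (nb A x) \<le> 1" if A: "thr U' A" and x: "x \<in> U' - A" for A x
  proof -
    have A': "A \<subseteq> U'" "A \<noteq> {}" "A \<inter> big U' = {}" "card (bd U' A) \<le> 2"
      using A unfolding thr_def by auto
    have nbig: "A \<inter> U \<inter> big U = {}" using A' bigm by blast
    show ?thesis
    proof (cases "A \<inter> U = {}")
      case True
      then have "A \<subseteq> ?P" using A' U' by blast
      then show ?thesis using pf3[of A x] A' x by blast
    next
      case False
      have t: "thr U (A \<inter> U)"
        unfolding thr_def using A' False nbig cbs[of A] card_mono[OF fb, of "bd U' A \<inter> U" A] by auto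
      have "card (bd U (A \<inter> U)) = 2" by (rule thr_bd[OF g t])
      then have c: "\<not> card (bd U' A \<inter> U) \<le> 1" using cbs[of A] by simp
      have S: "bd U' A \<subseteq> U" using two[OF c A'(4)] .
      from PA[OF S] show ?thesis
      proof
        assume "?P \<subseteq> A"
        then show ?thesis using thread[of A] A' S nbig False by blast
      next
        assume "?P \<inter> A = {}"
        then have AU: "A \<subseteq> U" using A' U' by blast
        show ?thesis
        proof (cases "x \<in> U")
          case True
          then show ?thesis using goodD(6)[OF g t, of x] x AU by (simp add: Int_absorb2)
        next
          case F: False
          have "nb A x = {}"
          proof (rule ccontr)
            assume "nb A x \<noteq> {}"
            then have "x \<in> bd U' A" using x adj_sym unfolding nb_def bd_def by blast
            then show False using S F by blast
          qed
          then show ?thesis by simp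
        qed
      qed
    qed
  qed
  have U'V: "U' \<subseteq> V" using UV P U' by auto
  have "3 \<le> card (big U')"
    using goodD(3)[OF g] card_mono[OF _ bigm] fU' by (simp add: big_def)
  then show "good U'" unfolding good_def using U'V G1 G2 G3 by blast
  have "pot U' = pot U + (\<Sum>u\<in>U. int (card (nb U' u)) - int (card (nb U u))) + (\<Sum>u\<in>?P. int (card (nb U' u)) - 2)"
  proof -
    have "pot U' = (\<Sum>u\<in>U. int (card (nb U' u)) - 2) + (\<Sum>u\<in>?P. int (card (nb U' u)) - 2)"
      unfolding pot_def using sum.union_disjoint[of U ?P "\<lambda>u. int (card (nb U' u)) - 2"] fU PU
      by (simp only: U') blast
    then show ?thesis unfolding pot_def by (simp add: sum_subtractf)
  qed
  moreover have "0 \<le> (\<Sum>u\<in>?P. int (card (nb U' u)) - 2)"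
  proof (rule sum_nonneg)
    fix u assume "u \<in> ?P"
    then have u: "{u} \<subseteq> ?P" by simp
    have "bd U' {u} \<subseteq> nb U' u" by (auto simp: bd_def nb_def)
    then have "card (bd U' {u}) \<le> card (nb U' u)" by (rule card_mono[OF finite_nb[OF fU']])
    then have "2 \<le> card (nb U' u)" using pf1[OF u] by simp
    then show "0 \<le> int (card (nb U' u)) - 2" by simp
  qed
  moreover have "0 < (\<Sum>u\<in>U. int (card (nb U' u)) - int (card (nb U u)))"
  proof (rule sum_pos2[OF fU e(1)])
    have "v 1 \<in> nb U' (v 0)" "v 1 \<notin> nb U (v 0)"
      using assms(7)[of 0] l P[of 1] U' by (auto simp: nb_def)
    then have "nb U (v 0) \<subset> nb U' (v 0)" using nb_mono[OF sub] by blast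
    then have "card (nb U (v 0)) < card (nb U' (v 0))" using psubset_card_mono finite_nb[OF fU'] by blast
    then show "0 < int (card (nb U' (v 0))) - int (card (nb U (v 0)))" by simp
    show "0 \<le> int (card (nb U' u)) - int (card (nb U u))" for u
      using card_mono[OF finite_nb[OF fU'] nb_mono[OF sub]] by simp
  qed
  ultimately show "pot U < pot U'" by linarith
qed

text \<open>The vertex \<open>w\<close> becomes a thread of one vertex with the same ends as
  \<open>M\<close>. By the last clause of \<open>good\<close> each end has exactly one neighbour in
  \<open>M\<close>, so exchanging it for \<open>w\<close> changes no degree in \<open>U - M\<close>;
  the vertices of \<open>M\<close> have degree 2 and count nothing in \<open>pot\<close>.\<close>

lemma swap_good:
  assumes g: "good U" and M: "thr U M" and w: "w \<in> V - U" and nbw: "nb (U - M) w = bd U M"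
    and U': "U' = insert w (U - M)"
  shows "good U'" "pot U' = pot U" "big U' = big U"
proof -
  have fU: "finite U" and UV: "U \<subseteq> V" using goodD[OF g] by auto
  have MU: "M \<subseteq> U" "M \<noteq> {}" "M \<inter> big U = {}" using M unfolding thr_def by auto
  have fU': "finite U'" using fU U' by simp
  have wU: "w \<notin> U" using w by simp
  have b2: "card (bd U M) = 2" by (rule thr_bd[OF g M])
  have Mne: "bd U M \<noteq> {}" using b2 by auto
  have adjw: "adj x w \<longleftrightarrow> x \<in> bd U M" "adj w x \<longleftrightarrow> x \<in> bd U M" if "x \<in> U - M" for x
    using nbw that adj_sym unfolding nb_def by blast+
  have bdM: "bd U M \<subseteq> U - M" by (auto simp: bd_def)
  have nM: "nb M x \<noteq> {} \<longleftrightarrow> x \<in> bd U M" if "x \<in> U - M" for x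
    using that adj_sym unfolding nb_def bd_def by blast
  have cM: "card (nb M x) \<le> 1" if "x \<in> U - M" for x
    using goodD(6)[OF g M that] .
  have fM: "finite M" using MU fU finite_subset by blast
  have dg: "card (nb U' x) = card (nb U x)" if x: "x \<in> U - M" for x
  proof -
    have 1: "nb U x = nb (U - M) x \<union> nb M x" "nb (U - M) x \<inter> nb M x = {}"
      using MU by (auto simp: nb_def)
    have 2: "nb U' x = nb (U - M) x \<union> (if x \<in> bd U M then {w} else {})"
      using adjw[OF x] unfolding U' nb_def by auto
    have 3: "card (nb M x) = (if x \<in> bd U M then 1 else 0)"
      using cM[OF x] nM[OF x] fM finite_nb[of M x] by (auto simp: le_Suc_eq)
    have "card (nb U x) = card (nb (U - M) x) + card (nb M x)"
      unfolding 1(1) using 1(2) fU fM by (simp add: card_Un_disjoint finite_nb)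
    moreover have "card (nb U' x) = card (nb (U - M) x) + card (if x \<in> bd U M then {w} else {})"
      unfolding 2 by (rule card_Un_disjoint) (use fU wU in \<open>auto simp: finite_nb nb_def\<close>)
    ultimately show ?thesis using 3 by simp
  qed
  have nww: "nb U' w = bd U M"
    using nbw adj_col unfolding U' nb_def by auto
  have dM: "card (nb U x) = 2" if "x \<in> M" for x
    using good_deg2[OF g, of x] that MU unfolding big_def by fastforce
  show bg: "big U' = big U"
  proof -
    have "w \<notin> big U'" using nww b2 by (simp add: big_def)
    then have "big U' = {x \<in> U - M. 3 \<le> card (nb U' x)}" unfolding big_def U' by blast
    also have "\<dots> = {x \<in> U - M. 3 \<le> card (nb U x)}" using dg by auto
    also have "\<dots> = big U" using MU(3) unfolding big_def by blast
    finally show ?thesis .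
  qed
  show "pot U' = pot U"
  proof -
    have "pot U = (\<Sum>u\<in>U - M. int (card (nb U u)) - 2) + (\<Sum>u\<in>M. int (card (nb U u)) - 2)"
      unfolding pot_def using sum.subset_diff[OF MU(1) fU] by blast
    moreover have "(\<Sum>u\<in>M. int (card (nb U u)) - 2) = 0" using dM by simp
    moreover have "pot U' = (\<Sum>u\<in>U - M. int (card (nb U' u)) - 2) + (int (card (nb U' w)) - 2)"
      unfolding pot_def using fU wU by (subst (1) U') simp
    ultimately show ?thesis using dg nww b2 by simp
  qed
  \<comment> \<open>Translates a set of \<open>U'\<close> back to \<open>U\<close> without enlarging
    its boundary: \<open>M\<close> stands for \<open>w\<close>. If \<open>w\<close> is missing but
    both ends of \<open>M\<close> are in \<open>A\<close>, then \<open>w\<close> is a boundary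
    vertex, and absorbing \<open>M\<close> saves it. If only one end is in \<open>A\<close>, this
    end has at most one neighbour in \<open>M\<close>, which is paid for by
    \<open>w\<close>.\<close>
  define L where "L A = (if w \<in> A then A - {w} \<union> M else if bd U M \<subseteq> A then A \<union> M else A)" for A
  have fb: "finite (bd U' A)" for A using fU' finite_bd by blast
  have LU: "L A \<subseteq> U" "A - {w} \<subseteq> L A" "L A \<subseteq> A \<union> M" "L A \<noteq> {} \<or> A = {}" if "A \<subseteq> U'" for A
    using that MU unfolding L_def U' by auto
  have Lbd: "bd U (L A) - M \<subseteq> bd U' A - {w}" if A: "A \<subseteq> U'" for A
  proof
    fix u assume u: "u \<in> bd U (L A) - M"
    then obtain a where a: "a \<in> L A" "adj a u" and uU: "u \<in> U - M" "u \<notin> L A" unfolding bd_def by blast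
    have uA: "u \<in> U' - A" "u \<noteq> w" using uU LU[OF A] wU U' by auto
    have "\<exists>a'\<in>A. adj a' u"
    proof (cases "a \<in> A")
      case False
      then have am: "a \<in> M" "w \<in> A \<or> bd U M \<subseteq> A" using a unfolding L_def by (auto split: if_splits)
      then have "u \<in> bd U M" using a uU unfolding bd_def by blast
      then show ?thesis using am uA adjw[OF uU(1)] by blast
    qed (use a in blast)
    then show "u \<in> bd U' A - {w}" using uA unfolding bd_def by blast
  qed
  have wb: "w \<in> bd U' A" if A: "A \<subseteq> U'" "w \<notin> A" "A \<inter> bd U M \<noteq> {}" for A
  proof -
    obtain a where a: "a \<in> A" "a \<in> bd U M" using A by blast
    then have "adj a w" using bdM adjw(1)[of a] by blast
    then show ?thesis using A a U' unfolding bd_def by blast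
  qed
  have Lc: "card (bd U (L A)) \<le> card (bd U' A)"
    "w \<notin> A \<Longrightarrow> bd U M \<subseteq> A \<Longrightarrow> card (bd U (L A)) < card (bd U' A)" if A: "A \<subseteq> U'" for A
  proof -
    note Lb = Lbd[OF A]
    have lt: "card (bd U' A - {w}) < card (bd U' A)" if "w \<in> bd U' A"
      using that fb by (intro psubset_card_mono) auto
    show 2: "card (bd U (L A)) < card (bd U' A)" if c: "w \<notin> A" "bd U M \<subseteq> A"
    proof -
      have "bd U (L A) \<inter> M = {}" using c unfolding L_def bd_def by auto
      then have "card (bd U (L A)) \<le> card (bd U' A - {w})" using Lb fb by (intro card_mono) auto
      moreover have "w \<in> bd U' A" using wb[OF A c(1)] c(2) b2 Mne by (simp add: Int_absorb1)
      ultimately show ?thesis using lt by simp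
    qed
    show "card (bd U (L A)) \<le> card (bd U' A)"
    proof (cases "w \<in> A")
      case True
      then have "bd U (L A) \<inter> M = {}" unfolding L_def bd_def by auto
      then show ?thesis using Lb fb by (intro card_mono) auto
    next
      case wA: False
      show ?thesis
      proof (cases "bd U M \<subseteq> A")
        case True then show ?thesis using 2 wA by simp
      next
        case False
        then have LA: "L A = A" using wA unfolding L_def by simp
        have AU: "A \<subseteq> U - M" using A wA U' by blast
        show ?thesis
        proof (cases "A \<inter> bd U M = {}")
          case True
          have "bd U A \<inter> M = {}" using True AU adj_sym unfolding bd_def by blast
          then show ?thesis using Lb fb LA by (intro card_mono) auto
        next
          case ne: False
          obtain a where a: "a \<in> A" "a \<in> bd U M" using ne by blast
          have "card (A \<inter> bd U M) < card (bd U M)"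
            using False finite_bd[OF fU] by (intro psubset_card_mono) auto
          then have "card (A \<inter> bd U M) \<le> 1" using b2 by simp
          moreover have "finite (A \<inter> bd U M)" using finite_bd[OF fU] by blast
          ultimately have "\<forall>x\<in>A \<inter> bd U M. \<forall>y\<in>A \<inter> bd U M. x = y" using card_le_Suc0_iff_eq by auto
          then have s: "A \<inter> bd U M = {a}" using a by blast
          have "bd U A \<inter> M \<subseteq> nb M a"
          proof
            fix m assume m: "m \<in> bd U A \<inter> M"
            then obtain a' where a': "a' \<in> A" "adj a' m" unfolding bd_def by blast
            then have "a' \<in> bd U M" using AU m adj_sym unfolding bd_def by blast
            then have "a' \<in> A \<inter> bd U M" using a' by simp
            then have "a' = a" using s by simp
            then show "m \<in> nb M a" using a' m unfolding nb_def by simp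
          qed
          then have "card (bd U A \<inter> M) \<le> card (nb M a)" using finite_nb[OF fM] by (intro card_mono) auto
          then have c1: "card (bd U A \<inter> M) \<le> 1" using cM[of a] a AU by fastforce
          have "card (bd U A - M) \<le> card (bd U' A - {w})" using Lb fb LA by (intro card_mono) auto
          then have "card (bd U A - M) < card (bd U' A)" using lt wb[OF A wA ne] by simp
          moreover have "card (bd U A) = card (bd U A \<inter> M) + card (bd U A - M)"
            using finite_bd[OF fU] card_Int_Diff by metis
          ultimately show ?thesis using c1 LA by simp
        qed
      qed
    qed
  qed
  have G1: "A \<union> bd U' A = U'" if A: "A \<subseteq> U'" "A \<noteq> {}" "card (bd U' A) \<le> 1" for A
  proof -
    have "L A \<union> bd U (L A) = U" using goodD(4)[OF g LU(1)[OF A(1)]] LU(4)[OF A(1)] Lc(1)[OF A(1)] A by simp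
    then have sub: "U - M \<subseteq> A \<union> bd U' A" using LU(3)[OF A(1)] Lbd[OF A(1)] by blast
    have "w \<in> A \<union> bd U' A"
    proof (rule ccontr)
      assume nw: "w \<notin> A \<union> bd U' A"
      then have "A \<inter> bd U M = {}" using wb[OF A(1)] by blast
      then have "bd U M \<subseteq> bd U' A" using sub bdM by blast
      then have "card (bd U M) \<le> card (bd U' A)" using card_mono fb by blast
      then show False using b2 A by simp
    qed
    then show ?thesis using sub A(1) unfolding U' bd_def by blast
  qed
  have G2: "A \<inter> big U' = {} \<or> big U' \<subseteq> A \<union> bd U' A" if A: "A \<subseteq> U'" "card (bd U' A) \<le> 2" for A
  proof -
    have "L A \<inter> big U = {} \<or> big U \<subseteq> L A \<union> bd U (L A)"
      using goodD(5)[OF g LU(1)[OF A(1)]] Lc(1)[OF A(1)] A by simp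
    then show ?thesis
    proof
      assume "L A \<inter> big U = {}"
      then show ?thesis using LU(2)[OF A(1)] bg wU unfolding big_def by blast
    next
      assume "big U \<subseteq> L A \<union> bd U (L A)"
      then show ?thesis using LU(3)[OF A(1)] Lbd[OF A(1)] bg MU by blast
    qed
  qed
  have G3: "card (nb A x) \<le> 1" if A: "thr U' A" and x: "x \<in> U' - A" for A x
  proof -
    have A': "A \<subseteq> U'" "A \<noteq> {}" "A \<inter> big U' = {}" "card (bd U' A) \<le> 2"
      using A unfolding thr_def by auto
    have LAn: "L A \<inter> big U = {}" using LU(3)[OF A'(1)] A'(3) MU bg by blast
    have t: "thr U (L A)"
      unfolding thr_def using LU(1,4)[OF A'(1)] Lc(1)[OF A'(1)] A' LAn by auto
    show ?thesis
    proof (cases "x = w")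
      case True
      then have wA: "w \<notin> A" using x by simp
      have "nb A w \<subseteq> bd U M" using A' wA adjw(2) unfolding nb_def U' by blast
      moreover have "\<not> bd U M \<subseteq> A"
      proof
        assume "bd U M \<subseteq> A"
        then have "card (bd U (L A)) < 2" using Lc(2)[OF A'(1) wA] A' by simp
        then show False using thr_bd[OF g t] by simp
      qed
      ultimately have "nb A w \<subset> bd U M" unfolding nb_def by blast
      then have "card (nb A w) < 2" using psubset_card_mono finite_bd[OF fU] b2 by metis
      then show ?thesis using True by simp
    next
      case False
      then have xU: "x \<in> U - M" "x \<notin> A" using x U' by auto
      then have xL: "x \<in> U - L A" using LU(3)[OF A'(1)] by blast
      have c1: "card (nb (L A) x) \<le> 1" using goodD(6)[OF g t xL] .
      have fL: "finite (L A)" using LU(1)[OF A'(1)] fU finite_subset by blast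
      show ?thesis
      proof (cases "w \<in> A")
        case True
        have "card (nb A x) \<le> card (nb (L A) x)"
        proof (cases "adj x w")
          case False
          then have "nb A x \<subseteq> nb (L A) x" using LU(2)[OF A'(1)] unfolding nb_def by blast
          then show ?thesis using card_mono finite_nb[OF fL] by blast
        next
          case aw: True
          then obtain m where m: "m \<in> M" "adj x m" using adjw(1)[OF xU(1)] adj_sym unfolding bd_def by blast
          have "nb A x \<subseteq> insert w (nb (L A) x - {m})"
            using LU(2)[OF A'(1)] m A' unfolding nb_def U' by blast
          then have "card (nb A x) \<le> card (insert w (nb (L A) x - {m}))"
            using finite_nb[OF fL] by (intro card_mono) auto
          also have "\<dots> \<le> Suc (card (nb (L A) x - {m}))" by (simp add: card_insert_le_m1 finite_nb fL card_insert_if)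
          also have "\<dots> = card (nb (L A) x)"
          proof (rule card.remove[OF finite_nb[OF fL], symmetric])
            show "m \<in> nb (L A) x" using m True unfolding L_def nb_def by auto
          qed
          finally show ?thesis .
        qed
        then show ?thesis using c1 by simp
      next
        case wA: False
        then have "nb A x \<subseteq> nb (L A) x" using LU(2)[OF A'(1)] unfolding nb_def by blast
        then have "card (nb A x) \<le> card (nb (L A) x)" using card_mono finite_nb[OF fL] by blast
        then show ?thesis using c1 by simp
      qed
    qed
  qed
  have "U' \<subseteq> V" using UV w U' by auto
  then show "good U'" unfolding good_def using G1 G2 G3 bg goodD(3)[OF g] by auto
qed

text \<open>Exchanging the twins \<open>w\<close> and \<open>f\<close> is an isomorphism between
  \<open>U'\<close> and \<open>U\<close> (the map \<open>s\<close> below). It carries threads of the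
  swapped subgraph back to threads of \<open>U\<close>.\<close>

lemma twin_thr:
  assumes U': "U' = insert w (U - {f})" and bg: "big U' = big U" and f: "f \<in> U" "w \<notin> U" "f \<notin> big U"
    and nbw: "nb (U - {f}) w = bd U {f}" and fU: "finite U" and F: "thr U' F"
  obtains F' where "thr U F'" "\<And>b. b \<in> U - {f} \<Longrightarrow> b \<in> F \<union> bd U' F \<Longrightarrow> b \<in> F' \<union> bd U F'"
    "w \<in> F \<union> bd U' F \<Longrightarrow> f \<in> F' \<union> bd U F'"
proof
  have F1: "F \<subseteq> U'" "F \<noteq> {}" "F \<inter> big U' = {}" "card (bd U' F) \<le> 2" using F unfolding thr_def by auto
  have ff: "\<not> adj f f" "\<not> adj w w" using adj_col by blast+
  have adjw: "adj w x \<longleftrightarrow> adj f x" "adj x w \<longleftrightarrow> adj x f" if "x \<in> U - {f}" for x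
    using nbw that adj_sym unfolding nb_def bd_def by blast+
  define s where "s x = (if x = w then f else x)" for x
  have inj: "inj_on s U'" using f unfolding s_def U' inj_on_def by auto
  have sim: "s ` U' = U" using f unfolding s_def U' by (auto split: if_splits)
  have sad: "adj (s x) (s y) \<longleftrightarrow> adj x y" if "x \<in> U'" "y \<in> U'" for x y
    using that adjw ff f unfolding s_def U' by auto
  have sF: "bd U (s ` F) = s ` bd U' F"
  proof
    show "bd U (s ` F) \<subseteq> s ` bd U' F"
    proof
      fix y assume "y \<in> bd U (s ` F)"
      then have y: "y \<in> s ` U'" "y \<notin> s ` F" "\<exists>a\<in>F. adj (s a) y" unfolding bd_def sim by auto
      then obtain x where x: "y = s x" "x \<in> U'" by (elim imageE)
      obtain a where a: "a \<in> F" "adj (s a) y" using y(3) by (elim bexE)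
      have "adj a x" using sad[of a x] a x F1(1) by auto
      moreover have "x \<notin> F" using y(2) x by auto
      ultimately have "x \<in> bd U' F" using a x unfolding bd_def by auto
      then show "y \<in> s ` bd U' F" using x by simp
    qed
    show "s ` bd U' F \<subseteq> bd U (s ` F)"
    proof
      fix y assume "y \<in> s ` bd U' F"
      then obtain x a where xa: "y = s x" "x \<in> U'" "x \<notin> F" "a \<in> F" "adj a x" unfolding bd_def by blast
      have "s x \<notin> s ` F" using inj_on_image_mem_iff[OF inj xa(2) F1(1)] xa(3) by simp
      moreover have "s x \<in> U" using xa(2) sim by blast
      moreover have "adj (s a) (s x)" using sad[of a x] xa F1(1) by auto
      ultimately show "y \<in> bd U (s ` F)" using xa unfolding bd_def by auto
    qed
  qed
  have fb: "finite (bd U' F)" using fU U' finite_bd by simp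
  show "thr U (s ` F)"
    unfolding thr_def sF
  proof (intro conjI)
    show "s ` F \<subseteq> U" using sim F1 by blast
    show "s ` F \<noteq> {}" using F1 by blast
    show "s ` F \<inter> big U = {}" using F1 f bg unfolding s_def by auto
    show "card (s ` bd U' F) \<le> 2" using card_image_le[OF fb, of s] F1 by simp
  qed
  show "b \<in> s ` F \<union> bd U (s ` F)" if "b \<in> U - {f}" "b \<in> F \<union> bd U' F" for b
  proof -
    have "s b = b" using that f unfolding s_def by auto
    then show ?thesis using that(2) unfolding sF by (metis Un_iff imageI)
  qed
  show "f \<in> s ` F \<union> bd U (s ` F)" if "w \<in> F \<union> bd U' F"
  proof -
    have "s w = f" unfolding s_def by simp
    then show ?thesis using that unfolding sF by (metis Un_iff imageI)
  qed
qed

end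

section \<open>Ears\<close>

text \<open>Only the separation part of 3-connectivity; a single vertex satisfies it. The missing
  bound on the number of vertices is recovered from minimum degrees in
  \<open>k_connected_delete_verts\<close>.\<close>

definition (in bip_graph) conn3 :: "'v set \<Rightarrow> bool" where
  "conn3 H \<longleftrightarrow> (\<forall>F. F \<subseteq> H \<longrightarrow> F \<noteq> {} \<longrightarrow> card (bd H F) \<le> 2 \<longrightarrow> F \<union> bd H F = H)"

text \<open>\<open>l\<close> counts the inner vertices. Only a walk is required: a shortest ear has
  no repetitions and no chords at inner vertices anyway. The last clause excludes a path that merely
  runs parallel to a part of one subdivided edge.\<close>

definition (in bip_graph) ear :: "'v set \<Rightarrow> nat \<Rightarrow> (nat \<Rightarrow> 'v) \<Rightarrow> bool" where
  "ear U l v \<longleftrightarrow> 1 \<le> l \<and> v 0 \<in> U \<and> v (Suc l) \<in> U \<and> v 0 \<noteq> v (Suc l) \<and>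
    (\<forall>i. 1 \<le> i \<longrightarrow> i \<le> l \<longrightarrow> v i \<in> V - U) \<and> (\<forall>i\<le>l. adj (v i) (v (Suc i))) \<and>
    (\<forall>F. thr U F \<longrightarrow> \<not> {v 0, v (Suc l)} \<subseteq> F \<union> bd U F)"

section \<open>Shortening ears, and their existence\<close>

context bip_graph begin

lemma earD:
  assumes "ear U l v"
  shows "1 \<le> l" "v 0 \<in> U" "v (Suc l) \<in> U" "v 0 \<noteq> v (Suc l)"
    "\<And>i. 1 \<le> i \<Longrightarrow> i \<le> l \<Longrightarrow> v i \<in> V - U" "\<And>i. i \<le> l \<Longrightarrow> adj (v i) (v (Suc i))"
    "\<And>F. thr U F \<Longrightarrow> \<not> {v 0, v (Suc l)} \<subseteq> F \<union> bd U F"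
  using assms unfolding ear_def by auto

text \<open>The edge replaces the \<open>c - a - 1\<close> vertices strictly between its ends. An
  edge joining the two ends of the ear is excluded because no inner vertex would remain.\<close>

lemma ear_shortcut:
  assumes e: "ear U l v" and a: "adj (v a) (v c)" "Suc a < c" "c \<le> Suc l" "\<not> (a = 0 \<and> c = Suc l)"
  shows "ear U (l - (c - a - 1)) (\<lambda>k. if k \<le> a then v k else v (k + (c - a - 1)))"
  unfolding ear_def
proof (intro conjI allI impI)
  note eD = earD[OF e]
  let ?d = "c - a - 1"
  let ?v = "\<lambda>k. if k \<le> a then v k else v (k + ?d)"
  have d: "?d \<le> l" "l - ?d \<ge> 1" using a by linarith+
  have en: "?v (Suc (l - ?d)) = v (Suc l)"
  proof -
    have "\<not> Suc (l - ?d) \<le> a" using a by linarith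
    moreover have "Suc (l - ?d) + ?d = Suc l" using d by linarith
    ultimately show ?thesis by simp
  qed
  show "1 \<le> l - ?d" by (rule d)
  show "?v 0 \<in> U" using eD(2) by simp
  show "?v (Suc (l - ?d)) \<in> U" unfolding en by (rule eD(3))
  show "?v 0 \<noteq> ?v (Suc (l - ?d))" unfolding en using eD(4) by simp
  show "?v i \<in> V - U" if "1 \<le> i" "i \<le> l - ?d" for i
    using eD(5)[of i] eD(5)[of "i + ?d"] that d a by auto
  show "adj (?v i) (?v (Suc i))" if "i \<le> l - ?d" for i
  proof -
    consider "Suc i \<le> a" | "i = a" | "i > a" by linarith
    then show ?thesis
    proof cases
      case 1 then show ?thesis using eD(6)[of i] a by auto
    next
      case 2
      have "Suc a + (c - a - 1) = c" using a by linarith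
      then show ?thesis using 2 a(1) by simp
    next
      case 3 then show ?thesis using eD(6)[of "i + ?d"] that d by simp
    qed
  qed
  show "\<not> {?v 0, ?v (Suc (l - ?d))} \<subseteq> F \<union> bd U F" if "thr U F" for F
    unfolding en using eD(7)[OF that] by simp
qed

text \<open>The single vertex \<open>w\<close> takes the place of the \<open>c - a - 1\<close>
  vertices between \<open>v a\<close> and \<open>v c\<close>, at least two by assumption, so the ear
  gets strictly shorter.\<close>

lemma ear_detour:
  assumes e: "ear U l v" and a: "adj w (v a)" "adj w (v c)" "1 \<le> a" "a + 2 < c" "c \<le> l"
    and w: "w \<in> V - U"
  shows "\<exists>l' v'. l' < l \<and> ear U l' v'"
proof -
  note eD = earD[OF e]
  obtain d where c: "c = a + 2 + d" using a(4) less_imp_add_positive by blast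
  let ?d = d
  let ?v = "\<lambda>k. if k \<le> a then v k else if k = Suc a then w else v (k + ?d)"
  have d: "?d \<ge> 1" "?d < l" "l - ?d \<ge> 1" using a c by linarith+
  have en: "?v (Suc (l - ?d)) = v (Suc l)"
  proof -
    have "\<not> Suc (l - ?d) \<le> a" "Suc (l - ?d) \<noteq> Suc a" using a c by linarith+
    moreover have "Suc (l - ?d) + ?d = Suc l" using d by linarith
    ultimately show ?thesis by simp
  qed
  have "ear U (l - ?d) ?v"
    unfolding ear_def
  proof (intro conjI allI impI)
    show "1 \<le> l - ?d" by (rule d)
    show "?v 0 \<in> U" using eD(2) by simp
    show "?v (Suc (l - ?d)) \<in> U" unfolding en by (rule eD(3))
    show "?v 0 \<noteq> ?v (Suc (l - ?d))" unfolding en using eD(4) by simp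
    show "?v i \<in> V - U" if "1 \<le> i" "i \<le> l - ?d" for i
      using eD(5)[of i] eD(5)[of "i + ?d"] that d a w by auto
    show "adj (?v i) (?v (Suc i))" if "i \<le> l - ?d" for i
    proof -
      consider "Suc i \<le> a" | "i = a" | "i = Suc a" | "i > Suc a" by linarith
      then show ?thesis
      proof cases
        case 1 then show ?thesis using eD(6)[of i] a by auto
      next
        case 2
        then show ?thesis using a(1) adj_sym by simp
      next
        case 3
        then show ?thesis using a(2) c by simp
      next
        case 4 then show ?thesis using eD(6)[of "i + ?d"] that d by simp
      qed
    qed
    show "\<not> {?v 0, ?v (Suc (l - ?d))} \<subseteq> F \<union> bd U F" if "thr U F" for F
      unfolding en using eD(7)[OF that] by simp
  qed
  then show ?thesis using d by (intro exI[of _ "l - ?d"] exI[of _ ?v]) auto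
qed

text \<open>A repeated vertex or a chord at an inner vertex would yield a shorter ear, so the walk
  satisfies what \<open>ear_good\<close> asks of a path.\<close>

lemma min_ear_good:
  assumes g: "good U" and e: "ear U l v" and min: "\<And>l' v'. ear U l' v' \<Longrightarrow> l \<le> l'"
  shows "good (U \<union> v ` {1..l})" "pot U < pot (U \<union> v ` {1..l})"
    "\<And>i. 1 \<le> i \<Longrightarrow> i \<le> l \<Longrightarrow> nb (v ` {1..l}) (v i) \<subseteq> {v (i - 1), v (Suc i)}"
proof -
  note eD = earD[OF e]
  have nosc: False if "adj (v a) (v c)" "Suc a < c" "c \<le> Suc l" "\<not> (a = 0 \<and> c = Suc l)" for a c
    using min[OF ear_shortcut[OF e that]] that eD(1) by linarith
  have ne: False if ij: "i < j" "j \<le> Suc l" and eq: "v i = v j" for i j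
  proof -
    have i: "1 \<le> i" using ij eq eD(2,4) eD(5)[of j] by (cases "i = 0"; cases "j = Suc l") auto
    have j: "j \<le> l" using ij eq eD(3,4) eD(5)[of i] i by (cases "j = Suc l") auto
    \<comment> \<open>A repetition is turned into a chord: the predecessor of \<open>v i\<close> is
      adjacent to \<open>v j\<close>.\<close>
    have "adj (v (i - 1)) (v j)" using eD(6)[of "i - 1"] eq i ij j by simp
    then show False using nosc[of "i - 1" j] i j ij by simp
  qed
  have inj: "inj_on v {0..Suc l}"
  proof (rule inj_onI)
    fix i j assume "i \<in> {0..Suc l}" "j \<in> {0..Suc l}" "v i = v j"
    then show "i = j" using ne[of i j] ne[of j i] by (cases i j rule: linorder_cases) auto
  qed
  have ind: "j = Suc i \<or> i = Suc j" if ij: "1 \<le> i" "i \<le> l" "j \<le> Suc l" "adj (v i) (v j)" for i j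
  proof (rule ccontr)
    assume n: "\<not> ?thesis"
    have "i \<noteq> j" using ij(4) adj_col by blast
    then consider "Suc i < j" | "Suc j < i" using n by linarith
    then show False
      using nosc[of i j] nosc[of j i] ij adj_sym[OF ij(4)] by cases auto
  qed
  have nothr: "\<exists>u\<in>U. \<exists>i. 1 \<le> i \<and> i \<le> l \<and> adj (v i) u \<and> u \<notin> F \<union> bd U F" if F: "thr U F" for F
  proof -
    consider "v 0 \<notin> F \<union> bd U F" | "v (Suc l) \<notin> F \<union> bd U F" using eD(7)[OF F] by blast
    then show ?thesis
    proof cases
      case 1
      moreover have "adj (v 1) (v 0)" using eD(6)[of 0] adj_sym by simp
      ultimately show ?thesis using eD(1,2) by blast
    next
      case 2
      moreover have "adj (v l) (v (Suc l))" using eD(6)[of l] by simp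
      ultimately show ?thesis using eD(1,3) by blast
    qed
  qed
  show "good (U \<union> v ` {1..l})" "pot U < pot (U \<union> v ` {1..l})"
    by (rule ear_good[OF g refl eD(1,5,2,3,6) inj ind nothr]; assumption)+
  show "nb (v ` {1..l}) (v i) \<subseteq> {v (i - 1), v (Suc i)}" if i: "1 \<le> i" "i \<le> l" for i
  proof
    fix y assume "y \<in> nb (v ` {1..l}) (v i)"
    then obtain j where j: "1 \<le> j" "j \<le> l" "y = v j" "adj (v i) (v j)" unfolding nb_def by auto
    then show "y \<in> {v (i - 1), v (Suc i)}" using ind[OF i, of j] by auto
  qed
qed

text \<open>Only the later vertices of the walk must lie in \<open>W\<close>, so the starting set
  may be disjoint from \<open>W\<close>, as it is for walks that leave \<open>U\<close>.\<close>

definition reach :: "'v set \<Rightarrow> 'v set \<Rightarrow> 'v set" where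
  "reach W F = {w. \<exists>l v. 1 \<le> l \<and> v 0 \<in> F \<and> v l = w \<and> (\<forall>i. 1 \<le> i \<longrightarrow> i \<le> l \<longrightarrow> v i \<in> W) \<and>
     (\<forall>i<l. adj (v i) (v (Suc i)))}"

lemma reach_base: "f \<in> F \<Longrightarrow> w \<in> W \<Longrightarrow> adj f w \<Longrightarrow> w \<in> reach W F"
  unfolding reach_def
  by (auto intro!: exI[of _ 1] exI[of _ "\<lambda>i. if i = 0 then f else w"])

lemma reach_step:
  assumes "w \<in> reach W F" "x \<in> W" "adj w x"
  shows "x \<in> reach W F"
proof -
  obtain l v where v: "1 \<le> l" "v 0 \<in> F" "v l = w" "\<And>i. 1 \<le> i \<Longrightarrow> i \<le> l \<Longrightarrow> v i \<in> W"
    "\<And>i. i < l \<Longrightarrow> adj (v i) (v (Suc i))"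
    using assms(1) unfolding reach_def by blast
  show ?thesis
    unfolding reach_def mem_Collect_eq
    by (intro exI[of _ "Suc l"] exI[of _ "v(Suc l := x)"])
      (use v assms in \<open>auto simp: less_Suc_eq_le le_Suc_eq less_Suc_eq\<close>)
qed

lemma reach_sub: "reach W F \<subseteq> W"
  unfolding reach_def by auto

lemma reach_ear:
  assumes "w \<in> reach (V - U) F" "F \<subseteq> U" "adj w b" "b \<in> U" "b \<notin> F"
    and "\<And>a M. a \<in> F \<Longrightarrow> thr U M \<Longrightarrow> \<not> {a, b} \<subseteq> M \<union> bd U M"
  shows "\<exists>l v. ear U l v"
proof -
  obtain l v where v: "1 \<le> l" "v 0 \<in> F" "v l = w" "\<And>i. 1 \<le> i \<Longrightarrow> i \<le> l \<Longrightarrow> v i \<in> V - U"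
    "\<And>i. i < l \<Longrightarrow> adj (v i) (v (Suc i))"
    using assms(1) unfolding reach_def by blast
  have "ear U l (v(Suc l := b))"
    unfolding ear_def
  proof (intro conjI allI impI)
    show "adj ((v(Suc l := b)) i) ((v(Suc l := b)) (Suc i))" if "i \<le> l" for i
      using that v(3,5) assms(3) by (cases "i = l") auto
    show "\<not> {(v(Suc l := b)) 0, (v(Suc l := b)) (Suc l)} \<subseteq> M \<union> bd U M" if "thr U M" for M
      using assms(6)[OF v(2) that] by simp
  qed (use v assms in auto)
  then show ?thesis by blast
qed

text \<open>Without threads any path through \<open>V - U\<close> between two distinct vertices of
  \<open>U\<close> is an ear, and 3-connectivity gives one. Otherwise the start is a largest thread
  \<open>F\<close>: its closure cannot separate in \<open>V\<close>, so some vertex \<open>b\<close>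
  of \<open>U\<close> outside this closure is reached through \<open>V - U\<close>, and a thread
  with \<open>b\<close> and a vertex of \<open>F\<close> in its closure would allow \<open>F\<close>
  to grow.\<close>

lemma ear_exists:
  assumes g: "good U" and c3: "conn3 V" and W: "V - U \<noteq> {}"
  shows "\<exists>l v. ear U l v"
proof -
  have fU: "finite U" and UV: "U \<subseteq> V" using goodD[OF g] by auto
  have cU: "3 \<le> card U"
    using goodD(3)[OF g] card_mono[OF fU, of "big U"] by (simp add: big_def)
  have c3': "F \<union> bd V F = V" if "F \<subseteq> V" "F \<noteq> {}" "card (bd V F) \<le> 2" for F
    using c3 that unfolding conn3_def by blast
  have bdK: "bd V (F \<union> reach (V - U) F) \<subseteq> U" for F
    using reach_base reach_step unfolding bd_def by blast
  have bdR: "bd V (reach (V - U) F) \<subseteq> U" for F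
    using reach_step unfolding bd_def by blast
  show ?thesis
  proof (cases "\<exists>F. thr U F")
    case False
    have "bd V (V - U) \<noteq> {}"
    proof
      assume "bd V (V - U) = {}"
      then have "(V - U) \<union> {} = V" using c3'[of "V - U"] W by simp
      then have "U = {}" using UV by blast
      then show False using cU by simp
    qed
    then obtain b w where b: "b \<in> U" "w \<in> V - U" "adj w b" unfolding bd_def by blast
    let ?K = "reach (V - U) {b}"
    have wK: "w \<in> ?K" using reach_base[of b "{b}" w] b adj_sym by blast
    have "\<not> card (bd V ?K) \<le> 2"
    proof
      assume c: "card (bd V ?K) \<le> 2"
      have "?K \<subseteq> V" using reach_sub by blast
      then have "?K \<union> bd V ?K = V" using c3'[of ?K] wK c by blast
      then have "U \<subseteq> bd V ?K" using reach_sub[of "V - U" "{b}"] UV by blast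
      then have "card U \<le> card (bd V ?K)" using card_mono[OF finite_bd[OF finite_V]] by blast
      then show False using c cU by simp
    qed
    moreover have "card (bd V ?K) \<le> 1" if "bd V ?K \<subseteq> {b}" using card_mono[OF _ that] by simp
    ultimately have "\<not> bd V ?K \<subseteq> {b}" by auto
    then obtain b' where b': "b' \<in> bd V ?K" "b' \<noteq> b" by blast
    then obtain k where "k \<in> ?K" "adj k b'" unfolding bd_def by blast
    moreover have "b' \<in> U" using b' bdR by blast
    ultimately show ?thesis using reach_ear[of k U "{b}" b'] b b' False by blast
  next
    case True
    then obtain F where F: "thr U F" and mx: "\<And>M. thr U M \<Longrightarrow> card M \<le> card F"
    proof -
      have "finite {F. thr U F}" using fU by (rule finite_subset[rotated, OF finite_Pow_iff[THEN iffD2]]) (auto simp: thr_def)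
      moreover have "{F. thr U F} \<noteq> {}" using True by blast
      ultimately obtain F where "thr U F" "card F = Max (card ` {F. thr U F})"
        using Max_in[of "card ` {F. thr U F}"] by fastforce
      moreover have "card M \<le> Max (card ` {F. thr U F})" if "thr U M" for M
        using that \<open>finite {F. thr U F}\<close> by (intro Max_ge) auto
      ultimately show thesis using that by simp
    qed
    have FU: "F \<subseteq> U" "F \<noteq> {}" "F \<inter> big U = {}" "card (bd U F) \<le> 2" using F unfolding thr_def by auto
    have fF: "finite F" using FU fU finite_subset by blast
    let ?X = "F \<union> reach (V - U) F"
    have XV: "?X \<subseteq> V" using FU UV reach_sub by blast
    have "\<not> bd V ?X \<subseteq> bd U F"
    proof
      assume s: "bd V ?X \<subseteq> bd U F"
      then have "card (bd V ?X) \<le> card (bd U F)" using card_mono finite_bd[OF fU] by blast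
      then have "?X \<union> bd V ?X = V" using c3'[OF XV] FU by simp
      then have "U \<subseteq> F \<union> bd U F" using s UV reach_sub[of "V - U" F] by blast
      then have "big U \<subseteq> bd U F" using FU unfolding big_def by blast
      then have "card (big U) \<le> card (bd U F)" using card_mono finite_bd[OF fU] by blast
      then show False using FU goodD(3)[OF g] by simp
    qed
    then obtain b where b: "b \<in> bd V ?X" "b \<notin> bd U F" by blast
    have bU: "b \<in> U" "b \<notin> F" using b bdK unfolding bd_def by blast+
    obtain k where k: "k \<in> reach (V - U) F" "adj k b" using b bU unfolding bd_def by blast
    have "\<not> {a, b} \<subseteq> M \<union> bd U M" if a: "a \<in> F" and M: "thr U M" for a M
    proof
      assume ab: "{a, b} \<subseteq> M \<union> bd U M"
      \<comment> \<open>Either \<open>M\<close> meets \<open>F\<close> and is swallowed by it,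
        because the union is again a thread, or \<open>a\<close> is an end of \<open>M\<close> and
        its neighbour \<open>z\<close> in \<open>M\<close> could be added to
        \<open>F\<close>.\<close>
      have sub: "M \<subseteq> F" if "F \<inter> M \<noteq> {}"
      proof -
        have t: "thr U (F \<union> M)" by (rule thr_Un[OF g F M that])
        then have "finite (F \<union> M)" using fU finite_subset unfolding thr_def by blast
        then have "F \<union> M = F" using card_seteq[of "F \<union> M" F] mx[OF t] by blast
        then show ?thesis by blast
      qed
      show False
      proof (cases "F \<inter> M = {}")
        case False
        then have "b \<in> F \<union> bd U F" using sub ab bU unfolding bd_def by blast
        then show False using b bU by blast
      next
        case True
        then have "a \<in> bd U M" using ab a by blast
        then obtain z where z: "z \<in> M" "adj z a" unfolding bd_def by blast
        have zF: "z \<in> bd U F" "z \<notin> F" "z \<notin> big U"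
          using z a True M adj_sym unfolding bd_def thr_def by blast+
        have t: "thr U (insert z F)" by (rule thr_insert[OF g F zF(1,3)])
        show False using mx[OF t] zF fF by simp
      qed
    qed
    then show ?thesis using reach_ear[OF k(1) FU(1) k(2) bU] by blast
  qed
qed

end

section \<open>Enlarging a good subgraph\<close>

text \<open>All that the extremal argument uses about the spider; copies are reduced to their vertex
  sets. \<open>copy_avoid\<close> expresses the abundance of embeddings and is supplied later by
  \<open>core_empty\<close>.\<close>

locale bip_graph_copies = bip_graph V adj col
  for V :: "'v set" and adj col +
  fixes \<T> :: "'v set set" and t :: nat
  assumes t_pos: "1 \<le> t"
    and degree: "v \<in> V \<Longrightarrow> t + 3 \<le> card (nb V v)"
    and three_conn: "conn3 V"
    and copy_sub: "T \<in> \<T> \<Longrightarrow> T \<subseteq> V"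
    and copy_nb: "T \<in> \<T> \<Longrightarrow> card (nb T v) \<le> t"
    and copy_greedy: "W \<subseteq> V \<Longrightarrow> W \<noteq> {} \<Longrightarrow> (\<And>w. w \<in> W \<Longrightarrow> t \<le> card (nb W w)) \<Longrightarrow> \<exists>T\<in>\<T>. T \<subseteq> W"
    and copy_avoid: "W \<subseteq> V \<Longrightarrow> \<exists>T\<in>\<T>. T \<subset> W \<Longrightarrow>
      (\<And>T w. T \<in> \<T> \<Longrightarrow> T \<subseteq> W \<Longrightarrow> w \<in> W - T \<Longrightarrow> Suc t \<le> card (nb W w)) \<Longrightarrow> v \<in> W \<Longrightarrow>
      \<exists>T\<in>\<T>. T \<subseteq> W - {v}"
begin

definition cand :: "'v set \<Rightarrow> bool" where
  "cand U \<longleftrightarrow> good U \<and> (\<exists>T\<in>\<T>. T \<subseteq> V - U)"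

definition opt :: "'v set \<Rightarrow> bool" where
  "opt U \<longleftrightarrow> cand U \<and>
    (\<forall>U'. cand U' \<longrightarrow> pot U' \<le> pot U \<and> (pot U' = pot U \<longrightarrow> card U \<le> card U'))"

lemma opt_exists:
  assumes "cand U"
  shows "\<exists>U. opt U"
proof -
  have "finite {U. cand U}"
    by (rule finite_subset[of _ "Pow V"]) (use finite_V in \<open>auto simp: cand_def good_def\<close>)
  then have f: "finite (pot ` {U. cand U})" by simp
  have ne: "pot ` {U. cand U} \<noteq> {}" using assms by blast
  define p where "p = Max (pot ` {U. cand U})"
  obtain U0 where U0: "cand U0" "pot U0 = p" using Max_in[OF f ne] unfolding p_def by auto
  obtain U1 where U1: "cand U1 \<and> pot U1 = p" "\<And>U'. cand U' \<and> pot U' = p \<Longrightarrow> card U1 \<le> card U'"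
    using ex_has_least_nat[of "\<lambda>U. cand U \<and> pot U = p" U0 card] U0 by blast
  have "pot U' \<le> p" if "cand U'" for U' using Max_ge[OF f] that unfolding p_def by blast
  then have "opt U1" unfolding opt_def using U1 by auto
  then show ?thesis by blast
qed

lemma optD:
  assumes "opt U"
  shows "good U" "U \<subseteq> V" "finite U" "\<exists>T\<in>\<T>. T \<subseteq> V - U"
    "\<And>U'. cand U' \<Longrightarrow> pot U' \<le> pot U" "\<And>U'. cand U' \<Longrightarrow> pot U' = pot U \<Longrightarrow> card U \<le> card U'"
  using assms goodD[of U] unfolding opt_def cand_def by auto

lemma opt_transfer:
  assumes "opt U" "cand U'" "pot U' = pot U" "card U' \<le> card U"
  shows "opt U'"
  using assms unfolding opt_def by auto

section \<open>Local structure around an optimal subgraph\<close>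

lemma card_nb_Un: "finite A \<Longrightarrow> finite B \<Longrightarrow> card (nb (A \<union> B) v) \<le> card (nb A v) + card (nb B v)"
proof -
  have "nb (A \<union> B) v = nb A v \<union> nb B v" by (auto simp: nb_def)
  then show ?thesis by (simp add: card_Un_le)
qed

text \<open>A vertex of \<open>U\<close> loses at most \<open>t\<close> of its \<open>t + 3\<close>
  neighbours to \<open>T\<close>. So every vertex of \<open>U\<close> is big, and the clause of
  \<open>good\<close> on boundaries of size 2 becomes \<open>conn3\<close>.\<close>

lemma opt_spanning:
  assumes o: "opt U" and T: "T \<in> \<T>" "T \<subseteq> V - U" "V - U \<subseteq> T"
  shows "conn3 (V - T)"
proof -
  note g = optD(1)[OF o]
  have UV: "V - T = U" and V: "V = U \<union> T" using optD(2)[OF o] T by blast+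
  have fT: "finite T" using fin[OF copy_sub] T by blast
  have "3 \<le> card (nb U u)" if "u \<in> U" for u
    using degree[of u] card_nb_Un[OF optD(3)[OF o] fT, of u] copy_nb[OF T(1), of u] that V by auto
  then have "big U = U" unfolding big_def by blast
  then show ?thesis
    unfolding conn3_def UV
  proof (intro allI impI)
    fix F assume F: "F \<subseteq> U" "F \<noteq> {}" "card (bd U F) \<le> 2"
    then have "U \<subseteq> F \<union> bd U F" using goodD(5)[OF g F(1,3)] \<open>big U = U\<close> by blast
    then show "F \<union> bd U F = U" using F(1) unfolding bd_def by blast
  qed
qed

text \<open>The neighbours of \<open>w\<close> must fit into the closure of one thread, since
  otherwise adding \<open>w\<close> raises the potential. A smallest such thread can be exchanged
  for \<open>w\<close>, and minimality of \<open>U\<close> then forces it to be a single vertex, a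
  twin of \<open>w\<close>.\<close>

lemma opt_outside:
  assumes o: "opt U" and w: "w \<in> V - U" and T: "T \<in> \<T>" "T \<subseteq> V - U - {w}"
    and c: "\<not> card (nb U w) \<le> 1"
  shows "\<exists>f\<in>U. f \<notin> big U \<and> nb U w = bd U {f} \<and> nb (U - {f}) w = bd U {f} \<and> thr U {f}"
proof -
  note g = optD(1)[OF o] and fU = optD(3)[OF o]
  \<comment> \<open>Otherwise \<open>w\<close> with two of its neighbours is an ear with one inner
    vertex, and the copy \<open>T\<close> still avoids the enlarged set.\<close>
  have cov: "\<exists>M. thr U M \<and> nb U w \<subseteq> M \<union> bd U M"
  proof (rule ccontr)
    assume no: "\<not> ?thesis"
    obtain u1 u2 where u1: "u1 \<in> nb U w" and u2: "u2 \<in> nb U w" "u1 \<noteq> u2"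
      using c card_le_Suc0_iff_eq[OF finite_nb[OF fU], of w] by auto
    define v where "v i = (if i = 0 then u1 else if i = 1 then w else u2)" for i :: nat
    have v: "v 0 = u1" "v 1 = w" "v (Suc 0) = w" "v (Suc 1) = u2" "v (Suc (Suc 0)) = u2"
      unfolding v_def by auto
    have uw: "u1 \<in> U" "u2 \<in> U" "adj w u1" "adj w u2" using u1 u2 unfolding nb_def by auto
    have "good (U \<union> v ` {1..1})" "pot U < pot (U \<union> v ` {1..1})"
    proof -
      have 1: "v i \<in> V - U" if "1 \<le> i" "i \<le> 1" for i
        using that w v by (metis One_nat_def le_antisym)
      have 2: "adj (v i) (v (Suc i))" if "i \<le> 1" for i
        using that uw v adj_sym by (cases i) auto
      have 3: "inj_on v {0..Suc 1}"
        using u2(2) w uw unfolding inj_on_def v_def by auto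
      have 4: "j = Suc i \<or> i = Suc j" if "1 \<le> i" "i \<le> 1" "j \<le> Suc 1" "adj (v i) (v j)" for i j
      proof -
        have "i = 1" using that by simp
        moreover have "j \<noteq> 1" using that adj_col \<open>i = 1\<close> by blast
        ultimately show ?thesis using that by linarith
      qed
      have 5: "\<exists>u\<in>U. \<exists>i. 1 \<le> i \<and> i \<le> 1 \<and> adj (v i) u \<and> u \<notin> F \<union> bd U F" if "thr U F" for F
        using no that v(2) unfolding nb_def by blast
      have 6: "v 0 \<in> U" "v (Suc 1) \<in> U" using v uw by auto
      show "good (U \<union> v ` {1..1})" "pot U < pot (U \<union> v ` {1..1})"
        by (rule ear_good[OF g refl _ 1 6 2 3 4 5]; (assumption | simp))+
    qed
    moreover have "U \<union> v ` {1..1} = insert w U" using v(3) by simp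
    ultimately have "good (insert w U)" "pot U < pot (insert w U)" by simp_all
    moreover have "T \<subseteq> V - insert w U" using T by blast
    ultimately have "cand (insert w U)" unfolding cand_def using T by blast
    then show False using optD(5)[OF o] \<open>pot U < pot (insert w U)\<close> by fastforce
  qed
  then obtain M0 where M0: "thr U M0 \<and> nb U w \<subseteq> M0 \<union> bd U M0" by blast
  obtain M where M': "thr U M \<and> nb U w \<subseteq> M \<union> bd U M"
    and mn: "\<And>M'. thr U M' \<and> nb U w \<subseteq> M' \<union> bd U M' \<Longrightarrow> card M \<le> card M'"
    using ex_has_least_nat[of "\<lambda>M. thr U M \<and> nb U w \<subseteq> M \<union> bd U M" M0 card, OF M0] by blast
  have M: "thr U M" "nb U w \<subseteq> M \<union> bd U M" using M' by auto
  have MU: "M \<subseteq> U" "M \<noteq> {}" "M \<inter> big U = {}" using M unfolding thr_def by auto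
  have fM: "finite M" using MU fU finite_subset by blast
  have bM: "card (bd U M) = 2" by (rule thr_bd[OF g M(1)])
  \<comment> \<open>If an end \<open>a\<close> of \<open>M\<close> were not a neighbour of
    \<open>w\<close>, then the only neighbour \<open>m\<close> of \<open>a\<close> in
    \<open>M\<close> could take over the role of the end, leaving a smaller thread that still covers
    \<open>nb U w\<close>. For \<open>M = {m}\<close> the vertex \<open>w\<close> would form a
    triangle with \<open>m\<close> and the other end.\<close>
  have "bd U M \<subseteq> nb U w"
  proof
    fix a assume a: "a \<in> bd U M"
    show "a \<in> nb U w"
    proof (rule ccontr)
      assume na: "a \<notin> nb U w"
      obtain m where m: "m \<in> M" "adj m a" using a unfolding bd_def by blast
      have aU: "a \<in> U - M" using a unfolding bd_def by blast
      have "card (nb M a) \<le> 1" by (rule goodD(6)[OF g M(1) aU])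
      then have only: "m' = m" if "m' \<in> M" "adj a m'" for m'
        using that m adj_sym fM card_le_Suc0_iff_eq[of "nb M a"] finite_nb[OF fM] unfolding nb_def by auto
      have ca: "card (bd U M - {a}) = 1" using bM a finite_bd[OF fU] by simp
      then obtain b where b: "bd U M - {a} = {b}" using card_1_singletonE by blast
      show False
      proof (cases "M = {m}")
        case True
        have "nb U w \<subseteq> {m, b}" using M(2) na b True by blast
        moreover have "\<not> {m, b} \<subseteq> nb U w"
        proof
          assume "{m, b} \<subseteq> nb U w"
          then have "adj w m" "adj w b" unfolding nb_def by auto
          moreover have "adj m b" using b True unfolding bd_def by blast
          ultimately show False using adj_col by metis
        qed
        ultimately have "nb U w \<subset> {m, b}" by blast
        then have "card (nb U w) < card {m, b}" by (intro psubset_card_mono) auto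
        then show False using c by (simp add: card_insert_if split: if_splits)
      next
        case False
        let ?M = "M - {m}"
        have bdm: "bd U ?M \<subseteq> {m, b}"
        proof
          fix u assume u: "u \<in> bd U ?M"
          then obtain m' where m': "m' \<in> M" "m' \<noteq> m" "adj m' u" unfolding bd_def by blast
          show "u \<in> {m, b}"
          proof (cases "u = m")
            case nm: False
            then have "u \<in> bd U M" using u unfolding bd_def by blast
            moreover have "u \<noteq> a" using only m' adj_sym by blast
            ultimately show ?thesis using b by blast
          qed simp
        qed
        have c2: "card (bd U ?M) \<le> 2" using card_mono[OF _ bdm] by (simp add: card_insert_if split: if_splits)
        have t: "thr U ?M" unfolding thr_def using MU False m c2 by blast
        have "bd U ?M = {m, b}"
          using thr_bd[OF g t] bdm card_seteq[of "{m, b}" "bd U ?M"] by (simp add: card_insert_if split: if_splits)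
        moreover have "nb U w \<subseteq> M \<union> {b}" using M(2) na b by blast
        ultimately have "nb U w \<subseteq> ?M \<union> bd U ?M" by blast
        then have "card M \<le> card ?M" using mn t by blast
        then show False using card_Diff1_less[OF fM m(1)] by simp
      qed
    qed
  qed
  then have nbw: "nb (U - M) w = bd U M" using M(2) unfolding nb_def bd_def by blast
  \<comment> \<open>Exchanging \<open>M\<close> for \<open>w\<close> keeps the potential, so the
    minimal cardinality of \<open>U\<close> gives that \<open>M\<close> has one vertex.\<close>
  let ?U = "insert w (U - M)"
  note sw = swap_good[OF g M(1) w nbw refl]
  have "T \<subseteq> V - ?U" using T by blast
  then have "cand ?U" unfolding cand_def using sw T by blast
  then have "card U \<le> card ?U" using optD(6)[OF o] sw by blast
  moreover have "card ?U = Suc (card U - card M)" using w MU fU fM by (simp add: card_Diff_subset)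
  moreover have "card M \<le> card U" using MU fU card_mono by blast
  ultimately have "card M \<le> 1" by linarith
  moreover have "card M \<noteq> 0" using MU fM by simp
  ultimately have "card M = 1" by linarith
  then obtain f where f: "M = {f}" by (rule card_1_singletonE)
  have "f \<notin> nb U w"
  proof
    assume "f \<in> nb U w"
    then have wf: "adj w f" unfolding nb_def by simp
    have "bd U M \<noteq> {}" using bM by auto
    then obtain a where a: "a \<in> bd U M" by blast
    then have "adj w a" using nbw unfolding nb_def by blast
    moreover have "adj f a" using a f unfolding bd_def by blast
    ultimately show False using adj_col wf by metis
  qed
  then have "nb U w = bd U {f}" using nbw f unfolding nb_def by blast
  then show "\<exists>f\<in>U. f \<notin> big U \<and> nb U w = bd U {f} \<and> nb (U - {f}) w = bd U {f} \<and> thr U {f}"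
    using f MU nbw M(1) by blast
qed

text \<open>A vertex off some copy has at most two neighbours in \<open>U\<close>, hence at least
  \<open>t + 1\<close> in \<open>V - U\<close>. The strict inclusion wanted by
  \<open>copy_avoid\<close> holds because a copy filling \<open>V - U\<close> would already settle
  the theorem by \<open>opt_spanning\<close>.\<close>

lemma opt_avoid:
  assumes o: "opt U" and no: "\<And>T. T \<in> \<T> \<Longrightarrow> \<not> conn3 (V - T)" and v: "v \<in> V - U"
  shows "\<exists>T\<in>\<T>. T \<subseteq> V - U - {v}"
proof (rule copy_avoid[OF _ _ _ v])
  show "\<exists>T\<in>\<T>. T \<subset> V - U" using optD(4)[OF o] opt_spanning[OF o] no by blast
next
  fix T w assume T: "T \<in> \<T>" "T \<subseteq> V - U" "w \<in> V - U - T"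
  have "card (nb U w) \<le> 2"
  proof (cases "card (nb U w) \<le> 1")
    case False
    have "w \<in> V - U" "T \<subseteq> V - U - {w}" using T by auto
    then obtain f where f: "nb U w = bd U {f}" "thr U {f}" using opt_outside[OF o _ T(1) _ False] by blast
    then show ?thesis unfolding thr_def by simp
  qed simp
  moreover have "V = U \<union> (V - U)" using optD(2)[OF o] by blast
  then have "card (nb V w) \<le> card (nb U w) + card (nb (V - U) w)"
    using card_nb_Un[of U "V - U" w] optD(3)[OF o] finite_V by simp
  ultimately show "Suc t \<le> card (nb (V - U) w)" using degree[of w] T by simp
qed blast

lemma twin_swap:
  assumes o: "opt U" and w: "w \<in> V - U" and T: "T \<in> \<T>" "T \<subseteq> V - U - {w}"
    and f: "f \<in> U" "thr U {f}" "nb (U - {f}) w = bd U {f}"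
  shows "opt (insert w (U - {f}))" "big (insert w (U - {f})) = big U"
proof -
  let ?U = "insert w (U - {f})"
  note sw = swap_good[OF optD(1)[OF o] f(2) w f(3) refl]
  have "T \<subseteq> V - ?U" using T by blast
  then have "cand ?U" unfolding cand_def using sw T by blast
  moreover have "card ?U = card U" using w card_Suc_Diff1[OF optD(3)[OF o] f(1)] optD(3)[OF o] by simp
  ultimately show "opt ?U" using opt_transfer[OF o] sw by simp
  show "big ?U = big U" by (rule sw)
qed

lemma thr_with:
  assumes g: "good U" and F: "thr U F" and f: "f \<in> F \<union> bd U F" "f \<notin> big U" and b: "b \<in> F \<union> bd U F"
  obtains F' where "thr U F'" "f \<in> F'" "b \<in> F' \<union> bd U F'"
proof (cases "f \<in> F")
  case True then show ?thesis using that F b by blast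
next
  case False
  then have t: "thr U (insert f F)" using thr_insert[OF g F] f by blast
  have "b \<in> insert f F \<union> bd U (insert f F)" using b unfolding bd_def by auto
  then show ?thesis using that[OF t] by blast
qed

text \<open>At most two neighbours lie in \<open>U\<close> and at most two on the ear. If both
  bounds were attained, \<open>w\<close> would have a twin \<open>f\<close> in \<open>U\<close>, and
  after exchanging them two shorter ears start at \<open>w\<close>, one towards each end. Hence
  minimality ranges over the ears of all optimal sets.\<close>

lemma few_neighbours:
  assumes o: "opt U" and no: "\<And>T. T \<in> \<T> \<Longrightarrow> \<not> conn3 (V - T)"
    and e: "ear U l v" and min: "\<And>U' l' v'. opt U' \<Longrightarrow> ear U' l' v' \<Longrightarrow> l \<le> l'"
    and w: "w \<in> V - (U \<union> v ` {1..l})"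
  shows "card (nb (U \<union> v ` {1..l}) w) \<le> 3"
proof (rule ccontr)
  assume many: "\<not> ?thesis"
  let ?P = "v ` {1..l}"
  note g = optD(1)[OF o] and fU = optD(3)[OF o] and eD = earD[OF e]
  have wW: "w \<in> V - U" and wP: "w \<notin> ?P" using w by auto
  obtain T where T: "T \<in> \<T>" "T \<subseteq> V - U - {w}" using opt_avoid[OF o no wW] by blast
  define I where "I = {i \<in> {1..l}. adj w (v i)}"
  have nbP: "nb ?P w = v ` I" unfolding I_def nb_def by auto
  have fI: "finite I" unfolding I_def by simp
  have gap: "c = Suc (Suc a)" if "a \<in> I" "c \<in> I" "a < c" for a c
  proof (rule ccontr)
    assume n: "c \<noteq> Suc (Suc a)"
    have ac: "adj w (v a)" "adj w (v c)" "1 \<le> a" "c \<le> l" using that unfolding I_def by auto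
    show False
    proof (cases "c = Suc a")
      case True
      then have "adj (v a) (v c)" using eD(6)[of a] ac by simp
      then show False using ac adj_col by metis
    next
      case False
      then have "a + 2 < c" using n that by linarith
      then obtain l' v' where "l' < l" "ear U l' v'" using ear_detour[OF e ac(1,2,3) _ ac(4) wW] by blast
      then show False using min[OF o] by fastforce
    qed
  qed
  have c: "card (nb (U \<union> ?P) w) \<le> card (nb U w) + card (nb ?P w)"
    by (rule card_nb_Un) (use fU in auto)
  have cP: "card (nb ?P w) \<le> card I" unfolding nbP by (rule card_image_le[OF fI])
  have cI: "card I \<le> 2"
  proof (cases "I = {}")
    case False
    then have m: "Min I \<in> I" "\<And>k. k \<in> I \<Longrightarrow> Min I \<le> k" using fI by auto
    have "I \<subseteq> {Min I, Suc (Suc (Min I))}"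
    proof
      fix k assume "k \<in> I"
      then show "k \<in> {Min I, Suc (Suc (Min I))}" using gap[OF m(1), of k] m(2)[of k] by fastforce
    qed
    then have "card I \<le> card {Min I, Suc (Suc (Min I))}" by (intro card_mono) auto
    then show ?thesis by simp
  qed simp
  have cU: "card (nb U w) \<le> 2" "\<not> card (nb U w) \<le> 1 \<Longrightarrow> \<exists>f\<in>U. f \<notin> big U \<and> nb (U - {f}) w = bd U {f} \<and> thr U {f}"
  proof -
    have *: "\<exists>f\<in>U. f \<notin> big U \<and> nb U w = bd U {f} \<and> nb (U - {f}) w = bd U {f} \<and> thr U {f}"
      if "\<not> card (nb U w) \<le> 1"
      by (rule opt_outside[OF o wW T that])
    show "card (nb U w) \<le> 2" using * unfolding thr_def by fastforce
    show "\<exists>f\<in>U. f \<notin> big U \<and> nb (U - {f}) w = bd U {f} \<and> thr U {f}" if "\<not> card (nb U w) \<le> 1"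
      using *[OF that] by blast
  qed
  have "\<not> card (nb U w) \<le> 1" "\<not> card I \<le> 1" using many c cP cI cU(1) by linarith+
  then obtain f where f: "f \<in> U" "f \<notin> big U" "nb (U - {f}) w = bd U {f}" "thr U {f}"
    using cU(2) by blast
  obtain a c where ac: "a \<in> I" "c \<in> I" "a < c"
    using \<open>\<not> card I \<le> 1\<close> fI card_le_Suc0_iff_eq[OF fI] by (metis One_nat_def nat_neq_iff)
  have a: "1 \<le> a" "Suc (Suc a) \<le> l" "adj w (v a)" "adj w (v (Suc (Suc a)))"
    using ac gap[OF ac] unfolding I_def by auto
  let ?U = "insert w (U - {f})"
  have oU: "opt ?U" and bU: "big ?U = big U"
    using twin_swap[OF o wW T f(1,4,3)] by auto
  have vW: "v i \<in> V - ?U" if "1 \<le> i" "i \<le> l" for i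
    using eD(5)[OF that] wP that by auto
  have wnU: "w \<notin> U" using wW by simp
  have lift1: "\<exists>F'. thr U F' \<and> f \<in> F' \<and> b \<in> F' \<union> bd U F'"
    if F: "thr ?U F" "{w, b} \<subseteq> F \<union> bd ?U F" and b: "b \<in> U - {f}" for F b
  proof -
    obtain F1 where F1: "thr U F1" "\<And>b. b \<in> U - {f} \<Longrightarrow> b \<in> F \<union> bd ?U F \<Longrightarrow> b \<in> F1 \<union> bd U F1"
      "w \<in> F \<union> bd ?U F \<Longrightarrow> f \<in> F1 \<union> bd U F1"
      using twin_thr[OF refl bU f(1) wnU f(2,3) fU F(1)] by blast
    have fF1: "f \<in> F1 \<union> bd U F1" and bF1: "b \<in> F1 \<union> bd U F1" using F1(2)[OF b] F1(3) F(2) by auto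
    show ?thesis using thr_with[OF g F1(1) fF1 f(2) bF1] by metis
  qed
  \<comment> \<open>The walk \<open>w, v a, ..., v 1, v 0\<close> has only \<open>a\<close> inner
    vertices. Being too short for an ear of the swapped set, it must have both ends in the closure
    of one thread there, which lifts to a thread of \<open>U\<close> through
    \<open>f\<close>.\<close>
  have A: "\<exists>F'. thr U F' \<and> f \<in> F' \<and> v 0 \<in> F' \<union> bd U F'" if n: "v 0 \<noteq> f"
  proof (rule ccontr)
    assume no: "\<not> ?thesis"
    let ?v = "\<lambda>k. if k = 0 then w else v (Suc a - k)"
    have "ear ?U a ?v"
      unfolding ear_def
    proof (intro conjI allI impI)
      show "1 \<le> a" by (rule a)
      show "?v 0 \<in> ?U" by simp
      show "?v (Suc a) \<in> ?U" using eD(2) n by simp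
      show "?v 0 \<noteq> ?v (Suc a)" using eD(2) wnU by auto
      show "?v i \<in> V - ?U" if "1 \<le> i" "i \<le> a" for i
      proof -
        have "1 \<le> Suc a - i" "Suc a - i \<le> l" using that a by linarith+
        then show ?thesis using vW[of "Suc a - i"] that by simp
      qed
      show "adj (?v i) (?v (Suc i))" if i: "i \<le> a" for i
      proof (cases i)
        case 0 then show ?thesis using a by simp
      next
        case (Suc j)
        have "adj (v (a - i)) (v (Suc (a - i)))" using eD(6)[of "a - i"] a by simp
        moreover have "Suc (a - i) = Suc a - i" using i by simp
        ultimately show ?thesis using adj_sym Suc by simp
      qed
      show "\<not> {?v 0, ?v (Suc a)} \<subseteq> F \<union> bd ?U F" if "thr ?U F" for F
        using lift1[OF that, of "v 0"] no n eD(2) by auto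
    qed
    then show False using min[OF oU] a by fastforce
  qed
  \<comment> \<open>The same for the walk \<open>w, v (a + 2), ..., v (l + 1)\<close>, which has
    \<open>l - a - 1\<close> inner vertices.\<close>
  have B: "\<exists>F'. thr U F' \<and> f \<in> F' \<and> v (Suc l) \<in> F' \<union> bd U F'" if n: "v (Suc l) \<noteq> f"
  proof (rule ccontr)
    assume no: "\<not> ?thesis"
    let ?l = "l - Suc a"
    let ?v = "\<lambda>k. if k = 0 then w else v (Suc a + k)"
    have l1: "1 \<le> ?l" "Suc a + ?l = l" "Suc a + Suc ?l = Suc l" using a by linarith+
    have en: "?v (Suc ?l) = v (Suc l)" unfolding l1(3) by simp
    have "ear ?U ?l ?v"
      unfolding ear_def
    proof (intro conjI allI impI)
      show "1 \<le> ?l" by (rule l1)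
      show "?v 0 \<in> ?U" by simp
      show "?v (Suc ?l) \<in> ?U" unfolding en using eD(3) n by simp
      show "?v 0 \<noteq> ?v (Suc ?l)" unfolding en using eD(3) wnU by auto
      show "?v i \<in> V - ?U" if "1 \<le> i" "i \<le> ?l" for i
        using vW[of "Suc a + i"] that l1 by simp
      show "adj (?v i) (?v (Suc i))" if i: "i \<le> ?l" for i
      proof (cases i)
        case 0 then show ?thesis using a by simp
      next
        case (Suc j)
        then show ?thesis using eD(6)[of "Suc a + i"] i l1 by simp
      qed
      show "\<not> {?v 0, ?v (Suc ?l)} \<subseteq> F \<union> bd ?U F" if "thr ?U F" for F
        unfolding en using lift1[OF that, of "v (Suc l)"] no n eD(3) by auto
    qed
    then show False using min[OF oU] a by fastforce
  qed
  show False
  proof (cases "v 0 = f")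
    case True
    then have "v (Suc l) \<noteq> f" using eD(4) by auto
    then show False using B eD(7) True by blast
  next
    case n0: False
    show False
    proof (cases "v (Suc l) = f")
      case True then show False using A[OF n0] eD(7) by blast
    next
      case False
      obtain F1 where F1: "thr U F1" "f \<in> F1" "v 0 \<in> F1 \<union> bd U F1" using A[OF n0] by blast
      obtain F2 where F2: "thr U F2" "f \<in> F2" "v (Suc l) \<in> F2 \<union> bd U F2" using B[OF False] by blast
      \<comment> \<open>Both threads contain \<open>f\<close>, so their union is a thread whose
        closure holds both ends of the original ear.\<close>
      have t: "thr U (F1 \<union> F2)" using thr_Un[OF g F1(1) F2(1)] F1 F2 by blast
      have "{v 0, v (Suc l)} \<subseteq> (F1 \<union> F2) \<union> bd U (F1 \<union> F2)"
        using F1(3) F2(3) unfolding bd_def by blast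
      then show False using eD(7)[OF t] by blast
    qed
  qed
qed

theorem exists_keeping_copy:
  assumes "T0 \<in> \<T>" "good U0" "U0 \<subseteq> V - T0"
  shows "\<exists>T\<in>\<T>. conn3 (V - T)"
proof (rule ccontr)
  assume n: "\<not> ?thesis"
  then have no: "\<And>T. T \<in> \<T> \<Longrightarrow> \<not> conn3 (V - T)" by blast
  have "T0 \<subseteq> V - U0" using assms copy_sub by blast
  then have "cand U0" unfolding cand_def using assms by blast
  then obtain Ui where Ui: "opt Ui" using opt_exists by blast
  have "V - Ui \<noteq> {}"
  proof
    assume "V - Ui = {}"
    moreover obtain T where "T \<in> \<T>" "T \<subseteq> V - Ui" using optD(4)[OF Ui] by blast
    ultimately show False using opt_spanning[OF Ui] no by blast
  qed
  then obtain li where "\<exists>v. ear Ui li v" using ear_exists[OF optD(1)[OF Ui] three_conn] by blast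
  then have ex: "\<exists>U v. opt U \<and> ear U li v" using Ui by blast
  obtain l where l: "\<exists>U v. opt U \<and> ear U l v" "\<And>l'. (\<exists>U v. opt U \<and> ear U l' v) \<Longrightarrow> l \<le> l'"
    using ex_has_least_nat[of "\<lambda>l. \<exists>U v. opt U \<and> ear U l v" li "\<lambda>x. x"] ex by blast
  obtain U v where o: "opt U" and e: "ear U l v" using l(1) by blast
  have min: "l \<le> l'" if "opt U'" "ear U' l' v'" for U' l' v' using l(2) that by blast
  note g = optD(1)[OF o] and fU = optD(3)[OF o] and UV = optD(2)[OF o] and eD = earD[OF e]
  let ?P = "v ` {1..l}"
  let ?U = "U \<union> ?P"
  have min': "\<And>l' v'. ear U l' v' \<Longrightarrow> l \<le> l'" using min[OF o] by blast
  have me: "good ?U" "pot U < pot ?U"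
    using min_ear_good(1,2)[OF g e] min' by blast+
  have me3: "nb ?P (v i) \<subseteq> {v (i - 1), v (Suc i)}" if "1 \<le> i" "i \<le> l" for i
    using min_ear_good(3)[OF g e _ that] min' by blast
  have fP: "finite ?P" by simp
  have few: "card (nb ?U w) \<le> 3" if "w \<in> V - ?U" for w
    using few_neighbours[OF o no e min that] .
  let ?W = "V - ?U"
  have sub: "?U \<subseteq> V" using UV eD(5) by auto
  have split: "card (nb V x) \<le> card (nb ?U x) + card (nb ?W x)" for x
  proof -
    have "V = ?U \<union> ?W" using sub by blast
    then show ?thesis using card_nb_Un[of ?U ?W x] finite_V finite_subset[OF sub] by auto
  qed
  \<comment> \<open>If nothing were left, \<open>v 1\<close> would have at most three neighbours,
    two in \<open>U\<close> and the next one on the ear, but its degree is at least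
    \<open>t + 3\<close>, which exceeds 3.\<close>
  have "?W \<noteq> {}"
  proof
    assume W: "?W = {}"
    have v1: "v 1 \<in> V - U" using eD(5)[of 1] eD(1) by simp
    obtain T where T: "T \<in> \<T>" "T \<subseteq> V - U - {v 1}" using opt_avoid[OF o no v1] by blast
    have "card (nb U (v 1)) \<le> 2"
    proof (cases "card (nb U (v 1)) \<le> 1")
      case False
      then show ?thesis using opt_outside[OF o v1 T] unfolding thr_def by fastforce
    qed simp
    moreover have "nb ?P (v 1) \<subseteq> {v 2}"
    proof
      fix y assume y: "y \<in> nb ?P (v 1)"
      then have "y \<in> {v (1 - 1), v (Suc 1)}" using me3[of 1] eD(1) by blast
      moreover have "y \<notin> U" using y eD(5) unfolding nb_def by auto
      ultimately show "y \<in> {v 2}" using eD(2) by (auto simp: numeral_2_eq_2)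
    qed
    then have "card (nb ?P (v 1)) \<le> 1" using card_mono[of "{v 2}"] by fastforce
    moreover have "card (nb ?U (v 1)) \<le> card (nb U (v 1)) + card (nb ?P (v 1))"
      by (rule card_nb_Un[OF fU fP])
    moreover have "card (nb ?W (v 1)) = 0" unfolding W by (simp add: nb_def)
    ultimately have "card (nb V (v 1)) \<le> 3" using split[of "v 1"] by linarith
    then show False using degree[of "v 1"] v1 t_pos by simp
  qed
  moreover have "t \<le> card (nb ?W w)" if "w \<in> ?W" for w
    using few[OF that] split[of w] degree[of w] that by simp
  ultimately obtain T where T: "T \<in> \<T>" "T \<subseteq> ?W" using copy_greedy[of ?W] by blast
  then have "cand ?U" unfolding cand_def using me(1) by blast
  then have "pot ?U \<le> pot U" by (rule optD(5)[OF o])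
  then show False using me(2) by simp
qed

end

section \<open>Embedded spiders\<close>

definition slots :: "nat \<Rightarrow> (nat \<Rightarrow> nat) \<Rightarrow> (nat \<times> nat) set" where
  "slots d l = (SIGMA i:{..<d}. {1..l i})"

definition feet :: "nat \<Rightarrow> (nat \<Rightarrow> nat) \<Rightarrow> 'v \<Rightarrow> (nat \<Rightarrow> nat \<Rightarrow> 'v) \<Rightarrow> 'v set" where
  "feet d l c p = insert c ((\<lambda>(i, s). p i s) ` slots d l)"

text \<open>
  The centre \<open>c\<close> of the spider is position 0 on each of its \<open>d\<close> legs; leg \<open>i\<close> has the further
  vertices \<open>p i 1, \<dots>, p i (l i)\<close>.
\<close>

definition (in bip_graph) emb :: "nat \<Rightarrow> (nat \<Rightarrow> nat) \<Rightarrow> 'v \<Rightarrow> (nat \<Rightarrow> nat \<Rightarrow> 'v) \<Rightarrow> bool" where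
  "emb d l c p \<longleftrightarrow> feet d l c p \<subseteq> V \<and> (\<forall>i<d. p i 0 = c) \<and>
    (\<forall>i<d. \<forall>s<l i. adj (p i s) (p i (Suc s))) \<and>
    (\<forall>i<d. \<forall>s. 1 \<le> s \<longrightarrow> s \<le> l i \<longrightarrow> p i s \<noteq> c) \<and>
    inj_on (\<lambda>(i, s). p i s) (slots d l)"

lemma in_slots: "(i, s) \<in> slots d l \<longleftrightarrow> i < d \<and> 1 \<le> s \<and> s \<le> l i"
  by (auto simp: slots_def)

lemma finite_slots: "finite (slots d l)"
  by (simp add: slots_def)

lemma finite_feet: "finite (feet d l c p)"
  by (simp add: feet_def finite_slots)

lemma feet_iff: "x \<in> feet d l c p \<longleftrightarrow> x = c \<or> (\<exists>i s. i < d \<and> 1 \<le> s \<and> s \<le> l i \<and> x = p i s)"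
  by (auto simp: feet_def in_slots image_iff Bex_def)

lemma feet_mono: "(\<And>i. i < d \<Longrightarrow> a i \<le> l i) \<Longrightarrow> feet d a c p \<subseteq> feet d l c p"
  unfolding feet_iff subset_iff using order_trans by blast

lemma card_odd_upto: "card {s \<in> {1..n::nat}. odd s} = (n + 1) div 2"
proof (induction n)
  case (Suc n)
  have "{s \<in> {1..Suc n}. odd s} = (if odd (Suc n) then insert (Suc n) {s \<in> {1..n}. odd s} else {s \<in> {1..n}. odd s})"
    by (auto simp: le_Suc_eq)
  then show ?case using Suc by (auto elim!: oddE evenE)
qed simp

lemma card_even_upto: "card {s \<in> {1..n::nat}. even s} = n div 2"
proof (induction n)
  case (Suc n)
  have "{s \<in> {1..Suc n}. even s} = (if even (Suc n) then insert (Suc n) {s \<in> {1..n}. even s} else {s \<in> {1..n}. even s})"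
    by (auto simp: le_Suc_eq)
  then show ?case using Suc by (auto elim!: oddE evenE)
qed simp

section \<open>Colour classes of embedded spiders, and growing them greedily\<close>

context bip_graph begin

lemma embD:
  assumes "emb d l c p"
  shows "feet d l c p \<subseteq> V" "c \<in> V" "\<And>i. i < d \<Longrightarrow> p i 0 = c"
    "\<And>i s. i < d \<Longrightarrow> s < l i \<Longrightarrow> adj (p i s) (p i (Suc s))"
    "\<And>i s. i < d \<Longrightarrow> 1 \<le> s \<Longrightarrow> s \<le> l i \<Longrightarrow> p i s \<noteq> c"
    "\<And>i s j r. i < d \<Longrightarrow> 1 \<le> s \<Longrightarrow> s \<le> l i \<Longrightarrow> j < d \<Longrightarrow> 1 \<le> r \<Longrightarrow> r \<le> l j \<Longrightarrow> p i s = p j r \<Longrightarrow> i = j \<and> s = r"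
    "inj_on (\<lambda>(i, s). p i s) (slots d l)"
    "\<And>i s. i < d \<Longrightarrow> s \<le> l i \<Longrightarrow> p i s \<in> feet d l c p"
proof -
  show a: "feet d l c p \<subseteq> V" "\<And>i. i < d \<Longrightarrow> p i 0 = c"
    "\<And>i s. i < d \<Longrightarrow> s < l i \<Longrightarrow> adj (p i s) (p i (Suc s))"
    "\<And>i s. i < d \<Longrightarrow> 1 \<le> s \<Longrightarrow> s \<le> l i \<Longrightarrow> p i s \<noteq> c" "inj_on (\<lambda>(i, s). p i s) (slots d l)"
    using assms unfolding emb_def by auto
  show "c \<in> V" using a(1) unfolding feet_def by blast
  show "i = j \<and> s = r" if "i < d" "1 \<le> s" "s \<le> l i" "j < d" "1 \<le> r" "r \<le> l j" "p i s = p j r" for i s j r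
    using inj_onD[OF a(5), of "(i, s)" "(j, r)"] that by (simp add: in_slots)
  show "p i s \<in> feet d l c p" if "i < d" "s \<le> l i" for i s
    using that a(2)[of i] unfolding feet_iff by (cases s) auto
qed

lemma embI:
  assumes "feet d l c p \<subseteq> V" "\<And>i. i < d \<Longrightarrow> p i 0 = c"
    "\<And>i s. i < d \<Longrightarrow> s < l i \<Longrightarrow> adj (p i s) (p i (Suc s))"
    "\<And>i s. i < d \<Longrightarrow> 1 \<le> s \<Longrightarrow> s \<le> l i \<Longrightarrow> p i s \<noteq> c"
    "\<And>i s j r. i < d \<Longrightarrow> 1 \<le> s \<Longrightarrow> s \<le> l i \<Longrightarrow> j < d \<Longrightarrow> 1 \<le> r \<Longrightarrow> r \<le> l j \<Longrightarrow> p i s = p j r \<Longrightarrow> i = j \<and> s = r"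
  shows "emb d l c p"
  unfolding emb_def
proof (intro conjI allI impI)
  show "inj_on (\<lambda>(i, s). p i s) (slots d l)"
    using assms(5) by (auto simp: inj_on_def in_slots split: prod.splits)
qed (use assms in auto)

lemma emb_mono:
  assumes "emb d l c p" "\<And>i. i < d \<Longrightarrow> a i \<le> l i"
  shows "emb d a c p"
proof (rule embI)
  note e = embD[OF assms(1)]
  show "feet d a c p \<subseteq> V" using e(1) feet_mono[of d a l c p] assms(2) by blast
  show "adj (p i s) (p i (Suc s))" if "i < d" "s < a i" for i s
    using e(4)[of i s] assms(2)[of i] that by simp
  show "p i s \<noteq> c" if "i < d" "1 \<le> s" "s \<le> a i" for i s
    using e(5)[of i s] assms(2)[of i] that by simp
  show "i = j \<and> s = r" if "i < d" "1 \<le> s" "s \<le> a i" "j < d" "1 \<le> r" "r \<le> a j" "p i s = p j r" for i s j r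
    using e(6)[of i s j r] assms(2)[of i] assms(2)[of j] that by simp
qed (use embD[OF assms(1)] in auto)

lemma emb_col:
  assumes "emb d l c p" "i < d" "s \<le> l i"
  shows "col (p i s) = (if even s then col c else \<not> col c)"
  using assms(3)
proof (induction s)
  case (Suc s)
  then show ?case using adj_col[OF embD(4)[OF assms(1,2), of s]] by auto
qed (use embD(3)[OF assms(1,2)] in simp)

text \<open>Colours alternate along a leg, so this class consists of the odd positions. This sum and
  the one in \<open>emb_card_same\<close> are the sizes of the two classes of the spider;
  \<open>t\<close> bounds both of them from here on.\<close>

lemma emb_card_other:
  assumes "emb d l c p"
  shows "card {x \<in> feet d l c p. col x \<noteq> col c} = (\<Sum>i<d. (l i + 1) div 2)"
proof -
  let ?S = "SIGMA i:{..<d}. {s \<in> {1..l i}. odd s}"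
  have "{x \<in> feet d l c p. col x \<noteq> col c} = (\<lambda>(i, s). p i s) ` ?S"
  proof -
    have *: "col (p i s) \<noteq> col c \<longleftrightarrow> odd s" if "i < d" "s \<le> l i" for i s
      using emb_col[OF assms that] by auto
    have "x \<in> feet d l c p \<and> col x \<noteq> col c \<longleftrightarrow> (\<exists>i s. i < d \<and> 1 \<le> s \<and> s \<le> l i \<and> odd s \<and> x = p i s)" for x
      unfolding feet_iff using * by metis
    then show ?thesis by (auto simp: image_iff Bex_def)
  qed
  moreover have "inj_on (\<lambda>(i, s). p i s) ?S"
    by (rule inj_on_subset[OF embD(7)[OF assms]]) (auto simp: slots_def)
  moreover have "card ?S = (\<Sum>i<d. card {s \<in> {1..l i}. odd s})" by (rule card_SigmaI) auto
  ultimately show ?thesis by (simp only: card_image card_odd_upto)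
qed

lemma emb_card_same:
  assumes "emb d l c p"
  shows "card {x \<in> feet d l c p. col x = col c} = Suc (\<Sum>i<d. l i div 2)"
proof -
  let ?S = "SIGMA i:{..<d}. {s \<in> {1..l i}. even s}"
  have "{x \<in> feet d l c p. col x = col c} = insert c ((\<lambda>(i, s). p i s) ` ?S)"
  proof -
    have *: "col (p i s) = col c \<longleftrightarrow> even s" if "i < d" "s \<le> l i" for i s
      using emb_col[OF assms that] by auto
    have "x \<in> feet d l c p \<and> col x = col c \<longleftrightarrow> x = c \<or> (\<exists>i s. i < d \<and> 1 \<le> s \<and> s \<le> l i \<and> even s \<and> x = p i s)" for x
      unfolding feet_iff using * by metis
    then show ?thesis by (auto simp: image_iff Bex_def)
  qed
  moreover have "inj_on (\<lambda>(i, s). p i s) ?S"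
    by (rule inj_on_subset[OF embD(7)[OF assms]]) (auto simp: slots_def)
  moreover have "c \<notin> (\<lambda>(i, s). p i s) ` ?S" using embD(5)[OF assms] by fastforce
  moreover have "finite ?S" by auto
  moreover have "card ?S = (\<Sum>i<d. card {s \<in> {1..l i}. even s})" by (rule card_SigmaI) auto
  ultimately show ?thesis by (simp only: card_image card_even_upto card_insert_disjoint finite_imageI not_False_eq_True)
qed

lemma emb_nb_same:
  assumes "emb d l c p" "col w = col c"
  shows "card (nb (feet d l c p) w) \<le> (\<Sum>i<d. (l i + 1) div 2)"
  unfolding emb_card_other[OF assms(1), symmetric]
  using adj_col assms(2) by (intro card_mono) (auto simp: nb_def finite_feet)

lemma emb_nb_other:
  assumes "emb d l c p" "col w \<noteq> col c"
  shows "card (nb (feet d l c p) w) \<le> Suc (\<Sum>i<d. l i div 2)"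
  unfolding emb_card_same[OF assms(1), symmetric]
  using adj_col assms(2) by (intro card_mono) (auto simp: nb_def finite_feet)

lemma emb_extend:
  assumes e: "emb d a c p" and i: "i < d" and x: "x \<in> V" "x \<notin> feet d a c p" "adj (p i (a i)) x"
  shows "emb d (a(i := Suc (a i))) c (p(i := (p i)(Suc (a i) := x)))"
    "feet d (a(i := Suc (a i))) c (p(i := (p i)(Suc (a i) := x))) = insert x (feet d a c p)"
proof -
  let ?a = "a(i := Suc (a i))" and ?p = "p(i := (p i)(Suc (a i) := x))"
  note eD = embD[OF e]
  have pc: "?p j s = (if j = i \<and> s = Suc (a i) then x else p j s)" for j s by auto
  have new: "s \<le> ?a j \<longleftrightarrow> s \<le> a j \<or> (j = i \<and> s = Suc (a i))" for j s by auto
  show f: "feet d ?a c ?p = insert x (feet d a c p)"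
  proof (rule set_eqI)
    fix y
    show "y \<in> feet d ?a c ?p \<longleftrightarrow> y \<in> insert x (feet d a c p)"
    proof
      assume "y \<in> feet d ?a c ?p"
      then show "y \<in> insert x (feet d a c p)"
        unfolding feet_iff pc new insert_iff by (auto split: if_splits)
    next
      assume "y \<in> insert x (feet d a c p)"
      then have "y = x \<or> y = c \<or> (\<exists>j s. j < d \<and> 1 \<le> s \<and> s \<le> a j \<and> y = p j s)"
        using feet_iff[of y d a c p] by blast
      then consider "y = x" | "y = c" | j s where "j < d" "1 \<le> s" "s \<le> a j" "y = p j s"
        by auto
      then show "y \<in> feet d ?a c ?p"
      proof cases
        case 1
        then show ?thesis using i unfolding feet_iff by (intro disjI2 exI[of _ i] exI[of _ "Suc (a i)"]) simp
      next
        case 3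
        then show ?thesis unfolding feet_iff
          by (intro disjI2 exI[of _ j] exI[of _ s]) auto
      qed (simp add: feet_iff)
    qed
  qed
  have xn: "x \<noteq> c" "\<And>j s. j < d \<Longrightarrow> s \<le> a j \<Longrightarrow> p j s \<noteq> x" using x eD(8) unfolding feet_iff by blast+
  show "emb d ?a c ?p"
  proof (rule embI)
    show "feet d ?a c ?p \<subseteq> V" unfolding f using x(1) eD(1) by simp
    show "?p j 0 = c" if "j < d" for j using eD(3)[OF that] by auto
    show "adj (?p j s) (?p j (Suc s))" if "j < d" "s < ?a j" for j s
      using that eD(4)[of j s] x(3) by (cases "j = i"; cases "s = a i") auto
    show "?p j s \<noteq> c" if "j < d" "1 \<le> s" "s \<le> ?a j" for j s
      using that eD(5)[of j s] xn unfolding pc new by auto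
    show "j = k \<and> s = r" if "j < d" "1 \<le> s" "s \<le> ?a j" "k < d" "1 \<le> r" "r \<le> ?a k" "?p j s = ?p k r" for j s k r
    proof -
      have "s \<le> a j \<or> (j = i \<and> s = Suc (a i))" "r \<le> a k \<or> (k = i \<and> r = Suc (a i))"
        using that(3,6) unfolding new by auto
      then show ?thesis
        using that eD(6)[of j s k r] xn(2)[of j s] xn(2)[of k r] unfolding pc by (auto split: if_splits)
    qed
  qed
qed

lemma emb_trivial: "c \<in> V \<Longrightarrow> (\<And>i. i < d \<Longrightarrow> l i = 0) \<Longrightarrow> emb d l c (\<lambda>i s. c)"
  by (rule embI) (auto simp: feet_iff)

lemma feet_trivial: "(\<And>i. i < d \<Longrightarrow> l i = 0) \<Longrightarrow> feet d l c p = {c}"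
  by (auto simp: feet_iff)

lemma emb_cong: "(\<And>i. i < d \<Longrightarrow> a i = l i) \<Longrightarrow> emb d a c p \<longleftrightarrow> emb d l c p"
  using emb_mono[of d l c p a] emb_mono[of d a c p l] by auto

lemma feet_cong_len: "(\<And>i. i < d \<Longrightarrow> a i = l i) \<Longrightarrow> feet d a c p = feet d l c p"
  by (intro subset_antisym feet_mono) simp_all

lemma sum_upd_gt:
  fixes f :: "nat \<Rightarrow> nat"
  assumes "i < d"
  shows "(\<Sum>j<d. g ((f(i := m)) j)) + g (f i) = (\<Sum>j<d. g (f j)) + (g m :: nat)"
proof -
  have "(\<Sum>j<d. g ((f(i := m)) j)) = g m + (\<Sum>j\<in>{..<d} - {i}. g ((f(i := m)) j))"
    using sum.remove[of "{..<d}" i "\<lambda>j. g ((f(i := m)) j)"] assms by simp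
  moreover have "(\<Sum>j\<in>{..<d} - {i}. g ((f(i := m)) j)) = (\<Sum>j\<in>{..<d} - {i}. g (f j))"
    by (rule sum.cong) auto
  moreover have "(\<Sum>j<d. g (f j)) = g (f i) + (\<Sum>j\<in>{..<d} - {i}. g (f j))"
    using sum.remove[of "{..<d}" i "\<lambda>j. g (f j)"] assms by simp
  ultimately show ?thesis by simp
qed

text \<open>The tip to be extended has neighbours only in the opposite class, which in the partial
  copy is one smaller than in the full spider, so a free neighbour exists. The second degree
  condition is required only for a nontrivial spider, because a single centre needs no vertex of the
  other colour.\<close>

lemma emb_greedy:
  assumes A: "A \<subseteq> V" and c: "c \<in> A"
    and H1: "\<And>w. w \<in> A \<Longrightarrow> col w = col c \<Longrightarrow> (\<Sum>i<d. (l i + 1) div 2) \<le> card (nb A w)"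
    and H2: "\<And>w. w \<in> A \<Longrightarrow> col w \<noteq> col c \<Longrightarrow> 0 < (\<Sum>i<d. l i) \<Longrightarrow> Suc (\<Sum>i<d. l i div 2) \<le> card (nb A w)"
  shows "\<exists>p. emb d l c p \<and> feet d l c p \<subseteq> A"
  using H1 H2
proof (induction "\<Sum>i<d. l i" arbitrary: l)
  case 0
  then have "\<And>i. i < d \<Longrightarrow> l i = 0" by simp
  then have "emb d l c (\<lambda>i s. c)" "feet d l c (\<lambda>i s. c) = {c}"
    using emb_trivial[of c d l] feet_trivial[of d l c] c A by auto
  then show ?case using c by (intro exI[of _ "\<lambda>i s. c"]) simp
next
  case (Suc n)
  have "\<exists>i<d. l i \<noteq> 0"
  proof (rule ccontr)
    assume "\<not> ?thesis"
    then have "(\<Sum>i<d. l i) = 0" by simp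
    then show False using Suc(2) by simp
  qed
  then obtain i where i: "i < d" "l i \<noteq> 0" by blast
  define a where "a = l(i := l i - 1)"
  have la: "l = a(i := Suc (a i))" using i unfolding a_def by auto
  have s1: "(\<Sum>j<d. l j) = Suc (\<Sum>j<d. a j)"
    using sum_upd_gt[OF i(1), of "\<lambda>x. x" a "Suc (a i)"] unfolding la[symmetric] by simp
  have s2: "(\<Sum>j<d. (l j + 1) div 2) + (a i + 1) div 2 = (\<Sum>j<d. (a j + 1) div 2) + (a i + 2) div 2"
    using sum_upd_gt[OF i(1), of "\<lambda>x. (x + 1) div 2" a "Suc (a i)"] unfolding la[symmetric] by simp
  have s3: "(\<Sum>j<d. l j div 2) + a i div 2 = (\<Sum>j<d. a j div 2) + (a i + 1) div 2"
    using sum_upd_gt[OF i(1), of "\<lambda>x. x div 2" a "Suc (a i)"] unfolding la[symmetric] by simp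
  have "\<exists>p. emb d a c p \<and> feet d a c p \<subseteq> A"
  proof (rule Suc(1))
    show "n = (\<Sum>i<d. a i)" using s1 Suc(2) by simp
    show "(\<Sum>i<d. (a i + 1) div 2) \<le> card (nb A w)" if "w \<in> A" "col w = col c" for w
      using Suc(3)[OF that] s2 by linarith
    show "Suc (\<Sum>i<d. a i div 2) \<le> card (nb A w)" if "w \<in> A" "col w \<noteq> col c" for w
      using Suc(4)[OF that] s3 Suc(2) by linarith
  qed
  then obtain p where p: "emb d a c p" "feet d a c p \<subseteq> A" by blast
  let ?w = "p i (a i)"
  have w: "?w \<in> A" using embD(8)[OF p(1) i(1), of "a i"] p(2) by blast
  have cw: "col ?w = (if even (a i) then col c else \<not> col c)" by (rule emb_col[OF p(1) i(1)]) simp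
  have "card (nb (feet d a c p) ?w) < card (nb A ?w)"
  proof (cases "even (a i)")
    case True
    then have "col ?w = col c" using cw by simp
    then have "card (nb (feet d a c p) ?w) \<le> (\<Sum>i<d. (a i + 1) div 2)" "(\<Sum>i<d. (l i + 1) div 2) \<le> card (nb A ?w)"
      using emb_nb_same[OF p(1)] Suc(3)[OF w] by auto
    moreover have "(a i + 2) div 2 = Suc ((a i + 1) div 2)" using True by (auto elim: evenE)
    ultimately show ?thesis using s2 by linarith
  next
    case False
    then have "col ?w \<noteq> col c" using cw by simp
    then have "card (nb (feet d a c p) ?w) \<le> Suc (\<Sum>i<d. a i div 2)" "Suc (\<Sum>i<d. l i div 2) \<le> card (nb A ?w)"
      using emb_nb_other[OF p(1)] Suc(4)[OF w] Suc(2) by auto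
    moreover have "(a i + 1) div 2 = Suc (a i div 2)" using False by (auto elim: oddE)
    ultimately show ?thesis using s3 by linarith
  qed
  moreover have "finite (nb (feet d a c p) ?w)" by (simp add: finite_nb finite_feet)
  ultimately obtain x where x: "x \<in> nb A ?w" "x \<notin> nb (feet d a c p) ?w"
    using card_mono[of "nb (feet d a c p) ?w" "nb A ?w"] by (meson not_less subsetI)
  then have x': "x \<in> A" "x \<notin> feet d a c p" "adj ?w x" unfolding nb_def by auto
  have "x \<in> V" using x' A by blast
  note ex = emb_extend[OF p(1) i(1) this x'(2,3)]
  show ?case using ex p(2) x' unfolding la[symmetric] by (intro exI[of _ "p(i := (p i)(Suc (a i) := x))"]) auto
qed

text \<open>Legs that lack just their last vertex can be completed in any order: a tip has
  \<open>t + 1\<close> neighbours in \<open>W\<close>, and the partial copy never occupies more than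
  \<open>t\<close> of them.\<close>

lemma emb_finish:
  assumes W: "W \<subseteq> V" and e: "emb d a c p" "feet d a c p \<subseteq> W"
    and al: "\<And>i. i < d \<Longrightarrow> a i = l i \<or> Suc (a i) = l i \<and> Suc t \<le> card (nb W (p i (a i)))"
    and t: "(\<Sum>i<d. (l i + 1) div 2) \<le> t" "Suc (\<Sum>i<d. l i div 2) \<le> t"
  shows "\<exists>p. emb d l c p \<and> feet d l c p \<subseteq> W"
  using e al
proof (induction "card {i. i < d \<and> a i \<noteq> l i}" arbitrary: a p)
  case 0
  then have "{i. i < d \<and> a i \<noteq> l i} = {}" by simp
  then have "\<And>i. i < d \<Longrightarrow> a i = l i" by blast
  then show ?case using 0 emb_cong[of d a l c p] feet_cong_len[of d a l c p] by blast
next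
  case (Suc n)
  have "{i. i < d \<and> a i \<noteq> l i} \<noteq> {}" using Suc(2) by (metis card.empty nat.distinct(2))
  then obtain i where i: "i < d" "a i \<noteq> l i" by blast
  have dg: "Suc (a i) = l i" "Suc t \<le> card (nb W (p i (a i)))" using Suc(5)[OF i(1)] i by auto
  let ?w = "p i (a i)"
  have le: "a j \<le> l j" if "j < d" for j using Suc(5)[OF that] by auto
  have "card (nb (feet d a c p) ?w) \<le> t"
  proof (cases "col ?w = col c")
    case True
    have "(\<Sum>i<d. (a i + 1) div 2) \<le> (\<Sum>i<d. (l i + 1) div 2)"
      using le by (intro sum_mono div_le_mono) auto
    then show ?thesis using emb_nb_same[OF Suc(3) True] t by linarith
  next
    case False
    have "(\<Sum>i<d. a i div 2) \<le> (\<Sum>i<d. l i div 2)"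
      using le by (intro sum_mono div_le_mono) auto
    then show ?thesis using emb_nb_other[OF Suc(3) False] t by linarith
  qed
  then have "card (nb (feet d a c p) ?w) < card (nb W ?w)" using dg by simp
  moreover have "finite (nb (feet d a c p) ?w)" by (simp add: finite_nb finite_feet)
  ultimately obtain x where x: "x \<in> nb W ?w" "x \<notin> nb (feet d a c p) ?w"
    using card_mono[of "nb (feet d a c p) ?w" "nb W ?w"] by (meson not_less subsetI)
  then have x': "x \<in> W" "x \<notin> feet d a c p" "adj ?w x" unfolding nb_def by auto
  have "x \<in> V" using x' W by blast
  note ex = emb_extend[OF Suc(3) i(1) this x'(2,3)]
  let ?a = "a(i := Suc (a i))" and ?p = "p(i := (p i)(Suc (a i) := x))"
  show ?case
  proof (rule Suc(1)[OF _ ex(1)])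
    have "{j. j < d \<and> ?a j \<noteq> l j} = {j. j < d \<and> a j \<noteq> l j} - {i}" using dg by auto
    then show "n = card {j. j < d \<and> ?a j \<noteq> l j}" using Suc(2) i by simp
    show "feet d ?a c ?p \<subseteq> W" unfolding ex(2) using Suc(4) x'(1) by simp
    show "?a j = l j \<or> Suc (?a j) = l j \<and> Suc t \<le> card (nb W (?p j (?a j)))" if "j < d" for j
      using Suc(5)[OF that] dg by auto
  qed
qed

end

section \<open>Rerouting a leg around one of its vertices\<close>

context bip_graph begin

lemma emb_replace_leg:
  assumes e: "emb d l c p" and i: "i < d" and q0: "q 0 = c"
    and qa: "\<And>r. r < l i \<Longrightarrow> adj (q r) (q (Suc r))"
    and qi: "\<And>r r'. 1 \<le> r \<Longrightarrow> r \<le> l i \<Longrightarrow> 1 \<le> r' \<Longrightarrow> r' \<le> l i \<Longrightarrow> q r = q r' \<Longrightarrow> r = r'"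
    and qV: "\<And>r. 1 \<le> r \<Longrightarrow> r \<le> l i \<Longrightarrow> q r \<in> V"
    and qc: "\<And>r. 1 \<le> r \<Longrightarrow> r \<le> l i \<Longrightarrow> q r \<noteq> c"
    and qo: "\<And>r k s. 1 \<le> r \<Longrightarrow> r \<le> l i \<Longrightarrow> k < d \<Longrightarrow> k \<noteq> i \<Longrightarrow> 1 \<le> s \<Longrightarrow> s \<le> l k \<Longrightarrow> q r \<noteq> p k s"
  shows "emb d l c (p(i := q))"
proof (rule embI)
  note eD = embD[OF e]
  show "feet d l c (p(i := q)) \<subseteq> V"
  proof
    fix x assume "x \<in> feet d l c (p(i := q))"
    then have "x = c \<or> (\<exists>k s. k < d \<and> 1 \<le> s \<and> s \<le> l k \<and> x = (p(i := q)) k s)" by (simp only: feet_iff)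
    then show "x \<in> V"
    proof (elim disjE exE conjE)
      fix k s assume "k < d" "1 \<le> s" "s \<le> l k" "x = (p(i := q)) k s"
      then show ?thesis using eD(1) eD(8)[of k s] qV[of s] by (cases "k = i") auto
    qed (use eD(2) in simp)
  qed
  show "(p(i := q)) k 0 = c" if "k < d" for k using that eD(3)[of k] q0 by (cases "k = i") simp_all
  show "adj ((p(i := q)) k s) ((p(i := q)) k (Suc s))" if "k < d" "s < l k" for k s
    using that eD(4)[of k s] qa[of s] by (cases "k = i") simp_all
  show "(p(i := q)) k s \<noteq> c" if "k < d" "1 \<le> s" "s \<le> l k" for k s
    using that eD(5)[of k s] qc[of s] by auto
  show "k = m \<and> s = r" if "k < d" "1 \<le> s" "s \<le> l k" "m < d" "1 \<le> r" "r \<le> l m"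
      "(p(i := q)) k s = (p(i := q)) m r" for k s m r
  proof (cases "k = i"; cases "m = i")
    assume "k = i" "m = i" then show ?thesis using qi[of s r] that by simp
  next
    assume "k = i" "m \<noteq> i" then show ?thesis using qo[of s m r] that by simp
  next
    assume "k \<noteq> i" "m = i" then show ?thesis using qo[of r k s] that by simp
  next
    assume "k \<noteq> i" "m \<noteq> i" then show ?thesis using eD(6)[of k s m r] that by simp
  qed
qed

text \<open>For the count in \<open>reroute\<close>: the left set holds leg positions, the right one
  detour positions. The surplus of one comes from \<open>Suc k\<close> and makes up for the position
  \<open>j\<close>, which may have to be discounted.\<close>

lemma parity_interval_card:
  assumes "a \<le> (k::nat)"
  shows "card {u \<in> {a<..Suc k}. even u = even (Suc k)} = Suc (card {m \<in> {a<..<k}. even m = even (Suc k)})"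
proof -
  have "{u \<in> {a<..Suc k}. even u = even (Suc k)} = insert (Suc k) {m \<in> {a<..<k}. even m = even (Suc k)}"
    using assms by (auto simp: le_Suc_eq nat_less_le)
  then show ?thesis by (simp add: card_insert_disjoint)
qed

text \<open>Leave the leg before \<open>j\<close> along a longest detour outside the copy. Either
  the detour replaces the whole rest of the leg, or it returns to the leg beyond \<open>j\<close>.
  If it could do neither, its last vertex would have at most \<open>t\<close> neighbours in
  \<open>W\<close>.\<close>

lemma reroute:
  assumes e: "emb d l c p" and W: "W \<subseteq> V" "feet d l c p \<subseteq> W"
    and t: "(\<Sum>i<d. (l i + 1) div 2) \<le> t" "Suc (\<Sum>i<d. l i div 2) \<le> t"
    and i: "i < d" and j: "s < j" "j \<le> l i"
    and w: "w \<in> W - feet d l c p" "adj w (p i s)"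
    and rich: "\<And>u. u \<in> W - feet d l c p \<Longrightarrow> Suc t \<le> card (nb W u)"
  shows "\<exists>p'. emb d l c p' \<and> feet d l c p' \<subseteq> W \<and> p i j \<notin> feet d l c p'"
proof -
  note eD = embD[OF e]
  let ?T = "feet d l c p"
  define R where "R = W - ?T"
  define S where "S = {s. s < j \<and> (\<exists>w\<in>R. adj w (p i s))}"
  have S: "finite S" "s \<in> S" using w j unfolding S_def R_def by auto
  \<comment> \<open>The last exit before \<open>j\<close>: leg positions strictly between
    \<open>a\<close> and \<open>j\<close> have no neighbour outside the copy.\<close>
  define a where "a = Max S"
  have a: "a \<in> S" "\<And>u. u \<in> S \<Longrightarrow> u \<le> a" using Max_in[OF S(1)] Max_ge[OF S(1)] S(2) unfolding a_def by blast+
  then obtain w0 where w0: "a < j" "w0 \<in> R" "adj w0 (p i a)" unfolding S_def by blast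
  have al: "a < l i" using w0 j by simp
  \<comment> \<open>A detour that occupies the positions \<open>Suc a\<close> to \<open>k\<close> of
    the leg with vertices outside the copy; \<open>k\<close> will be chosen as large as
    possible.\<close>
  define P where "P k r \<longleftrightarrow> a < k \<and> k \<le> l i \<and> adj (p i a) (r (Suc a)) \<and> (\<forall>m. a < m \<longrightarrow> m \<le> k \<longrightarrow> r m \<in> R) \<and>
    (\<forall>m. a < m \<longrightarrow> m < k \<longrightarrow> adj (r m) (r (Suc m))) \<and> inj_on r {a<..k}" for k and r :: "nat \<Rightarrow> 'v"
  have "P (Suc a) (\<lambda>_. w0)"
    unfolding P_def using w0 al adj_sym by (auto simp: inj_on_def)
  then have ne: "{k. \<exists>r. P k r} \<noteq> {}" by blast
  have fin: "finite {k. \<exists>r. P k r}" by (rule finite_subset[of _ "{..l i}"]) (auto simp: P_def)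
  define k where "k = Max {k. \<exists>r. P k r}"
  obtain r where "P k r" using Max_in[OF fin ne] unfolding k_def by blast
  then have r: "a < k" "k \<le> l i" "adj (p i a) (r (Suc a))" "\<And>m. a < m \<Longrightarrow> m \<le> k \<Longrightarrow> r m \<in> R"
    "\<And>m. a < m \<Longrightarrow> m < k \<Longrightarrow> adj (r m) (r (Suc m))" "inj_on r {a<..k}"
    unfolding P_def by auto
  have kmax: "\<not> P (Suc k) r'" for r'
  proof
    assume "P (Suc k) r'"
    then have "Suc k \<le> k" using Max_ge[OF fin, of "Suc k"] unfolding k_def by blast
    then show False by simp
  qed
  have rR: "r m \<notin> ?T" "r m \<in> W" if "a < m" "m \<le> k" for m using r(4)[OF that] unfolding R_def by auto
  have rinj: "m = m'" if "r m = r m'" "a < m" "m \<le> k" "a < m'" "m' \<le> k" for m m'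
    using inj_onD[OF r(6) that(1)] that by simp
  have pT: "p i' s' \<in> ?T" if "i' < d" "s' \<le> l i'" for i' s' using eD(8)[OF that] .
  have rc: "col (r m) = (if even m then col c else \<not> col c)" if "a < m" "m \<le> k" for m
    using that
  proof (induction m)
    case (Suc m)
    show ?case
    proof (cases "m = a")
      case True
      then show ?thesis using adj_col[OF r(3)] emb_col[OF e i, of a] al by auto
    next
      case False
      then have "a < m" "m \<le> k" using Suc by auto
      then show ?thesis using Suc.IH adj_col[OF r(5)[of m]] Suc(3) by auto
    qed
  qed simp
  \<comment> \<open>Position \<open>x\<close> beyond the detour is filled with position
    \<open>u + (x - Suc k)\<close> of the old leg. As \<open>u\<close> is at most
    \<open>Suc k\<close>, the old leg is long enough for this, and as \<open>u\<close> exceeds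
    \<open>j\<close>, the vertex \<open>p i j\<close> is skipped.\<close>
  have finish: ?thesis if u: "k = l i \<or> (adj (r k) (p i u) \<and> j < u \<and> u \<le> Suc k)" for u
  proof -
    let ?q = "\<lambda>x. if x \<le> a then p i x else if x \<le> k then r x else p i (u + (x - Suc k))"
    have top: "adj (r k) (p i u)" "j < u" "u + (x - Suc k) \<le> l i" if "k < x" "x \<le> l i" for x
      using u that by auto
    have qT: "?q x \<in> W" if "x \<le> l i" for x
      using that W(2) pT[OF i, of x] pT[OF i, of "u + (x - Suc k)"] rR[of x] top[of x] al by auto
    have qR: "?q x \<noteq> y" if "y \<in> ?T" "\<And>s'. s' \<le> l i \<Longrightarrow> 1 \<le> s' \<Longrightarrow> y \<noteq> p i s'" "1 \<le> x" "x \<le> l i" for x y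
    proof -
      consider "x \<le> a" | "a < x" "x \<le> k" | "a < x" "k < x" by linarith
      then show ?thesis
      proof cases
        case 1 then show ?thesis using that by auto
      next
        case 2 then show ?thesis using that(1) rR(1)[of x] by auto
      next
        case 3
        have ge: "1 \<le> u + (x - Suc k)" using top(2)[OF 3(2) that(4)] by linarith
        have "y \<noteq> p i (u + (x - Suc k))" by (rule that(2)[OF top(3)[OF 3(2) that(4)] ge])
        then show ?thesis using 3 by auto
      qed
    qed
    have E: "emb d l c (p(i := ?q))"
    proof (rule emb_replace_leg[OF e i])
      show "?q 0 = c" using eD(3)[OF i] by simp
      show "adj (?q x) (?q (Suc x))" if x: "x < l i" for x
      proof -
        consider "Suc x \<le> a" | "x = a" | "a < x" "Suc x \<le> k" | "x = k" | "k < x" by linarith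
        then show ?thesis
        proof cases
          case 1 then show ?thesis using eD(4)[OF i x] by simp
        next
          case 2 then show ?thesis using r(1,3) by simp
        next
          case 3 then show ?thesis using r(5)[of x] by simp
        next
          case 4 then show ?thesis using top(1)[of "Suc x"] x r(1) by simp
        next
          case 5
          have "u + (Suc x - Suc k) = Suc (u + (x - Suc k))" using 5 by simp
          moreover have "u + (x - Suc k) < l i" using top(3)[of "Suc x"] 5 x by simp
          ultimately show ?thesis using eD(4)[OF i, of "u + (x - Suc k)"] 5 r(1) by simp
        qed
      qed
      show "x = x'" if x: "1 \<le> x" "x \<le> l i" "1 \<le> x'" "x' \<le> l i" "?q x = ?q x'" for x x'
      proof -
        have pin: "y = y'" if "p i y = p i y'" "1 \<le> y" "y \<le> l i" "1 \<le> y'" "y' \<le> l i" for y y'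
          using eD(6)[OF i _ _ i, of y y'] that by simp
        have rp: "r m \<noteq> p i y" if "a < m" "m \<le> k" "y \<le> l i" for m y
          using rR(1)[of m] pT[OF i, of y] that by auto
        show ?thesis
        proof (rule ccontr)
          assume n: "x \<noteq> x'"
          have B: "u + (y - Suc k) \<le> l i" "1 \<le> u + (y - Suc k)" "a < u + (y - Suc k)" if "k < y" "y \<le> l i" for y
            using top[OF that] j w0 by auto
          consider "x \<le> a" "x' \<le> a" | "x \<le> a" "a < x'" "x' \<le> k" | "x \<le> a" "k < x'"
            | "a < x" "x \<le> k" "x' \<le> a" | "a < x" "x \<le> k" "a < x'" "x' \<le> k" | "a < x" "x \<le> k" "k < x'"
            | "k < x" "x' \<le> a" | "k < x" "a < x'" "x' \<le> k" | "k < x" "k < x'" by linarith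
          then show False
          proof cases
            case 1 then show False using pin[of x x'] x n by simp
          next
            case 2 then show False using rp[of x' x] x by simp
          next
            case 3
            then have "p i x = p i (u + (x' - Suc k))" using x(5) r(1) by simp
            then show False using pin[of x "u + (x' - Suc k)"] x 3 B[of x'] by simp
          next
            case 4 then show False using rp[of x x'] x by simp
          next
            case 5 then show False using rinj[of x x'] x n by simp
          next
            case 6
            then have "r x = p i (u + (x' - Suc k))" using x(5) r(1) by simp
            then show False using rp[of x "u + (x' - Suc k)"] x 6 B[of x'] by simp
          next
            case 7
            then have "p i x' = p i (u + (x - Suc k))" using x(5) r(1) by simp
            then show False using pin[of x' "u + (x - Suc k)"] x 7 B[of x] by simp
          next
            case 8
            then have "r x' = p i (u + (x - Suc k))" using x(5) r(1) by simp
            then show False using rp[of x' "u + (x - Suc k)"] x 8 B[of x] by simp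
          next
            case 9
            then have "p i (u + (x - Suc k)) = p i (u + (x' - Suc k))" using x(5) r(1) by simp
            then have "u + (x - Suc k) = u + (x' - Suc k)" using pin x 9 B[of x] B[of x'] by blast
            then show False using n 9 by simp
          qed
        qed
      qed
      show "?q x \<in> V" if "1 \<le> x" "x \<le> l i" for x using qT[OF that(2)] W(1) by blast
      show "?q x \<noteq> c" if "1 \<le> x" "x \<le> l i" for x
        by (rule qR[OF _ _ that]) (use eD(5)[OF i] in \<open>auto simp: feet_iff\<close>)
      show "?q x \<noteq> p k' s'" if "1 \<le> x" "x \<le> l i" "k' < d" "k' \<noteq> i" "1 \<le> s'" "s' \<le> l k'" for x k' s'
      proof (rule qR[OF _ _ that(1,2)])
        show "p k' s' \<in> ?T" by (rule pT[OF that(3,6)])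
        show "p k' s' \<noteq> p i y" if "y \<le> l i" "1 \<le> y" for y
          using eD(6)[of k' s' i y] \<open>k' < d\<close> \<open>k' \<noteq> i\<close> \<open>1 \<le> s'\<close> \<open>s' \<le> l k'\<close> i that by blast
      qed
    qed
    have mem: "y = c \<or> (\<exists>k' s'. k' < d \<and> k' \<noteq> i \<and> 1 \<le> s' \<and> s' \<le> l k' \<and> y = p k' s') \<or> (\<exists>x. 1 \<le> x \<and> x \<le> l i \<and> y = ?q x)"
      if y: "y \<in> feet d l c (p(i := ?q))" for y
    proof -
      have "y = c \<or> (\<exists>k s. k < d \<and> 1 \<le> s \<and> s \<le> l k \<and> y = (p(i := ?q)) k s)" using y by (simp only: feet_iff)
      then show ?thesis
      proof (elim disjE exE conjE)
        fix k' s' assume *: "k' < d" "1 \<le> s'" "s' \<le> l k'" "y = (p(i := ?q)) k' s'"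
        then show ?thesis by (cases "k' = i") auto
      qed simp
    qed
    have sub: "feet d l c (p(i := ?q)) \<subseteq> W"
    proof
      fix y assume "y \<in> feet d l c (p(i := ?q))"
      from mem[OF this] show "y \<in> W"
      proof (elim disjE exE conjE)
        show "y \<in> W" if "y = c" using that W(2) by (auto simp: feet_def)
        show "y \<in> W" if "k' < d" "s' \<le> l k'" "y = p k' s'" for k' s' using pT[OF that(1,2)] that(3) W(2) by blast
        show "y \<in> W" if "x \<le> l i" "y = ?q x" for x using qT[OF that(1)] that(2) by simp
      qed
    qed
    have "p i j \<notin> feet d l c (p(i := ?q))"
    proof
      assume "p i j \<in> feet d l c (p(i := ?q))"
      from mem[OF this] show False
      proof (elim disjE exE conjE)
        show False if "p i j = c" using eD(5)[OF i, of j] j that by simp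
        show False if "k' < d" "k' \<noteq> i" "1 \<le> s'" "s' \<le> l k'" "p i j = p k' s'" for k' s'
          using eD(6)[of i j k' s'] i j that by simp
        show False if x: "1 \<le> x" "x \<le> l i" "p i j = ?q x" for x
        proof -
          consider "x \<le> a" | "a < x" "x \<le> k" | "k < x" by linarith
          then show False
          proof cases
            case 1
            then have "j = x" using eD(6)[of i j i x] i j x by simp
            then show False using 1 w0 by simp
          next
            case 2 then show False using rR(1)[of x] pT[OF i j(2)] x(3) by simp
          next
            case 3
            then have "p i j = p i (u + (x - Suc k))" using x(3) r(1) by simp
            then have "j = u + (x - Suc k)" using eD(6)[of i j i "u + (x - Suc k)"] i j top[OF 3 x(2)] by simp
            then show False using top(2)[OF 3 x(2)] by simp
          qed
        qed
      qed
    qed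
    then show ?thesis using E sub by blast
  qed
  show ?thesis
  proof (cases "k = l i")
    case True then show ?thesis using finish by blast
  next
    case False
    then have kl: "k < l i" using r(2) by simp
    have "\<exists>u. adj (r k) (p i u) \<and> j < u \<and> u \<le> Suc k"
    proof (rule ccontr)
      assume no: "\<not> ?thesis"
      \<comment> \<open>Neighbours of \<open>r k\<close> lie in the opposite class \<open>?C\<close>
        of the copy or, by maximality of \<open>k\<close>, on the detour at indices in
        \<open>?M\<close>. The leg positions in \<open>?U\<close> other than \<open>j\<close> are
        not neighbours: those below \<open>j\<close> by the choice of \<open>a\<close>, those above
        by \<open>no\<close>. They are at least as many as \<open>?M\<close>, so at most
        \<open>t\<close> neighbours remain.\<close>
      let ?U = "{u \<in> {a<..Suc k}. even u = even (Suc k)}"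
      let ?M = "{m \<in> {a<..<k}. even m = even (Suc k)}"
      let ?C = "{x \<in> ?T. col x \<noteq> col (r k)}"
      have ck: "col (r k) = (if even k then col c else \<not> col c)" using rc[of k] r(1) by simp
      have ct: "card ?C \<le> t"
      proof (cases "even k")
        case True
        then have "?C = {x \<in> ?T. col x \<noteq> col c}" using ck by auto
        then show ?thesis using emb_card_other[OF e] t by simp
      next
        case False
        then have "?C = {x \<in> ?T. col x = col c}" using ck by auto
        then show ?thesis using emb_card_same[OF e] t by simp
      qed
      have fC: "finite ?C" using finite_feet[of d l c p] by simp
      have sub: "p i ` (?U - {j}) \<subseteq> ?C"
      proof
        fix y assume "y \<in> p i ` (?U - {j})"
        then obtain u where u: "u \<in> ?U" "y = p i u" by blast
        then have "u \<le> l i" using kl by auto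
        then have "y \<in> ?T" "col y = (if even u then col c else \<not> col c)"
          using u(2) pT[OF i] emb_col[OF e i] by auto
        then show "y \<in> ?C" using ck u by auto
      qed
      have inj: "inj_on (p i) (?U - {j})"
        using eD(6)[of i _ i] i kl by (fastforce intro!: inj_onI)
      have nb: "nb W (r k) \<subseteq> (?C - p i ` (?U - {j})) \<union> r ` ?M"
      proof
        fix y assume y: "y \<in> nb W (r k)"
        then have yW: "y \<in> W" "adj (r k) y" unfolding nb_def by auto
        show "y \<in> (?C - p i ` (?U - {j})) \<union> r ` ?M"
        proof (cases "y \<in> ?T")
          case True
          moreover have "col y \<noteq> col (r k)" using adj_col[OF yW(2)] by simp
          moreover have "y \<notin> p i ` (?U - {j})"
          proof
            assume "y \<in> p i ` (?U - {j})"
            then obtain u where u: "a < u" "u \<le> Suc k" "u \<noteq> j" "y = p i u" by auto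
            have "\<not> j < u" using no u yW by blast
            then have "u \<in> S" unfolding S_def using u yW r(4)[of k] r(1) by auto
            then show False using a(2) u(1) by fastforce
          qed
          ultimately show ?thesis by blast
        next
          case False
          then have yR: "y \<in> R" using yW unfolding R_def by simp
          have "y \<in> r ` {a<..k}"
          proof (rule ccontr)
            assume ny: "y \<notin> r ` {a<..k}"
            have "P (Suc k) (r(Suc k := y))"
              unfolding P_def
            proof (intro conjI allI impI)
              show "inj_on (r(Suc k := y)) {a<..Suc k}"
              proof (rule inj_onI)
                fix x x' assume xx: "x \<in> {a<..Suc k}" "x' \<in> {a<..Suc k}" "(r(Suc k := y)) x = (r(Suc k := y)) x'"
                show "x = x'"
                proof (cases "x = Suc k"; cases "x' = Suc k")
                  assume "x = Suc k" "x' \<noteq> Suc k"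
                  then have "y = r x'" "x' \<in> {a<..k}" using xx by auto
                  then show ?thesis using ny by blast
                next
                  assume "x \<noteq> Suc k" "x' = Suc k"
                  then have "y = r x" "x \<in> {a<..k}" using xx by auto
                  then show ?thesis using ny by blast
                next
                  assume "x \<noteq> Suc k" "x' \<noteq> Suc k"
                  then show ?thesis using xx rinj[of x x'] by auto
                qed simp
              qed
            qed (use r kl yR yW al in \<open>auto simp: le_Suc_eq less_Suc_eq\<close>)
            then show False using kmax by blast
          qed
          then obtain m where m: "a < m" "m \<le> k" "y = r m" by auto
          have "col (r m) \<noteq> col (r k)" using adj_col[OF yW(2)] m by simp
          then have "even m \<noteq> even k" using rc[of m] rc[of k] m r(1) by (auto split: if_splits)
          then have "m \<in> ?M" using m by (auto simp: nat_less_le)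
          then show ?thesis using m by blast
        qed
      qed
      have "card (nb W (r k)) \<le> card ((?C - p i ` (?U - {j})) \<union> r ` ?M)"
        using nb by (rule card_mono[rotated]) (use fC in auto)
      also have "\<dots> \<le> card (?C - p i ` (?U - {j})) + card (r ` ?M)" by (rule card_Un_le)
      also have "\<dots> \<le> card (?C - p i ` (?U - {j})) + card ?M" by (simp add: card_image_le)
      finally have 1: "card (nb W (r k)) \<le> card (?C - p i ` (?U - {j})) + card ?M" .
      have "card (?C - p i ` (?U - {j})) = card ?C - card (?U - {j})"
        using card_Diff_subset[of "p i ` (?U - {j})" ?C] sub card_image[OF inj] by simp
      moreover have "card (?U - {j}) \<le> card ?C"
        using card_mono[OF fC sub] card_image[OF inj] by simp
      moreover have "card ?U \<le> Suc (card (?U - {j}))"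
        by (cases "j \<in> ?U") (simp_all add: card_Diff_singleton)
      moreover have "card ?U = Suc (card ?M)" using parity_interval_card[of a k] r(1) by simp
      ultimately have "card (nb W (r k)) \<le> t" using 1 ct by linarith
      moreover have "Suc t \<le> card (nb W (r k))" using rich[of "r k"] r(4)[of k] r(1) unfolding R_def by simp
      ultimately show False by simp
    qed
    then show ?thesis using finish by blast
  qed
qed

end

section \<open>Moving spiders off a vertex\<close>

lemma sum_half_odd:
  "(\<Sum>i<d. (a i + 1) div 2) = (\<Sum>i<d. a i div 2) + card {i \<in> {..<d}. odd (a i)}" for d :: nat and a :: "nat \<Rightarrow> nat"
proof -
  have "(\<Sum>i<d. (a i + 1) div 2) = (\<Sum>i<d. a i div 2 + (if odd (a i) then 1 else 0))"
    by (rule sum.cong) (auto elim!: oddE evenE)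
  also have "\<dots> = (\<Sum>i<d. a i div 2) + card {i \<in> {..<d}. odd (a i)}"
    by (simp add: sum.distrib sum.If_cases Int_def)
  finally show ?thesis .
qed

text \<open>The setting in which \<open>copy_avoid\<close> is to be proved, with the host
  \<open>W\<close> fixed. \<open>dl\<close> rules out a path on three or more vertices that is
  presented with an end as its centre.\<close>

locale spider_host = bip_graph V adj col
  for V :: "'v set" and adj col +
  fixes d :: nat and l :: "nat \<Rightarrow> nat" and t :: nat and W :: "'v set"
  assumes W: "W \<subseteq> V"
    and t1: "(\<Sum>i<d. (l i + 1) div 2) \<le> t" and t2: "Suc (\<Sum>i<d. l i div 2) \<le> t"
    and lpos: "\<And>i. i < d \<Longrightarrow> 1 \<le> l i"
    and dl: "2 \<le> d \<or> (\<forall>i<d. l i \<le> 1)"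
    and rich: "\<And>c p w. emb d l c p \<Longrightarrow> feet d l c p \<subseteq> W \<Longrightarrow> w \<in> W - feet d l c p \<Longrightarrow> Suc t \<le> card (nb W w)"
begin

definition core :: "'v set" where
  "core = {v \<in> W. \<forall>c p. emb d l c p \<longrightarrow> feet d l c p \<subseteq> W \<longrightarrow> v \<in> feet d l c p}"

definition height :: "(nat \<Rightarrow> nat \<Rightarrow> 'v) \<Rightarrow> nat \<Rightarrow> nat" where
  "height p i = Max {s. s \<le> l i \<and> p i s \<in> core}"

section \<open>The vertices common to all copies\<close>

lemma finW: "finite W"
  using fin W by blast

text \<open>Such an edge would allow a rerouting that avoids \<open>p i j\<close>, which no copy
  does.\<close>

lemma no_nb:
  assumes e: "emb d l c p" "feet d l c p \<subseteq> W" and i: "i < d" "s < j" "j \<le> l i" "p i j \<in> core"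
    and w: "w \<in> W - feet d l c p"
  shows "\<not> adj w (p i s)"
proof
  assume "adj w (p i s)"
  then obtain p' where "emb d l c p'" "feet d l c p' \<subseteq> W" "p i j \<notin> feet d l c p'"
    using reroute[OF e(1) W e(2) t1 t2 i(1-3) w] rich[OF e] by blast
  then show False using i(4) unfolding core_def by blast
qed

lemma rich_core: "w \<in> W - core \<Longrightarrow> Suc t \<le> card (nb W w)"
  using rich unfolding core_def by blast

lemma emb_nb_le: "emb d l c p \<Longrightarrow> card (nb (feet d l c p) w) \<le> t"
  using emb_nb_same[of d l c p w] emb_nb_other[of d l c p w] t1 t2 by fastforce

text \<open>A vertex outside \<open>core\<close> is missed by some copy and so has
  \<open>t + 1\<close> neighbours in \<open>W\<close>, whereas here all neighbours of
  \<open>x\<close> lie in one copy, which offers at most \<open>t\<close>.\<close>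

lemma poor_core:
  assumes e: "emb d l c p" "feet d l c p \<subseteq> W" and x: "x \<in> feet d l c p"
    and n: "\<And>w. w \<in> W - feet d l c p \<Longrightarrow> \<not> adj w x"
  shows "x \<in> core"
proof (rule ccontr)
  assume "x \<notin> core"
  then have "Suc t \<le> card (nb W x)" using rich_core x e(2) by blast
  moreover have "nb W x \<subseteq> nb (feet d l c p) x" using n adj_sym unfolding nb_def by blast
  then have "card (nb W x) \<le> card (nb (feet d l c p) x)"
    by (rule card_mono[OF finite_nb[OF finite_feet]])
  ultimately show False using emb_nb_le[OF e(1), of x] by simp
qed

text \<open>By \<open>no_nb\<close> an earlier vertex of the leg has no neighbours outside the copy,
  so \<open>poor_core\<close> applies. Hence \<open>core\<close> meets each leg in an initial
  segment, which is what makes \<open>height\<close> meaningful.\<close>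

lemma pred_core:
  assumes e: "emb d l c p" "feet d l c p \<subseteq> W" and i: "i < d" "s < j" "j \<le> l i" "p i j \<in> core"
  shows "p i s \<in> core"
  using poor_core[OF e, of "p i s"] no_nb[OF e i] embD(8)[OF e(1) i(1), of s] i by simp

lemma centre_core:
  assumes e: "emb d l c p" "feet d l c p \<subseteq> W" and ne: "core \<noteq> {}"
  shows "c \<in> core"
proof -
  obtain v where v: "v \<in> core" using ne by blast
  then have "v \<in> feet d l c p" using e unfolding core_def by blast
  then consider "v = c" | i s where "i < d" "1 \<le> s" "s \<le> l i" "v = p i s" unfolding feet_iff by blast
  then show ?thesis
  proof cases
    case 2
    then show ?thesis using pred_core[OF e 2(1), of 0 s] v embD(3)[OF e(1) 2(1)] by simp
  qed (use v in simp)
qed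

lemma height:
  assumes e: "emb d l c p" "feet d l c p \<subseteq> W" and ne: "core \<noteq> {}" and i: "i < d"
  shows "height p i \<le> l i" "p i (height p i) \<in> core" "\<And>s. s \<le> l i \<Longrightarrow> p i s \<in> core \<longleftrightarrow> s \<le> height p i"
proof -
  let ?S = "{s. s \<le> l i \<and> p i s \<in> core}"
  have f: "finite ?S" by simp
  have "0 \<in> ?S" using embD(3)[OF e(1) i] centre_core[OF e ne] by simp
  then have m: "height p i \<in> ?S" "\<And>s. s \<in> ?S \<Longrightarrow> s \<le> height p i"
    unfolding height_def using Max_in[OF f] Max_ge[OF f] by blast+
  show "height p i \<le> l i" "p i (height p i) \<in> core" using m by auto
  show "p i s \<in> core \<longleftrightarrow> s \<le> height p i" if "s \<le> l i" for s
    using m that pred_core[OF e i, of s "height p i"] by (metis (mono_tags, lifting) mem_Collect_eq nat_less_le)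
qed

text \<open>Thus \<open>core\<close> is a truncated spider with respect to every copy at once,
  although centre and heights may depend on the copy.\<close>

lemma core_feet:
  assumes e: "emb d l c p" "feet d l c p \<subseteq> W" and ne: "core \<noteq> {}"
  shows "core = feet d (height p) c p"
proof (rule set_eqI)
  fix v
  have "v \<in> core \<longleftrightarrow> v \<in> core \<and> v \<in> feet d l c p" using e unfolding core_def by blast
  also have "\<dots> \<longleftrightarrow> v \<in> core \<and> (v = c \<or> (\<exists>i s. i < d \<and> 1 \<le> s \<and> s \<le> l i \<and> v = p i s))"
    unfolding feet_iff ..
  also have "\<dots> \<longleftrightarrow> v = c \<or> (\<exists>i s. i < d \<and> 1 \<le> s \<and> s \<le> height p i \<and> v = p i s)"
    using centre_core[OF e ne] height[OF e ne] by (metis order_trans)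
  also have "\<dots> \<longleftrightarrow> v \<in> feet d (height p) c p" unfolding feet_iff ..
  finally show "v \<in> core \<longleftrightarrow> v \<in> feet d (height p) c p" .
qed

lemma core_nb_ends:
  assumes e: "emb d l c p" "feet d l c p \<subseteq> W" and ne: "core \<noteq> {}" and d: "0 < d"
    and w: "w \<in> W - feet d l c p"
  shows "nb core w \<subseteq> (\<lambda>i. p i (height p i)) ` {..<d}"
proof
  fix x assume x: "x \<in> nb core w"
  then have xc: "x \<in> core" "adj w x" unfolding nb_def by auto
  have "x \<in> feet d (height p) c p" using xc core_feet[OF e ne] by simp
  then consider "x = c" | i s where "i < d" "1 \<le> s" "s \<le> height p i" "x = p i s" unfolding feet_iff by blast
  then obtain i s where im: "i < d" "s \<le> height p i" "x = p i s"
    using embD(3)[OF e(1) d] d by (metis le0)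
  have "s = height p i"
  proof (rule ccontr)
    assume "s \<noteq> height p i"
    then have "s < height p i" using im by simp
    then show False using no_nb[OF e im(1) _ height(1,2)[OF e ne im(1)] w, of s] xc im by simp
  qed
  then show "x \<in> (\<lambda>i. p i (height p i)) ` {..<d}" using im by blast
qed

text \<open>Compares the two class sizes of the truncated spider. Consequently the number of odd
  heights depends only on \<open>core\<close> and the colour of the centre, not on the copy.\<close>

lemma card_core:
  assumes e: "emb d l c p" "feet d l c p \<subseteq> W" and ne: "core \<noteq> {}"
  shows "card {x \<in> core. col x \<noteq> col c} + 1 = card {x \<in> core. col x = col c} + card {i \<in> {..<d}. odd (height p i)}"
proof -
  have "emb d (height p) c p" using emb_mono[OF e(1)] height(1)[OF e ne] by blast
  from emb_card_other[OF this] emb_card_same[OF this] show ?thesis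
    unfolding core_feet[OF e ne, symmetric] sum_half_odd by simp
qed

lemma outside_copy:
  assumes "w \<in> W - core"
  obtains c p where "emb d l c p" "feet d l c p \<subseteq> W" "w \<in> W - feet d l c p"
  using assms unfolding core_def by blast

lemma core_nb_le:
  assumes ne: "core \<noteq> {}" and d: "0 < d" and w: "w \<in> W - core"
  shows "card (nb core w) \<le> d"
proof -
  obtain c p where e: "emb d l c p" "feet d l c p \<subseteq> W" "w \<in> W - feet d l c p" using outside_copy[OF w] .
  have "card (nb core w) \<le> card ((\<lambda>i. p i (height p i)) ` {..<d})"
    by (rule card_mono[OF _ core_nb_ends[OF e(1,2) ne d e(3)]]) simp
  also have "\<dots> \<le> d" using card_image_le[of "{..<d}"] by fastforce
  finally show ?thesis .
qed

text \<open>For a copy that misses \<open>w\<close>, the neighbours of \<open>w\<close> in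
  \<open>core\<close> are tips of the colour of \<open>c0\<close>. If its centre has that colour
  too, these are tips of even height, and by \<open>card_core\<close> it has as many odd heights as
  \<open>p0\<close>. If not, they are tips of odd height, and \<open>card_core\<close> makes the two
  numbers of odd heights add up to 2, which is at most \<open>d\<close>.\<close>

lemma core_nb_odd_le:
  assumes e0: "emb d l c0 p0" "feet d l c0 p0 \<subseteq> W" and ne: "core \<noteq> {}" and d: "2 \<le> d"
    and w: "w \<in> W - core" "col w \<noteq> col c0"
  shows "card (nb core w) + card {i \<in> {..<d}. odd (height p0 i)} \<le> d"
proof -
  obtain c p where e: "emb d l c p" "feet d l c p \<subseteq> W" "w \<in> W - feet d l c p" using outside_copy[OF w(1)] .
  let ?O = "{i \<in> {..<d}. odd (height p i)}" and ?E = "{i \<in> {..<d}. even (height p i)}"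
  have d0: "0 < d" using d by simp
  note ends = core_nb_ends[OF e(1,2) ne d0 e(3)]
  have cc: "col (p i (height p i)) = (if even (height p i) then col c else \<not> col c)" if "i < d" for i
    using emb_col[OF e(1) that height(1)[OF e(1,2) ne that]] .
  have dd: "card ?E + card ?O = d"
  proof -
    have "?E \<union> ?O = {..<d}" "?E \<inter> ?O = {}" by auto
    then show ?thesis using card_Un_disjoint[of ?E ?O] by simp
  qed
  have nbc: "col x = col c0" if "x \<in> nb core w" for x
    using that adj_col[of w x] w(2) unfolding nb_def by auto
  show ?thesis
  proof (cases "col c = col c0")
    case True
    have "nb core w \<subseteq> (\<lambda>i. p i (height p i)) ` ?E"
    proof
      fix x assume x: "x \<in> nb core w"
      then obtain i where i: "i < d" "x = p i (height p i)" using ends by blast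
      then show "x \<in> (\<lambda>i. p i (height p i)) ` ?E" using nbc[OF x] cc[OF i(1)] True by (auto split: if_splits)
    qed
    then have "card (nb core w) \<le> card ((\<lambda>i. p i (height p i)) ` ?E)" by (intro card_mono) auto
    also have "\<dots> \<le> card ?E" by (rule card_image_le) simp
    finally have "card (nb core w) \<le> card ?E" .
    moreover have "card ?O = card {i \<in> {..<d}. odd (height p0 i)}"
      using card_core[OF e(1,2) ne] card_core[OF e0 ne] True by simp
    ultimately show ?thesis using dd by simp
  next
    case False
    have "nb core w \<subseteq> (\<lambda>i. p i (height p i)) ` ?O"
    proof
      fix x assume x: "x \<in> nb core w"
      then obtain i where i: "i < d" "x = p i (height p i)" using ends by blast
      then show "x \<in> (\<lambda>i. p i (height p i)) ` ?O" using nbc[OF x] cc[OF i(1)] False by (auto split: if_splits)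
    qed
    then have "card (nb core w) \<le> card ((\<lambda>i. p i (height p i)) ` ?O)" by (intro card_mono) auto
    also have "\<dots> \<le> card ?O" by (rule card_image_le) simp
    finally have "card (nb core w) \<le> card ?O" .
    moreover have "card {x \<in> core. col x \<noteq> col c} = card {x \<in> core. col x = col c0}"
      "card {x \<in> core. col x = col c} = card {x \<in> core. col x \<noteq> col c0}"
      using False by (auto intro!: arg_cong[where f = card])
    ultimately show ?thesis using card_core[OF e(1,2) ne] card_core[OF e0 ne] d by linarith
  qed
qed

text \<open>
  A copy centred outside \<open>core\<close> would contradict \<open>centre_core\<close>. It is built from a copy of the
  spider with legs of the even lengths \<open>2 * ((l i - 1) div 2)\<close>, which avoids \<open>core\<close>, and whose
  legs are completed by at most two more vertices.
\<close>

lemma core_empty: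
  assumes e: "emb d l c p" "feet d l c p \<subset> W"
  shows "core = {}"
proof (rule ccontr)
  assume ne: "core \<noteq> {}"
  have eW: "feet d l c p \<subseteq> W" using e(2) by blast
  note eD = embD[OF e(1)]
  have noc: "\<not> (emb d l c' p' \<and> feet d l c' p' \<subseteq> W \<and> c' \<notin> core)" for c' p'
    using centre_core[OF _ _ ne] by blast
  obtain w0 where w0: "w0 \<in> W" "w0 \<notin> feet d l c p" using e(2) by blast
  have d: "0 < d"
  proof (rule ccontr)
    assume "\<not> 0 < d"
    then have d0: "d = 0" by simp
    have "emb d l w0 (\<lambda>i s. w0)" "feet d l w0 (\<lambda>i s. w0) = {w0}"
      using emb_trivial[of w0 d l] feet_trivial[of d l w0] w0 W d0 by auto
    then have "w0 \<in> core" using noc[of w0 "\<lambda>i s. w0"] w0 by auto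
    then show False using w0 e eW unfolding core_def by blast
  qed
  define q where "q i = (l i - 1) div 2" for i
  have lq: "l i = 2 * q i + 1 \<or> l i = 2 * q i + 2" if "i < d" for i
    using lpos[OF that] unfolding q_def by presburger
  have odd_l: "odd (l i) \<longleftrightarrow> l i = 2 * q i + 1" if "i < d" for i using lq[OF that] by auto
  have hl: "(l i + 1) div 2 = q i + 1" if "i < d" for i using lq[OF that] by auto
  \<comment> \<open>Since \<open>t\<close> exceeds the sum of the \<open>q i\<close> by at least
    \<open>d\<close>, every vertex outside \<open>core\<close> can give up \<open>d\<close>
    neighbours and still satisfy the greedy bound for the shortened spider.\<close>
  have qt: "(\<Sum>i<d. q i) + d \<le> t"
  proof -
    have "(\<Sum>i<d. (l i + 1) div 2) = (\<Sum>i<d. q i + 1)" by (rule sum.cong) (use hl in auto)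
    also have "\<dots> = (\<Sum>i<d. q i) + d" unfolding sum.distrib by simp
    finally show ?thesis using t1 by simp
  qed
  let ?h = "height p"
  have h: "?h i \<le> l i" "p i (?h i) \<in> core" "\<And>s. s \<le> l i \<Longrightarrow> p i s \<in> core \<longleftrightarrow> s \<le> ?h i" if "i < d" for i
    using height[OF e(1) eW ne that] by auto
  have cp: "col (p i s) = (if even s then col c else \<not> col c)" if "i < d" "s \<le> l i" for i s
    using emb_col[OF e(1) that] .
  define C where "C = W - core"
  let ?I = "{i \<in> {..<d}. odd (?h i)}"
  \<comment> \<open>The successors of the tips of odd height. They are kept out of \<open>A\<close>
    in reserve, so that a new leg that steps onto such a tip can continue there.\<close>
  define Fb where "Fb = (\<lambda>i. p i (Suc (?h i))) ` {i \<in> ?I. ?h i < l i}"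
  define A where "A = C - Fb"
  have FbT: "Fb \<subseteq> feet d l c p" unfolding Fb_def using eD(8) by auto
  have Fbcol: "col x = col c" if "x \<in> Fb" for x
    using that cp unfolding Fb_def by auto
  have cFb: "card Fb \<le> card ?I"
  proof -
    have "card Fb \<le> card {i \<in> ?I. ?h i < l i}" unfolding Fb_def by (rule card_image_le) simp
    also have "\<dots> \<le> card ?I" by (rule card_mono) auto
    finally show ?thesis .
  qed
  have AW: "A \<subseteq> W" "A \<subseteq> C" "A \<subseteq> V" unfolding A_def C_def using W by auto
  have finA: "finite A" and finc: "finite core" and finF: "finite Fb"
    using finW AW finite_subset[of core W] finite_subset[of A W] unfolding core_def Fb_def by auto
  \<comment> \<open>An outside vertex of the wrong colour has \<open>t + 1\<close> neighbours in
    \<open>W\<close>, of which the copy holds at most \<open>t\<close>, so it has an outside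
    neighbour of the right colour.\<close>
  obtain r where r: "r \<in> A" "col r = col c" "r \<notin> core"
  proof -
    have w0c: "w0 \<in> W - feet d l c p" using w0 by simp
    have dd: "Suc t \<le> card (nb W w0)" using rich[OF e(1) eW w0c] .
    have "\<exists>r \<in> W - feet d l c p. col r = col c"
    proof (cases "col w0 = col c")
      case False
      have "\<not> nb W w0 \<subseteq> nb (feet d l c p) w0"
      proof
        assume "nb W w0 \<subseteq> nb (feet d l c p) w0"
        then have "card (nb W w0) \<le> card (nb (feet d l c p) w0)"
          by (rule card_mono[OF finite_nb[OF finite_feet]])
        then show False using emb_nb_le[OF e(1), of w0] dd by simp
      qed
      then obtain y where "y \<in> W" "adj w0 y" "y \<notin> feet d l c p" unfolding nb_def by blast
      then show ?thesis using adj_col[of w0 y] False by blast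
    qed (use w0 in blast)
    then obtain r where r: "r \<in> W" "r \<notin> feet d l c p" "col r = col c" by blast
    have "r \<notin> core" using r e eW unfolding core_def by blast
    then show thesis using that[of r] r FbT unfolding A_def C_def by blast
  qed
  \<comment> \<open>Vertices of \<open>Fb\<close> have the same colour as \<open>w\<close>, so only
    the at most \<open>d\<close> neighbours in \<open>core\<close> are lost.\<close>
  have H: "(\<Sum>i<d. (2 * q i + 1) div 2) \<le> card (nb A w)" if w: "w \<in> A" "col w = col r" for w
  proof -
    have wc: "w \<in> W - core" using w AW unfolding C_def by blast
    have "nb W w \<subseteq> nb A w \<union> nb core w"
      using adj_col[of w] Fbcol w r(2) unfolding A_def C_def nb_def by auto
    then have "card (nb W w) \<le> card (nb A w \<union> nb core w)"
      using finA finc by (intro card_mono) (auto simp: finite_nb)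
    also have "\<dots> \<le> card (nb A w) + card (nb core w)" by (rule card_Un_le)
    finally show ?thesis using core_nb_le[OF ne d wc] rich_core[OF wc] qt by simp
  qed
  \<comment> \<open>Here \<open>Fb\<close> costs up to the number of odd heights;
    \<open>core_nb_odd_le\<close> bounds this together with the neighbours in \<open>core\<close> by
    \<open>d\<close>. The condition \<open>pos\<close> yields a leg of length above 1, hence
    \<open>2 \<le> d\<close>.\<close>
  have H2: "Suc (\<Sum>i<d. 2 * q i div 2) \<le> card (nb A w)"
    if w: "w \<in> A" "col w \<noteq> col r" and pos: "0 < (\<Sum>i<d. 2 * q i)" for w
  proof -
    have wc: "w \<in> W - core" "col w \<noteq> col c" using w AW r(2) unfolding C_def by auto
    have "\<exists>i<d. 2 * q i \<noteq> 0" using pos by (metis lessThan_iff not_gr_zero sum.neutral)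
    then obtain i where "i < d" "q i \<noteq> 0" by auto
    then have "\<not> l i \<le> 1" using lq[of i] by linarith
    then have d2: "2 \<le> d" using dl \<open>i < d\<close> by blast
    have "nb W w \<subseteq> nb A w \<union> (nb core w \<union> Fb)"
      unfolding A_def C_def nb_def by auto
    then have "card (nb W w) \<le> card (nb A w \<union> (nb core w \<union> Fb))"
      using finA finc finF by (intro card_mono) (auto simp: finite_nb)
    also have "\<dots> \<le> card (nb A w) + card (nb core w \<union> Fb)" by (rule card_Un_le)
    also have "\<dots> \<le> card (nb A w) + (card (nb core w) + card Fb)" by (simp add: card_Un_le)
    finally show ?thesis
      using core_nb_odd_le[OF e(1) eW ne d2 wc] rich_core[OF wc(1)] qt cFb by simp
  qed
  have "\<exists>p. emb d (\<lambda>i. 2 * q i) r p \<and> feet d (\<lambda>i. 2 * q i) r p \<subseteq> A"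
    by (rule emb_greedy[OF AW(3) r(1)]) (use H H2 in simp_all)
  then obtain p0 where p0: "emb d (\<lambda>i. 2 * q i) r p0" "feet d (\<lambda>i. 2 * q i) r p0 \<subseteq> A" by blast
  \<comment> \<open>Vertices of the colour opposite to \<open>c\<close> that have no successor on
    their leg. New legs must not step onto them.\<close>
  define Bd where "Bd = (\<lambda>i. p i (l i)) ` {i \<in> {..<d}. odd (l i)}"
  have cBd: "card Bd \<le> card {i \<in> {..<d}. odd (l i)}" unfolding Bd_def by (rule card_image_le) simp
  text \<open>\<open>nxt y x\<close>: a step along a leg of the given copy, from a vertex of \<open>core\<close> to one outside \<open>A\<close>.\<close>
  define nxt where "nxt y x \<longleftrightarrow> (\<exists>i s. i < d \<and> odd s \<and> s < l i \<and> y = p i s \<and> x = p i (Suc s))" for y x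
  have nxtD: "adj y x \<and> x \<in> W \<and> col x = col c \<and> x \<notin> A" if yx: "nxt y x" "y \<in> core" for y x
  proof -
    obtain i s where im: "i < d" "odd s" "s < l i" "y = p i s" "x = p i (Suc s)" using yx(1) unfolding nxt_def by blast
    have "x \<notin> A"
    proof (cases "Suc s \<le> ?h i")
      case True
      then have "x \<in> core" using h(3)[of i "Suc s"] im by simp
      then show ?thesis unfolding A_def C_def by blast
    next
      case False
      have "s \<le> ?h i" using h(3)[of i s] im yx(2) by simp
      then have "s = ?h i" using False by simp
      then have "x \<in> Fb" unfolding Fb_def using im by auto
      then show ?thesis unfolding A_def by blast
    qed
    then show ?thesis using eD(4)[of i s] eD(8)[of i "Suc s"] eW cp[of i "Suc s"] im by auto
  qed
  have nxt_inj: "y = y'" if "nxt y x" "nxt y' x" for y y' x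
    using that eD(6) unfolding nxt_def by (metis Suc_inject Suc_leI le_add1 plus_1_eq_Suc)
  have nxt_ex: "\<exists>x. nxt y x" if y: "y \<in> core" "y \<notin> Bd" "col y \<noteq> col c" for y
  proof -
    have "y \<in> feet d l c p" using y e eW unfolding core_def by blast
    then obtain i s where im: "i < d" "1 \<le> s" "s \<le> l i" "y = p i s" using y(3) unfolding feet_iff by blast
    then have os: "odd s" using cp[of i s] y(3) by auto
    then have "s \<noteq> l i" using y(2) im unfolding Bd_def by auto
    then show ?thesis using im os unfolding nxt_def by (intro exI[of _ "p i (Suc s)"] exI[of _ i] exI[of _ s]) auto
  qed
  let ?Ev = "{i \<in> {..<d}. even (l i)}"
  have evod: "card ?Ev + card {i \<in> {..<d}. odd (l i)} = d"
  proof -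
    have "?Ev \<union> {i \<in> {..<d}. odd (l i)} = {..<d}" "?Ev \<inter> {i \<in> {..<d}. odd (l i)} = {}" by auto
    then show ?thesis using card_Un_disjoint[of ?Ev "{i \<in> {..<d}. odd (l i)}"] by simp
  qed
  \<comment> \<open>State after treating the legs in \<open>D\<close>, all of even length: each is
    complete or lacks one vertex after a tip outside \<open>core\<close>. By the last clause, a
    vertex of the centre's colour outside \<open>A\<close> is in use only together with its
    predecessor in \<open>core\<close>; this keeps reserved successors free.\<close>
  define st where "st D a p' \<longleftrightarrow> emb d a r p' \<and> feet d a r p' \<subseteq> W \<and>
    (\<forall>i\<in>D. a i = l i \<or> Suc (a i) = l i \<and> p' i (a i) \<in> C) \<and>
    (\<forall>i<d. i \<notin> D \<longrightarrow> a i = 2 * q i \<and> p' i (a i) \<in> C) \<and>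
    (\<forall>x \<in> feet d a r p'. col x = col c \<longrightarrow> x \<in> A \<or> (\<exists>y \<in> feet d a r p' \<inter> core. nxt y x))" for D a p'
  have "\<exists>a p'. st D a p'" if D: "D \<subseteq> ?Ev" for D
  proof -
    have "finite D" using D finite_subset by fastforce
    then show ?thesis using D
    proof (induction D rule: finite_induct)
      case empty
      have "p0 i (2 * q i) \<in> C" if "i < d" for i
        using embD(8)[OF p0(1) that, of "2 * q i"] p0(2) AW by blast
      then have "st {} (\<lambda>i. 2 * q i) p0" unfolding st_def using p0 AW by blast
      then show ?case by blast
    next
      case (insert i D)
      then obtain a p' where s: "st D a p'" by blast
      have i: "i < d" "even (l i)" "i \<notin> D" using insert by auto
      have s': "emb d a r p'" "feet d a r p' \<subseteq> W" "\<And>j. j \<in> D \<Longrightarrow> a j = l j \<or> Suc (a j) = l j \<and> p' j (a j) \<in> C"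
        "\<And>j. j < d \<Longrightarrow> j \<notin> D \<Longrightarrow> a j = 2 * q j \<and> p' j (a j) \<in> C"
        "\<And>x. x \<in> feet d a r p' \<Longrightarrow> col x = col c \<Longrightarrow> x \<in> A \<or> (\<exists>y \<in> feet d a r p' \<inter> core. nxt y x)"
        using s unfolding st_def by auto
      let ?T = "feet d a r p'"
      let ?w = "p' i (a i)"
      have ai: "a i = 2 * q i" and wC: "?w \<in> C" using s'(4)[OF i(1,3)] by auto
      have li: "l i = Suc (Suc (a i))" using lq[OF i(1)] i(2) ai by auto
      have cw: "col ?w = col r" using emb_col[OF s'(1) i(1), of "a i"] ai by simp
      have Dd: "D \<subseteq> ?Ev - {i}" using insert by auto
      have "card (nb ?T ?w) \<le> (\<Sum>j<d. (a j + 1) div 2)" by (rule emb_nb_same[OF s'(1) cw])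
      also have "\<dots> \<le> (\<Sum>j<d. q j + (if j \<in> D then 1 else 0))"
      proof (rule sum_mono)
        fix j assume j: "j \<in> {..<d}"
        show "(a j + 1) div 2 \<le> q j + (if j \<in> D then 1 else 0)"
        proof (cases "j \<in> D")
          case True
          then have "a j \<le> l j" using s'(3)[OF True] by auto
          then show ?thesis using True lq[of j] j by auto
        next
          case False then show ?thesis using s'(4)[of j] j by simp
        qed
      qed
      also have "\<dots> = (\<Sum>j<d. q j) + card D"
      proof -
        have "{..<d} \<inter> {j. j \<in> D} = D" using Dd by auto
        then show ?thesis by (simp add: sum.distrib sum.If_cases)
      qed
      finally have 1: "card (nb ?T ?w) \<le> (\<Sum>j<d. q j) + card D" .
      have "card D \<le> card (?Ev - {i})" by (rule card_mono[OF _ Dd]) simp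
      also have "\<dots> < card ?Ev" using i by (intro psubset_card_mono) auto
      finally have 2: "card D < card ?Ev" .
      \<comment> \<open>The tip sees at most the sum of the \<open>q j\<close> plus
        \<open>card D\<close> vertices of the partial copy. With \<open>card D\<close> below the
        number of even legs and \<open>Bd\<close> at most the number of odd legs, the forbidden
        vertices are fewer than that sum plus \<open>d\<close>, hence fewer than
        \<open>t\<close>.\<close>
      have "card (nb ?T ?w \<union> Bd) \<le> card (nb ?T ?w) + card Bd" by (rule card_Un_le)
      also have "\<dots> < Suc t" using 1 2 cBd evod qt by linarith
      also have "\<dots> \<le> card (nb W ?w)" using rich_core wC unfolding C_def by blast
      finally have "card (nb ?T ?w \<union> Bd) < card (nb W ?w)" .
      moreover have "finite (nb ?T ?w \<union> Bd)" unfolding Bd_def by (simp add: finite_nb finite_feet)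
      ultimately obtain y where "y \<in> nb W ?w" "y \<notin> nb ?T ?w \<union> Bd"
        using card_mono[of "nb ?T ?w \<union> Bd" "nb W ?w"] by (meson not_less subsetI)
      then have y: "y \<in> W" "y \<notin> ?T" "y \<notin> Bd" "adj ?w y" unfolding nb_def by auto
      have cy: "col y \<noteq> col c" using adj_col[OF y(4)] cw r(2) by simp
      have yV: "y \<in> V" using y W by blast
      let ?a = "a(i := Suc (a i))" and ?p = "p'(i := (p' i)(Suc (a i) := y))"
      note ex = emb_extend[OF s'(1) i(1) yV y(2,4)]
      have fW: "feet d ?a r ?p \<subseteq> W" unfolding ex(2) using s'(2) y(1) by simp
      have fA: "x \<in> A \<or> (\<exists>y \<in> feet d ?a r ?p \<inter> core. nxt y x)" if "x \<in> feet d ?a r ?p" "col x = col c" for x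
        using that s'(5)[of x] cy unfolding ex(2) by auto
      show ?case
      proof (cases "y \<in> core")
        case False
        \<comment> \<open>The new tip lies outside \<open>core\<close> and so has
          \<open>t + 1\<close> neighbours in \<open>W\<close>; its one missing vertex is left to
          \<open>emb_finish\<close>.\<close>
        have "st (insert i D) ?a ?p"
          unfolding st_def
        proof (intro conjI ballI allI impI)
          fix j assume "j \<in> insert i D"
          then show "?a j = l j \<or> Suc (?a j) = l j \<and> ?p j (?a j) \<in> C"
            using s'(3)[of j] li y(1) False unfolding C_def by (cases "j = i") auto
        next
          fix j assume "j < d" "j \<notin> insert i D"
          then show "?a j = 2 * q j" "?p j (?a j) \<in> C" using s'(4)[of j] by auto
        qed (use ex(1) fW fA in auto)
        then show ?thesis by blast
      next
        case True
        obtain x where x: "nxt y x" using nxt_ex[OF True y(3) cy] by blast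
        have xD: "adj y x" "x \<in> W" "col x = col c" "x \<notin> A" using nxtD[OF x True] by auto
        have xV: "x \<in> V" using xD W by blast
        \<comment> \<open>The successor \<open>x\<close> is still free: it is outside
          \<open>A\<close>, so it could only be in use along with its predecessor, which is
          \<open>y\<close> by injectivity, but \<open>y\<close> is new.\<close>
        have xn: "x \<notin> feet d ?a r ?p"
        proof
          assume "x \<in> feet d ?a r ?p"
          then have "x \<in> ?T" using xD(3) cy unfolding ex(2) by auto
          then obtain y' where "y' \<in> ?T" "nxt y' x" using s'(5)[of x] xD by blast
          then show False using nxt_inj[OF x] y(2) by blast
        qed
        have "adj (?p i (?a i)) x" using xD by simp
        note ex2 = emb_extend[OF ex(1) i(1) xV xn this]
        let ?b = "?a(i := Suc (?a i))" and ?r = "?p(i := (?p i)(Suc (?a i) := x))"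
        have "st (insert i D) ?b ?r"
          unfolding st_def
        proof (intro conjI ballI allI impI)
          show "feet d ?b r ?r \<subseteq> W" unfolding ex2(2) using fW xD(2) by simp
        next
          fix j assume "j \<in> insert i D"
          then show "?b j = l j \<or> Suc (?b j) = l j \<and> ?r j (?b j) \<in> C"
            using s'(3)[of j] li by (cases "j = i") auto
        next
          fix j assume "j < d" "j \<notin> insert i D"
          then show "?b j = 2 * q j" "?r j (?b j) \<in> C" using s'(4)[of j] by auto
        next
          fix z assume z: "z \<in> feet d ?b r ?r" "col z = col c"
          show "z \<in> A \<or> (\<exists>y \<in> feet d ?b r ?r \<inter> core. nxt y z)"
          proof (cases "z = x")
            case zx: True
            have "y \<in> feet d ?b r ?r" unfolding ex2(2) ex(2) by simp
            then show ?thesis using x True zx by blast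
          next
            case False
            then have "z \<in> feet d ?a r ?p" using z(1) unfolding ex2(2) by simp
            then show ?thesis using fA[OF _ z(2)] unfolding ex2(2) by blast
          qed
        qed (rule ex2(1))
        then show ?thesis by blast
      qed
    qed
  qed
  then obtain a p' where s: "st ?Ev a p'" by blast
  have "\<exists>p. emb d l r p \<and> feet d l r p \<subseteq> W"
  proof (rule emb_finish[OF W _ _ _ t1 t2])
    show "emb d a r p'" "feet d a r p' \<subseteq> W" using s unfolding st_def by auto
    show "a i = l i \<or> Suc (a i) = l i \<and> Suc t \<le> card (nb W (p' i (a i)))" if i: "i < d" for i
    proof (cases "even (l i)")
      case True
      then have "a i = l i \<or> Suc (a i) = l i \<and> p' i (a i) \<in> C" using s i unfolding st_def by auto
      then show ?thesis using rich_core unfolding C_def by blast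
    next
      case False
      then have "a i = 2 * q i" "p' i (a i) \<in> C" using s i unfolding st_def by auto
      then show ?thesis using rich_core odd_l[OF i] False unfolding C_def by auto
    qed
  qed
  then show False using noc r(3) by blast
qed

end

section \<open>Existence\<close>

context bip_graph begin

text \<open>The end \<open>v 0\<close> may have several neighbours in \<open>F\<close>. Putting one
  of them, \<open>f\<close>, in front of the path and counting \<open>v n\<close> among the base set
  reduces the claim to \<open>path_fragment\<close> with indices shifted by one.\<close>

lemma tail_fragment:
  assumes U: "U = F \<union> v ` {0..n}" and fF: "finite F"
    and vF: "\<And>i. i \<le> n \<Longrightarrow> v i \<notin> F" and inj: "inj_on v {0..n}"
    and step: "\<And>i. i < n \<Longrightarrow> adj (v i) (v (Suc i))"
    and ind: "\<And>i j. i \<le> n \<Longrightarrow> j \<le> n \<Longrightarrow> adj (v i) (v j) \<Longrightarrow> j = Suc i \<or> i = Suc j"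
    and only: "\<And>i f. i \<le> n \<Longrightarrow> f \<in> F \<Longrightarrow> adj (v i) f \<Longrightarrow> i = 0 \<or> i = n"
    and ex: "f \<in> F" "adj (v 0) f"
    and Z: "Z \<subseteq> v ` {0..n}" "v 0 \<in> Z" "v n \<notin> Z" and c: "card (bd U Z) \<le> 2"
  shows "2 \<le> card (bd U Z)" "Z \<inter> big U = {}" "x \<in> U - Z \<Longrightarrow> card (nb Z x) \<le> 1"
proof -
  have fU: "finite U" using U fF by simp
  have n: "0 < n" using Z by (cases n) auto
  have "\<exists>j<n. v j \<in> Z \<and> v (Suc j) \<notin> Z"
  proof (rule ccontr)
    assume no: "\<not> ?thesis"
    have "k \<le> n \<Longrightarrow> v k \<in> Z" for k
      by (induction k) (use Z no in auto)
    then show False using Z by blast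
  qed
  then obtain j where j: "j < n" "v j \<in> Z" "v (Suc j) \<notin> Z" by blast
  have jb: "v (Suc j) \<in> bd U Z" using j step[of j] U unfolding bd_def by auto
  have fb: "f' \<in> bd U Z" if "f' \<in> F" "adj (v 0) f'" for f'
    using that Z vF U unfolding bd_def by auto
  define w where "w k = (if k = 0 then f else v (k - 1))" for k
  have w: "w 0 = f" "\<And>k. w (Suc k) = v k" "\<And>k. 1 \<le> k \<Longrightarrow> w k = v (k - 1)" unfolding w_def by auto
  have wim: "w ` {1..n} = v ` {0..<n}"
  proof -
    have "{1..n} = Suc ` {0..<n}" by (auto simp: image_iff Bex_def gr0_conv_Suc Suc_le_eq)
    then show ?thesis by (simp only: image_image w(2))
  qed
  have vn: "v ` {0..n} = insert (v n) (v ` {0..<n})"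
    by (metis atLeast0_lessThan_Suc atLeastLessThanSuc_atLeastAtMost image_insert)
  have U2: "U = insert (v n) F \<union> w ` {1..n}" using U wim vn by auto
  have Z2: "Z \<subseteq> w ` {1..n}" using Z(1,3) wim vn by auto
  have A: "finite (insert (v n) F)" "\<And>i. 1 \<le> i \<Longrightarrow> i \<le> n \<Longrightarrow> w i \<notin> insert (v n) F"
    "w 0 \<in> insert (v n) F" "w (Suc n) \<in> insert (v n) F"
    "\<And>i. i \<le> n \<Longrightarrow> adj (w i) (w (Suc i))" "inj_on w {0..Suc n}"
    "\<And>i j. 1 \<le> i \<Longrightarrow> i \<le> n \<Longrightarrow> j \<le> Suc n \<Longrightarrow> adj (w i) (w j) \<Longrightarrow> j = Suc i \<or> i = Suc j"
  proof -
    show "finite (insert (v n) F)" using fF by simp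
    show "w i \<notin> insert (v n) F" if i: "1 \<le> i" "i \<le> n" for i
    proof -
      have "i - 1 \<noteq> n" "i - 1 \<in> {0..n}" using i by auto
      then have "v (i - 1) \<noteq> v n" using inj_onD[OF inj, of "i - 1" n] by auto
      then show ?thesis using vF[of "i - 1"] i w(3) by simp
    qed
    show "w 0 \<in> insert (v n) F" "w (Suc n) \<in> insert (v n) F" using ex w by auto
    show "adj (w i) (w (Suc i))" if "i \<le> n" for i
    proof (cases i)
      case 0 then show ?thesis using ex adj_sym w by simp
    next
      case (Suc k) then show ?thesis using step[of k] w(2) that by simp
    qed
    show "inj_on w {0..Suc n}"
    proof (rule inj_onI)
      fix a b assume ab: "a \<in> {0..Suc n}" "b \<in> {0..Suc n}" "w a = w b"
      show "a = b"
      proof (cases a; cases b)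
        fix a' b' assume "a = Suc a'" "b = Suc b'"
        then show ?thesis using ab w(2) inj_onD[OF inj, of a' b'] by simp
      next
        fix b' assume "a = 0" "b = Suc b'"
        then show ?thesis using ab w vF[of b'] ex by auto
      next
        fix a' assume "a = Suc a'" "b = 0"
        then show ?thesis using ab w vF[of a'] ex by auto
      qed simp
    qed
    show "j = Suc i \<or> i = Suc j" if ij: "1 \<le> i" "i \<le> n" "j \<le> Suc n" "adj (w i) (w j)" for i j
    proof -
      obtain k where k: "i = Suc k" using ij by (cases i) auto
      show ?thesis
      proof (cases j)
        case 0
        then have "adj (v k) f" using ij k w by simp
        then have "k = 0" using only[of k f] ex ij k by auto
        then show ?thesis using 0 k by simp
      next
        case (Suc m)
        then show ?thesis using ind[of k m] ij k w(2) by simp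
      qed
    qed
  qed
  have Zn: "Z \<noteq> {}" using Z by blast
  show "2 \<le> card (bd U Z)" by (rule path_fragment(1)[of U "insert (v n) F" w n, OF U2 A Z2 Zn])
  show "Z \<inter> big U = {}" by (rule path_fragment(2)[of U "insert (v n) F" w n, OF U2 A Z2 Zn c])
  show "card (nb Z x) \<le> 1" if "x \<in> U - Z"
    by (rule path_fragment(3)[of U "insert (v n) F" w n, OF U2 A Z2 Zn c that])
qed

text \<open>In a minimal fragment \<open>F\<close> every proper nonempty subset has boundary at
  least 3. A shortest path between its two attachment vertices \<open>x\<close> and \<open>y\<close>
  can stand in for all the rest of \<open>H\<close>: a separation of \<open>U\<close> by two
  vertices cannot split \<open>F\<close>, so one of its sides lies on the path.\<close>

lemma initial_good:
  assumes H: "H \<subseteq> V" and deg: "\<And>h. h \<in> H \<Longrightarrow> 3 \<le> card (nb H h)"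
    and two: "\<And>F. F \<subseteq> H \<Longrightarrow> F \<noteq> {} \<Longrightarrow> card (bd H F) \<le> 1 \<Longrightarrow> F \<union> bd H F = H"
    and n3: "\<not> conn3 H"
  shows "\<exists>U. good U \<and> U \<subseteq> H"
proof -
  have fH: "finite H" using fin[OF H] .
  define P where "P F \<longleftrightarrow> F \<subseteq> H \<and> F \<noteq> {} \<and> card (bd H F) \<le> 2 \<and> F \<union> bd H F \<noteq> H" for F
  obtain F0 where "P F0" using n3 unfolding conn3_def P_def by blast
  then obtain F where F: "P F" and mn: "\<And>F'. P F' \<Longrightarrow> card F \<le> card F'"
    using ex_has_least_nat[of P F0 card] by blast
  have FH: "F \<subseteq> H" "F \<noteq> {}" "card (bd H F) \<le> 2" "F \<union> bd H F \<noteq> H" using F unfolding P_def by auto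
  have fF: "finite F" using FH fH finite_subset by blast
  have bdF: "bd H A \<subseteq> F \<union> bd H F" if "A \<subseteq> F" for A using that unfolding bd_def by blast
  have M: "3 \<le> card (bd H A)" if A: "A \<subset> F" "A \<noteq> {}" for A
  proof (rule ccontr)
    assume c: "\<not> 3 \<le> card (bd H A)"
    have "A \<union> bd H A \<noteq> H" using bdF[of A] A FH bd_def by blast
    then have "P A" unfolding P_def using A FH c by auto
    then show False using mn[of A] psubset_card_mono[OF fF A(1)] by simp
  qed
  have "\<not> card (bd H F) \<le> 1" using two[OF FH(1,2)] FH by blast
  then have "card (bd H F) = 2" using FH by simp
  then obtain x y where xy: "bd H F = {x, y}" "x \<noteq> y" by (auto simp: card_2_iff)
  have xyH: "x \<in> H - F" "y \<in> H - F" using xy unfolding bd_def by blast+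
  have xF: "\<exists>f\<in>F. adj x f" "\<exists>f\<in>F. adj y f" using xy adj_sym unfolding bd_def by blast+
  have nbF: "u \<in> F \<or> u = x \<or> u = y" if "u \<in> H" "f \<in> F" "adj f u" for u f
    using that xy unfolding bd_def by blast
  \<comment> \<open>Two adjacent vertices of \<open>F\<close> have disjoint neighbourhoods, as there
    are no triangles; each has at least three vertices, and all six lie in \<open>F\<close> together
    with \<open>x\<close> and \<open>y\<close>.\<close>
  have cF: "4 \<le> card F"
  proof -
    have deg': "\<not> nb H f \<subseteq> {x, y}" if "f \<in> F" for f
    proof
      assume "nb H f \<subseteq> {x, y}"
      then have "card (nb H f) \<le> card {x, y}" by (intro card_mono) auto
      then show False using deg[of f] that FH xy by auto
    qed
    obtain f where f: "f \<in> F" using FH by blast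
    obtain f' where "f' \<in> H" "adj f f'" "f' \<noteq> x" "f' \<noteq> y" using deg'[OF f] unfolding nb_def by blast
    then have f': "f' \<in> F" "adj f f'" using nbF f by blast+
    have dis: "nb H f \<inter> nb H f' = {}"
    proof -
      have "False" if "adj f u" "adj f' u" for u
        using adj_col[OF that(1)] adj_col[OF that(2)] adj_col[OF f'(2)] by auto
      then show ?thesis unfolding nb_def by blast
    qed
    have "6 \<le> card (nb H f) + card (nb H f')" using deg[of f] deg[of f'] f f' FH by fastforce
    also have "\<dots> = card (nb H f \<union> nb H f')" using dis fH by (simp add: card_Un_disjoint finite_nb)
    also have "\<dots> \<le> card (F \<union> {x, y})"
      using nbF f f' fF by (intro card_mono) (auto simp: nb_def)
    also have "\<dots> \<le> card F + card {x, y}" by (rule card_Un_le)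
    finally show ?thesis using xy by simp
  qed
  define X where "X = insert x (reach (H - F) {x})"
  have XH: "X \<subseteq> H - F" using reach_sub xyH unfolding X_def by blast
  have Xcl: "u \<in> X" if "a \<in> X" "adj a u" "u \<in> H - F" for a u
    using that reach_base[of x "{x}" u "H - F"] reach_step[of a "H - F" "{x}" u] unfolding X_def by blast
  \<comment> \<open>Otherwise \<open>X - {x}\<close> has no boundary except \<open>x\<close> and is
    empty by 2-connectivity; then the rest of \<open>H - F\<close> has no boundary except
    \<open>y\<close> and is empty too, so \<open>F\<close> with \<open>x\<close> and
    \<open>y\<close> would be all of \<open>H\<close>.\<close>
  have yX: "y \<in> reach (H - F) {x}"
  proof (rule ccontr)
    assume "y \<notin> reach (H - F) {x}"
    then have ny: "y \<notin> X" using xy unfolding X_def by blast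
    have b1: "bd H (X - {x}) \<subseteq> {x}"
    proof
      fix u assume "u \<in> bd H (X - {x})"
      then obtain a where a: "u \<in> H" "u \<notin> X - {x}" "a \<in> X" "a \<noteq> x" "adj a u" unfolding bd_def by blast
      show "u \<in> {x}"
      proof (rule ccontr)
        assume "u \<notin> {x}"
        then have "u \<notin> X" using a by blast
        then have "u \<in> F" using Xcl[OF a(3,5)] a(1) by blast
        then have "a = y" using nbF[of a u] a XH adj_sym by blast
        then show False using a ny by blast
      qed
    qed
    have X0: "X - {x} = {}"
    proof (rule ccontr)
      assume ne: "X - {x} \<noteq> {}"
      have "card (bd H (X - {x})) \<le> 1" using card_mono[OF _ b1] by simp
      then have "(X - {x}) \<union> bd H (X - {x}) = H" using two[OF _ ne] XH by blast
      then show False using b1 XH FH xyH by blast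
    qed
    have b2: "bd H (H - F - {x, y}) \<subseteq> {y}"
    proof
      fix u assume "u \<in> bd H (H - F - {x, y})"
      then obtain a where a: "u \<in> H" "u \<notin> H - F - {x, y}" "a \<in> H - F - {x, y}" "adj a u" unfolding bd_def by blast
      have "u \<notin> F" using nbF[of a u] a adj_sym by blast
      moreover have "u \<noteq> x" using Xcl[of x a] a adj_sym X0 unfolding X_def by blast
      ultimately show "u \<in> {y}" using a by blast
    qed
    have "H - F - {x, y} = {}"
    proof (rule ccontr)
      assume ne: "H - F - {x, y} \<noteq> {}"
      have "card (bd H (H - F - {x, y})) \<le> 1" using card_mono[OF _ b2] by simp
      then have "(H - F - {x, y}) \<union> bd H (H - F - {x, y}) = H" using two[OF _ ne] by blast
      then show False using b2 FH xyH by blast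
    qed
    then have "H \<subseteq> F \<union> bd H F" unfolding xy(1) by blast
    moreover have "F \<union> bd H F \<subseteq> H" using FH(1) unfolding bd_def by blast
    ultimately show False using FH(4) by blast
  qed
  define pth where "pth n v \<longleftrightarrow> v 0 = x \<and> v n = y \<and> (\<forall>i\<le>n. v i \<in> H - F) \<and> (\<forall>i<n. adj (v i) (v (Suc i)))"
    for n and v :: "nat \<Rightarrow> 'v"
  have "\<exists>n v. pth n v"
  proof -
    obtain n v where v: "v 0 = x" "v n = y" "\<And>i. 1 \<le> i \<Longrightarrow> i \<le> n \<Longrightarrow> v i \<in> H - F" "\<And>i. i < n \<Longrightarrow> adj (v i) (v (Suc i))"
      using yX unfolding reach_def by blast
    have "v i \<in> H - F" if "i \<le> n" for i using v(1) v(3)[of i] xyH that by (cases i) auto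
    then show ?thesis unfolding pth_def using v by blast
  qed
  then obtain n where n: "\<exists>v. pth n v" "\<And>m. (\<exists>v. pth m v) \<Longrightarrow> n \<le> m"
    using ex_has_least_nat[of "\<lambda>n. \<exists>v. pth n v" _ "\<lambda>n. n"] by blast
  then obtain v where "pth n v" by blast
  then have v: "v 0 = x" "v n = y" "\<And>i. i \<le> n \<Longrightarrow> v i \<in> H - F" "\<And>i. i < n \<Longrightarrow> adj (v i) (v (Suc i))"
    unfolding pth_def by auto
  have short: False if ij: "i < n" "j \<le> n" "Suc i < j" "adj (v i) (v j)" for i j
  proof -
    let ?v = "\<lambda>k. if k \<le> i then v k else v (k + (j - i - 1))"
    have "pth (n - (j - i - 1)) ?v"
      unfolding pth_def
    proof (intro conjI allI impI)
      show "?v 0 = x" using v(1) by simp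
      have "\<not> n - (j - i - 1) \<le> i" "n - (j - i - 1) + (j - i - 1) = n" using ij by linarith+
      then show "?v (n - (j - i - 1)) = y" using v(2) by simp
      show "?v k \<in> H - F" if "k \<le> n - (j - i - 1)" for k
        using v(3)[of k] v(3)[of "k + (j - i - 1)"] that ij by simp
      show "adj (?v k) (?v (Suc k))" if k: "k < n - (j - i - 1)" for k
      proof -
        consider "Suc k \<le> i" | "k = i" | "i < k" by linarith
        then show ?thesis
        proof cases
          case 1 then show ?thesis using v(4)[of k] ij by simp
        next
          case 2
          have "Suc i + (j - i - 1) = j" using ij by linarith
          then show ?thesis using 2 ij(4) by simp
        next
          case 3 then show ?thesis using v(4)[of "k + (j - i - 1)"] k by simp
        qed
      qed
    qed
    then have "n \<le> n - (j - i - 1)" using n(2) by blast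
    then show False using ij by linarith
  qed
  have inj: "inj_on v {0..n}"
  proof -
    have ne: False if ij: "i < j" "j \<le> n" "v i = v j" for i j
    proof (cases i)
      case (Suc k)
      then have "adj (v k) (v j)" using v(4)[of k] ij by simp
      then show False using short[of k j] Suc ij by simp
    next
      case 0
      have "j \<noteq> n" using ij 0 v(1,2) xy by auto
      then have "adj (v 0) (v (Suc j))" using v(4)[of j] ij 0 by simp
      then show False using short[of 0 "Suc j"] ij 0 \<open>j \<noteq> n\<close> by simp
    qed
    show ?thesis
    proof (rule inj_onI)
      fix i j assume "i \<in> {0..n}" "j \<in> {0..n}" "v i = v j"
      then show "i = j" using ne[of i j] ne[of j i] by (cases i j rule: linorder_cases) auto
    qed
  qed
  have ind: "j = Suc i \<or> i = Suc j" if ij: "i \<le> n" "j \<le> n" "adj (v i) (v j)" for i j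
  proof (rule ccontr)
    assume no: "\<not> ?thesis"
    have "i \<noteq> j" using ij adj_col by blast
    then consider "Suc i < j" | "Suc j < i" using no by linarith
    then show False using short[of i j] short[of j i] ij adj_sym by cases auto
  qed
  have n0: "0 < n" using v(1,2) xy by (cases n) auto
  let ?Q = "v ` {0..n}"
  define U where "U = F \<union> ?Q"
  have QH: "?Q \<subseteq> H - F" using v(3) by auto
  have UH: "U \<subseteq> H" unfolding U_def using QH FH by blast
  have fU: "finite U" using UH fH finite_subset by blast
  have xyQ: "x \<in> ?Q" "y \<in> ?Q" using v(1,2) by force+
  have only: "i = 0 \<or> i = n" if i: "i \<le> n" "f \<in> F" "adj (v i) f" for i f
  proof -
    have "v i = x \<or> v i = y" using nbF[of "v i" f] v(3)[OF i(1)] i adj_sym by blast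
    then show ?thesis using v(1,2) inj_onD[OF inj, of i 0] inj_onD[OF inj, of i n] i by auto
  qed
  have Fbig: "F \<subseteq> big U"
  proof
    fix f assume f: "f \<in> F"
    have "nb H f \<subseteq> nb U f" using nbF[of _ f] f xyQ unfolding nb_def U_def by blast
    then have "card (nb H f) \<le> card (nb U f)" by (rule card_mono[OF finite_nb[OF fU]])
    then show "f \<in> big U" using deg[of f] f FH unfolding big_def U_def by auto
  qed
  have K2: "2 \<le> card (bd U Z) \<and> Z \<inter> big U = {} \<and> (\<forall>u\<in>U - Z. card (nb Z u) \<le> 1)"
    if Z: "Z \<subseteq> ?Q" "Z \<noteq> {}" "card (bd U Z) \<le> 2" for Z
  proof -
    obtain f1 where f1: "f1 \<in> F" "adj (v 0) f1" using xF v(1) by blast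
    obtain f2 where f2: "f2 \<in> F" "adj (v n) f2" using xF v(2) by blast
    have vF: "v i \<notin> F" if "i \<le> n" for i using v(3)[OF that] by simp
    consider "x \<in> Z" "y \<in> Z" | "x \<in> Z" "y \<notin> Z" | "x \<notin> Z" "y \<in> Z" | "x \<notin> Z" "y \<notin> Z" by blast
    then show ?thesis
    proof cases
      case 1
      \<comment> \<open>With both ends in \<open>Z\<close> all neighbours of \<open>x\<close> and
        \<open>y\<close> in \<open>F\<close> belong to the boundary. Removing these at most two
        vertices leaves a proper nonempty subset of \<open>F\<close> with boundary at most 2,
        against minimality.\<close>
      let ?S = "bd U Z \<inter> F"
      have fb: "finite (bd U Z)" using fU finite_bd by blast
      have S: "f \<in> ?S" if "f \<in> F" "adj x f \<or> adj y f" for f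
        using that 1 Z QH unfolding bd_def U_def by blast
      have "bd H (F - ?S) \<subseteq> ?S"
      proof
        fix u assume "u \<in> bd H (F - ?S)"
        then obtain a where a: "u \<in> H" "u \<notin> F - ?S" "a \<in> F - ?S" "adj a u" unfolding bd_def by blast
        then have "u \<in> F" using nbF[of u a] S[of a] adj_sym by blast
        then show "u \<in> ?S" using a by blast
      qed
      then have "card (bd H (F - ?S)) \<le> card ?S" using fb by (intro card_mono) auto
      moreover have "card ?S \<le> 2" using Z(3) card_mono[OF fb, of ?S] by simp
      moreover have "F - ?S \<subset> F" using S[OF f1(1)] f1 v(1) by blast
      moreover have "F - ?S \<noteq> {}"
      proof
        assume "F - ?S = {}"
        then have "F \<subseteq> ?S" by blast
        then have "card F \<le> card ?S" using fb by (intro card_mono) auto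
        then show False using cF \<open>card ?S \<le> 2\<close> by simp
      qed
      ultimately show ?thesis using M[of "F - ?S"] by simp
    next
      case 2
      then have z: "v 0 \<in> Z" "v n \<notin> Z" using v by auto
      have "2 \<le> card (bd U Z)"
        by (rule tail_fragment(1)[of U F v n f1 Z, OF U_def fF vF inj v(4) ind only f1 Z(1) z Z(3)])
      moreover have "Z \<inter> big U = {}"
        by (rule tail_fragment(2)[of U F v n f1 Z, OF U_def fF vF inj v(4) ind only f1 Z(1) z Z(3)])
      moreover have "card (nb Z u) \<le> 1" if "u \<in> U - Z" for u
        by (rule tail_fragment(3)[of U F v n f1 Z, OF U_def fF vF inj v(4) ind only f1 Z(1) z Z(3) that])
      ultimately show ?thesis by blast
    next
      case 3
      let ?w = "\<lambda>i. v (n - i)"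
      have im: "?w ` {0..n} = ?Q"
      proof -
        have "i \<in> (\<lambda>i. n - i) ` {0..n}" if "i \<le> n" for i
          by (rule image_eqI[of _ _ "n - i"]) (use that in auto)
        then have "(\<lambda>i. n - i) ` {0..n} = {0..n}" by auto
        then show ?thesis by (metis (no_types, lifting) image_cong image_image)
      qed
      have z: "?w 0 \<in> Z" "?w n \<notin> Z" using v 3 by auto
      have a: "U = F \<union> ?w ` {0..n}" "Z \<subseteq> ?w ` {0..n}" using im Z U_def by auto
      have b: "?w i \<notin> F" if "i \<le> n" for i using vF[of "n - i"] by simp
      have c: "inj_on ?w {0..n}"
      proof (rule inj_onI)
        fix i j assume "i \<in> {0..n}" "j \<in> {0..n}" "?w i = ?w j"
        then show "i = j" using inj_onD[OF inj, of "n - i" "n - j"] by auto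
      qed
      have d: "adj (?w i) (?w (Suc i))" if "i < n" for i
      proof -
        have "Suc (n - Suc i) = n - i" using that by simp
        then show ?thesis using v(4)[of "n - Suc i"] that adj_sym by auto
      qed
      have e: "j = Suc i \<or> i = Suc j" if "i \<le> n" "j \<le> n" "adj (?w i) (?w j)" for i j
        using ind[of "n - i" "n - j"] that by linarith
      have g: "i = 0 \<or> i = n" if "i \<le> n" "f \<in> F" "adj (?w i) f" for i f
        using only[of "n - i" f] that by linarith
      have h: "adj (?w 0) f2" using f2 by simp
      have "2 \<le> card (bd U Z)"
        by (rule tail_fragment(1)[of U F ?w n f2 Z, OF a(1) fF b c d e g f2(1) h a(2) z Z(3)])
      moreover have "Z \<inter> big U = {}"
        by (rule tail_fragment(2)[of U F ?w n f2 Z, OF a(1) fF b c d e g f2(1) h a(2) z Z(3)])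
      moreover have "card (nb Z u) \<le> 1" if "u \<in> U - Z" for u
        by (rule tail_fragment(3)[of U F ?w n f2 Z, OF a(1) fF b c d e g f2(1) h a(2) z Z(3) that])
      ultimately show ?thesis by blast
    next
      case 4
      define m where "m = n - 1"
      have nm: "n = Suc m" using n0 unfolding m_def by simp
      have Qm: "?Q = insert x (insert y (v ` {1..m}))"
      proof -
        have "{0..n} = insert 0 (insert n {1..m})" using nm by auto
        then show ?thesis using v by simp
      qed
      have U2: "U = insert x (insert y F) \<union> v ` {1..m}" unfolding U_def Qm by auto
      have Z2: "Z \<subseteq> v ` {1..m}" using Z(1) 4 unfolding Qm by blast
      have a: "v i \<notin> insert x (insert y F)" if "1 \<le> i" "i \<le> m" for i
        using vF[of i] v(1,2) inj_onD[OF inj, of i 0] inj_onD[OF inj, of i n] that nm by auto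
      have b: "adj (v i) (v (Suc i))" if "i \<le> m" for i using v(4) that nm by simp
      have c: "j = Suc i \<or> i = Suc j" if "1 \<le> i" "i \<le> m" "j \<le> Suc m" "adj (v i) (v j)" for i j
        using ind[of i j] that nm by simp
      have d: "finite (insert x (insert y F))" "v 0 \<in> insert x (insert y F)" "v (Suc m) \<in> insert x (insert y F)"
        using fF v nm by auto
      have inj2: "inj_on v {0..Suc m}" using inj nm by simp
      have "2 \<le> card (bd U Z)"
        by (rule path_fragment(1)[of U "insert x (insert y F)" v m, OF U2 d(1) a d(2,3) b inj2 c Z2 Z(2)])
      moreover have "Z \<inter> big U = {}"
        by (rule path_fragment(2)[of U "insert x (insert y F)" v m, OF U2 d(1) a d(2,3) b inj2 c Z2 Z(2) Z(3)])
      moreover have "card (nb Z u) \<le> 1" if "u \<in> U - Z" for u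
        by (rule path_fragment(3)[of U "insert x (insert y F)" v m, OF U2 d(1) a d(2,3) b inj2 c Z2 Z(2) Z(3) that])
      ultimately show ?thesis by blast
    qed
  qed
  have conn: "?Q \<subseteq> A \<or> ?Q \<inter> A = {}" if S: "bd U A \<inter> ?Q = {}" for A
  proof -
    have nx: "b \<in> A" if "a \<in> A" "adj a b" "b \<in> ?Q" for a b
    proof (rule ccontr)
      assume "b \<notin> A"
      then have "b \<in> bd U A" using that unfolding bd_def U_def by auto
      then show False using S that by blast
    qed
    have eqv: "v i \<in> A \<longleftrightarrow> v 0 \<in> A" if "i \<le> n" for i
      using that
    proof (induction i)
      case (Suc i)
      have q: "v i \<in> ?Q" "v (Suc i) \<in> ?Q" using Suc(2) by auto
      have ad: "adj (v i) (v (Suc i))" using v(4)[of i] Suc(2) by simp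
      have "v i \<in> A \<longleftrightarrow> v (Suc i) \<in> A" using nx[OF _ ad q(2)] nx[OF _ adj_sym[OF ad] q(1)] by blast
      then show ?case using Suc by simp
    qed simp
    show ?thesis
    proof (cases "v 0 \<in> A")
      case True
      have "?Q \<subseteq> A"
      proof
        fix z assume "z \<in> ?Q"
        then obtain i where i: "i \<le> n" "z = v i" by auto
        show "z \<in> A" unfolding i(2) using iffD2[OF eqv[OF i(1)] True] .
      qed
      then show ?thesis ..
    next
      case False
      have "?Q \<inter> A = {}"
      proof (rule equals0I)
        fix z assume "z \<in> ?Q \<inter> A"
        then obtain i where "i \<le> n" "v i \<in> A" by auto
        then show False using eqv[of i] False by simp
      qed
      then show ?thesis ..
    qed
  qed
  \<comment> \<open>No separation by two vertices of \<open>U\<close> has vertices of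
    \<open>F\<close> strictly on both sides.\<close>
  have K: "A \<inter> F = {} \<or> (U - A - bd U A) \<inter> F = {}" if A: "A \<subseteq> U" "card (bd U A) \<le> 2" for A
  proof (rule ccontr)
    assume no: "\<not> ?thesis"
    let ?S = "bd U A" and ?B = "U - A - bd U A"
    have fS: "finite ?S" using finite_bd[OF fU] .
    have SU: "?S \<subseteq> U" "?S \<inter> A = {}" by (auto simp: bd_def)
    \<comment> \<open>For either side \<open>Y\<close>, the set \<open>Y \<inter> F\<close> is a
      proper part of \<open>F\<close>, so its boundary in \<open>H\<close> has three vertices; those
      outside \<open>F\<close> can only be \<open>x\<close> and \<open>y\<close>.\<close>
    have big3: "3 \<le> card (?S \<inter> F) + card ({x, y} \<inter> (Y \<union> ?S))"
      if Y: "bd U Y \<subseteq> ?S" "Y \<inter> F \<noteq> {}" "\<not> F \<subseteq> Y" for Y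
    proof -
      have "bd H (Y \<inter> F) \<subseteq> (?S \<inter> F) \<union> ({x, y} \<inter> (Y \<union> ?S))"
      proof
        fix u assume u: "u \<in> bd H (Y \<inter> F)"
        then obtain a where a: "u \<in> H" "u \<notin> Y \<inter> F" "a \<in> Y" "a \<in> F" "adj a u" unfolding bd_def by blast
        have uU: "u \<in> U" "u \<in> F \<or> u \<in> {x, y}" using nbF[OF a(1,4,5)] xyQ unfolding U_def by auto
        show "u \<in> (?S \<inter> F) \<union> ({x, y} \<inter> (Y \<union> ?S))"
        proof (cases "u \<in> Y")
          case True then show ?thesis using uU a by blast
        next
          case False
          then have "u \<in> bd U Y" using a uU unfolding bd_def by blast
          then show ?thesis using Y uU by blast
        qed
      qed
      then have "card (bd H (Y \<inter> F)) \<le> card ((?S \<inter> F) \<union> ({x, y} \<inter> (Y \<union> ?S)))"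
        using fS by (intro card_mono) auto
      also have "\<dots> \<le> card (?S \<inter> F) + card ({x, y} \<inter> (Y \<union> ?S))" by (rule card_Un_le)
      finally have "card (bd H (Y \<inter> F)) \<le> card (?S \<inter> F) + card ({x, y} \<inter> (Y \<union> ?S))" .
      moreover have "Y \<inter> F \<subset> F" using Y(3) by blast
      then have "3 \<le> card (bd H (Y \<inter> F))" using M[of "Y \<inter> F"] Y(2) by blast
      ultimately show ?thesis by linarith
    qed
    have a3: "3 \<le> card (?S \<inter> F) + card ({x, y} \<inter> (A \<union> ?S))"
      by (rule big3) (use no in auto)
    have b3: "3 \<le> card (?S \<inter> F) + card ({x, y} \<inter> (?B \<union> ?S))"
      by (rule big3[OF bd_compl]) (use no in auto)
    have SS: "card ?S = card (?S \<inter> F) + card (?S \<inter> ?Q)"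
    proof -
      have "?S = (?S \<inter> F) \<union> (?S \<inter> ?Q)" using SU unfolding U_def by blast
      moreover have "(?S \<inter> F) \<inter> (?S \<inter> ?Q) = {}" using QH by blast
      ultimately show ?thesis using fS by (metis card_Un_disjoint finite_Int)
    qed
    show False
    proof (cases "card (?S \<inter> F) \<le> 1")
      case True
      \<comment> \<open>With at most one separating vertex in \<open>F\<close>, both
        \<open>x\<close> and \<open>y\<close> lie in the closure of each side, hence are themselves
        the separating vertices. Then none is left in \<open>F\<close>, and the count of three
        fails.\<close>
      have full: "{x, y} \<subseteq> T" if "3 \<le> card (?S \<inter> F) + card ({x, y} \<inter> T)" for T
      proof -
        have "2 \<le> card ({x, y} \<inter> T)" using that True by simp
        then have "{x, y} \<inter> T = {x, y}" using card_seteq[of "{x, y}" "{x, y} \<inter> T"] xy by simp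
        then show ?thesis by blast
      qed
      have "{x, y} \<subseteq> ?S" using full[OF a3] full[OF b3] by blast
      then have "{x, y} \<subseteq> ?S \<inter> ?Q" using xyQ by blast
      then have "card {x, y} \<le> card (?S \<inter> ?Q)" using fS by (intro card_mono) auto
      moreover have "card ({x, y} \<inter> (A \<union> ?S)) \<le> card {x, y}" by (intro card_mono) auto
      ultimately show False using SS A a3 xy by simp
    next
      case False
      then have "card (?S \<inter> F) = 2 \<and> card (?S \<inter> ?Q) = 0" using SS A(2) by linarith
      then have "card (?S \<inter> F) = 2" "card (?S \<inter> ?Q) = 0" by blast+
      then have "?S \<inter> ?Q = {}" using fS by simp
      from conn[OF this] show False
      proof
        assume "?Q \<subseteq> A"
        then have "{x, y} \<inter> (?B \<union> ?S) = {}" using xyQ SU by blast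
        then show False using b3 \<open>card (?S \<inter> F) = 2\<close> by simp
      next
        assume "?Q \<inter> A = {}"
        then have "{x, y} \<inter> (A \<union> ?S) = {}" using xyQ \<open>?S \<inter> ?Q = {}\<close> by blast
        then show False using a3 \<open>card (?S \<inter> F) = 2\<close> by simp
      qed
    qed
  qed
  have side: "(A \<subseteq> ?Q \<and> A \<noteq> {}) \<or> (U - A - bd U A \<subseteq> ?Q \<and> U - A - bd U A \<noteq> {})"
    if A: "A \<subseteq> U" "card (bd U A) \<le> 2" "A \<noteq> {}" "U - A - bd U A \<noteq> {}" for A
    using K[OF A(1,2)] A unfolding U_def by blast
  have cB: "card (bd U (U - A - bd U A)) \<le> card (bd U A)" for A
    by (rule card_mono[OF finite_bd[OF fU] bd_compl])
  have "good U"
    unfolding good_def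
  proof (intro conjI allI impI)
    show "U \<subseteq> V" using UH H by blast
    have "card F \<le> card (big U)" using Fbig fU by (intro card_mono) (auto simp: big_def)
    then show "3 \<le> card (big U)" using cF by simp
    show "A \<union> bd U A = U" if A: "A \<subseteq> U" "A \<noteq> {}" "card (bd U A) \<le> 1" for A
    proof (rule ccontr)
      assume "A \<union> bd U A \<noteq> U"
      then have "U - A - bd U A \<noteq> {}" using A unfolding bd_def by blast
      then show False using side[OF A(1) _ A(2)] K2[of A] K2[of "U - A - bd U A"] cB[of A] A(3) by fastforce
    qed
    show "A \<inter> big U = {} \<or> big U \<subseteq> A \<union> bd U A" if A: "A \<subseteq> U" "card (bd U A) \<le> 2" for A
    proof (rule ccontr)
      assume no: "\<not> ?thesis"
      then have 1: "A \<inter> big U \<noteq> {}" "(U - A - bd U A) \<inter> big U \<noteq> {}" unfolding big_def by blast+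
      then have "A \<noteq> {}" "U - A - bd U A \<noteq> {}" by blast+
      then show False using side[OF A] K2[of A] K2[of "U - A - bd U A"] cB[of A] A(2) 1 by force
    qed
    show "card (nb A u) \<le> 1" if A: "thr U A" and u: "u \<in> U - A" for A u
    proof -
      have "A \<subseteq> ?Q" "A \<noteq> {}" "card (bd U A) \<le> 2" using A Fbig unfolding thr_def U_def by blast+
      then show ?thesis using K2 u by blast
    qed
  qed
  then show ?thesis using UH by blast
qed

text \<open>Instance of the extremal argument with the vertex sets of embedded spiders as copies:
  \<open>emb_greedy\<close> gives \<open>copy_greedy\<close>, and \<open>core_empty\<close> gives
  \<open>copy_avoid\<close>.\<close>

lemma exists_spider_from_good:
  assumes c3: "conn3 V" and deg: "\<And>v. v \<in> V \<Longrightarrow> t + 3 \<le> card (nb V v)"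
    and t1: "(\<Sum>i<d. (l i + 1) div 2) \<le> t" and t2: "Suc (\<Sum>i<d. l i div 2) \<le> t"
    and lpos: "\<And>i. i < d \<Longrightarrow> 1 \<le> l i" and dl: "2 \<le> d \<or> (\<forall>i<d. l i \<le> 1)"
    and e: "emb d l c p" and U: "good U" "U \<subseteq> V - feet d l c p"
  shows "\<exists>c p. emb d l c p \<and> conn3 (V - feet d l c p)"
proof -
  define T where "T = {feet d l c p |c p. emb d l c p}"
  have le: "card (nb (feet d l c p) v) \<le> t" if "emb d l c p" for c p v
    using emb_nb_same[OF that, of v] emb_nb_other[OF that, of v] t1 t2 by (cases "col v = col c") auto
  interpret bip_graph_copies V adj col T t
  proof
    show "1 \<le> t" using t2 by simp
    show "S \<subseteq> V" if "S \<in> T" for S using that embD(1) unfolding T_def by blast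
    show "card (nb S v) \<le> t" if "S \<in> T" for S v using that le unfolding T_def by blast
    show "\<exists>S\<in>T. S \<subseteq> W" if W: "W \<subseteq> V" "W \<noteq> {}" "\<And>w. w \<in> W \<Longrightarrow> t \<le> card (nb W w)" for W
    proof -
      obtain c where c: "c \<in> W" using W by blast
      have "\<exists>p. emb d l c p \<and> feet d l c p \<subseteq> W"
        by (rule emb_greedy[OF W(1) c]) (use W(3) t1 t2 order_trans in blast)+
      then show ?thesis unfolding T_def by blast
    qed
    show "\<exists>S\<in>T. S \<subseteq> W - {v}"
      if hyp: "W \<subseteq> V" "\<exists>S\<in>T. S \<subset> W"
        "\<And>S w. S \<in> T \<Longrightarrow> S \<subseteq> W \<Longrightarrow> w \<in> W - S \<Longrightarrow> Suc t \<le> card (nb W w)" "v \<in> W" for W v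
    proof -
      interpret spider_host V adj col d l t W
      proof
        show "Suc t \<le> card (nb W w)" if "emb d l c p" "feet d l c p \<subseteq> W" "w \<in> W - feet d l c p" for c p w
          by (rule hyp(3)[OF _ that(2,3)]) (use that(1) in \<open>auto simp: T_def\<close>)
      qed (use hyp(1) t1 t2 lpos dl in auto)
      obtain c p where "emb d l c p" "feet d l c p \<subset> W" using hyp(2) unfolding T_def by blast
      then have "v \<notin> core" using core_empty by blast
      then show ?thesis using hyp(4) unfolding core_def T_def by blast
    qed
  qed (use c3 deg in auto)
  have "feet d l c p \<in> T" using e unfolding T_def by blast
  then show ?thesis using exists_keeping_copy[OF _ U] unfolding T_def by blast
qed

text \<open>The copy takes just one vertex more than a set \<open>Z\<close> whose removal keeps
  \<open>conn3\<close>. So what remains is either fine or still 2-connected of minimum degree 3,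
  which is what \<open>initial_good\<close> needs for a starting subgraph.\<close>

lemma exists_spider_step:
  assumes c3: "conn3 V" and deg: "\<And>v. v \<in> V \<Longrightarrow> t + 3 \<le> card (nb V v)"
    and t1: "(\<Sum>i<d. (l i + 1) div 2) \<le> t" and t2: "Suc (\<Sum>i<d. l i div 2) \<le> t"
    and lpos: "\<And>i. i < d \<Longrightarrow> 1 \<le> l i" and dl: "2 \<le> d \<or> (\<forall>i<d. l i \<le> 1)"
    and e: "emb d l c p" and J: "conn3 (V - Z)" "feet d l c p = insert u Z"
  shows "\<exists>c p. emb d l c p \<and> conn3 (V - feet d l c p)"
proof (cases "conn3 (V - feet d l c p)")
  case False
  let ?T = "feet d l c p" and ?H = "V - feet d l c p"
  have TV: "?T \<subseteq> V" by (rule embD(1)[OF e])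
  have "\<exists>U. good U \<and> U \<subseteq> ?H"
  proof (rule initial_good[OF _ _ _ False])
    show "3 \<le> card (nb ?H h)" if h: "h \<in> ?H" for h
    proof -
      have "card (nb ?T h) \<le> t"
        using emb_nb_same[OF e, of h] emb_nb_other[OF e, of h] t1 t2 by (cases "col h = col c") auto
      moreover have "nb V h = nb ?T h \<union> nb ?H h" using TV unfolding nb_def by blast
      then have "card (nb V h) \<le> card (nb ?T h) + card (nb ?H h)" by (simp add: card_Un_le)
      ultimately show ?thesis using deg[of h] h by simp
    qed
    show "F \<union> bd ?H F = ?H" if F: "F \<subseteq> ?H" "F \<noteq> {}" "card (bd ?H F) \<le> 1" for F
    proof -
      have sub: "bd (V - Z) F \<subseteq> insert u (bd ?H F)" unfolding J(2) bd_def by blast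
      have "finite (bd ?H F)" using finite_V finite_bd by simp
      then have "card (bd (V - Z) F) \<le> Suc (card (bd ?H F))"
        using card_mono[OF _ sub] card_insert_le_m1 by (metis card_insert_if finite_insert le_SucI)
      moreover have "F \<subseteq> V - Z" using F(1) J(2) by blast
      ultimately have "F \<union> bd (V - Z) F = V - Z" using J(1) F unfolding conn3_def by simp
      then show ?thesis using sub F(1) unfolding J(2) bd_def by blast
    qed
  qed auto
  then show ?thesis using exists_spider_from_good[OF c3 deg t1 t2 lpos dl e] by blast
qed (use e in blast)

theorem exists_spider:
  assumes c3: "conn3 V" and deg: "\<And>v. v \<in> V \<Longrightarrow> t + 3 \<le> card (nb V v)" and ne: "V \<noteq> {}"
    and t1: "(\<Sum>i<d. (l i + 1) div 2) \<le> t" and t2: "Suc (\<Sum>i<d. l i div 2) \<le> t"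
    and lpos: "\<And>i. i < d \<Longrightarrow> 1 \<le> l i" and dl: "2 \<le> d \<or> (\<forall>i<d. l i \<le> 1)"
  shows "\<exists>c p. emb d l c p \<and> conn3 (V - feet d l c p)"
  using t1 t2 lpos dl
proof (induction "\<Sum>i<d. l i" arbitrary: d l)
  case 0
  have d: "d = 0"
  proof (rule ccontr)
    assume "d \<noteq> 0"
    then have "l 0 = 0" "1 \<le> l 0" using 0(1) 0(4)[of 0] by auto
    then show False by simp
  qed
  obtain c where c: "c \<in> V" using ne by blast
  have e: "emb d l c (\<lambda>i s. c)" "feet d l c (\<lambda>i s. c) = insert c {}"
    using emb_trivial[OF c, of d l] feet_trivial[of d l c] d by auto
  show ?case
    by (rule exists_spider_step[OF c3 deg 0(2-5) e(1) _ e(2)]) (use c3 in auto)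
next
  case (Suc n)
  have ext: ?case if a: "emb d a c p" "conn3 (V - feet d a c p)" "i < d" "l = a(i := Suc (a i))"
    for a c p i
  proof -
    let ?T = "feet d a c p" and ?w = "p i (a i)"
    have al: "a j \<le> l j" for j using a(4) by simp
    have "(\<Sum>i<d. (a i + 1) div 2) \<le> t" "Suc (\<Sum>i<d. a i div 2) \<le> t"
      using Suc(3,4) sum_mono[of "{..<d}" "\<lambda>i. (a i + 1) div 2" "\<lambda>i. (l i + 1) div 2"]
        sum_mono[of "{..<d}" "\<lambda>i. a i div 2" "\<lambda>i. l i div 2"] al by (auto simp: div_le_mono)
    then have "card (nb ?T ?w) \<le> t"
      using emb_nb_same[OF a(1), of ?w] emb_nb_other[OF a(1), of ?w] by (cases "col ?w = col c") auto
    moreover have w: "?w \<in> V" using embD(1)[OF a(1)] embD(8)[OF a(1,3), of "a i"] by blast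
    ultimately have "card (nb ?T ?w) < card (nb V ?w)" using deg[OF w] by simp
    moreover have "finite (nb ?T ?w)" by (simp add: finite_nb finite_feet)
    ultimately obtain x where "x \<in> nb V ?w" "x \<notin> nb ?T ?w"
      using card_mono[of "nb ?T ?w" "nb V ?w"] by (meson not_less subsetI)
    then have x: "x \<in> V" "x \<notin> ?T" "adj ?w x" unfolding nb_def by auto
    note ex = emb_extend[OF a(1,3) x]
    show ?thesis
      by (rule exists_spider_step[OF c3 deg Suc(3-6) ex(1)[folded a(4)] a(2) ex(2)[folded a(4)]])
  qed
  show ?case
  proof (cases "\<exists>i<d. 2 \<le> l i")
    case True
    then obtain i where i: "i < d" "2 \<le> l i" by blast
    define a where "a = l(i := l i - 1)"
    have la: "l = a(i := Suc (a i))" using i unfolding a_def by auto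
    have s1: "(\<Sum>j<d. l j) = Suc (\<Sum>j<d. a j)"
      using sum_upd_gt[OF i(1), of "\<lambda>x. x" a "Suc (a i)"] unfolding la[symmetric] by simp
    have al: "a j \<le> l j" for j unfolding a_def by simp
    have "\<exists>c p. emb d a c p \<and> conn3 (V - feet d a c p)"
    proof (rule Suc(1))
      show "n = (\<Sum>i<d. a i)" using s1 Suc(2) by simp
      show "(\<Sum>i<d. (a i + 1) div 2) \<le> t" "Suc (\<Sum>i<d. a i div 2) \<le> t"
        using Suc(3,4) sum_mono[of "{..<d}" "\<lambda>i. (a i + 1) div 2" "\<lambda>i. (l i + 1) div 2"]
          sum_mono[of "{..<d}" "\<lambda>i. a i div 2" "\<lambda>i. l i div 2"] al by (auto simp: div_le_mono)
      show "1 \<le> a j" if "j < d" for j using Suc(5)[OF that] i unfolding a_def by auto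
      show "2 \<le> d \<or> (\<forall>i<d. a i \<le> 1)" using Suc(6) i by auto
    qed
    then show ?thesis using ext[OF _ _ i(1) la] by blast
  next
    case False
    \<comment> \<open>Now all legs have length 1. Shortening one further would leave a leg of length
      0, so a whole leg is dropped; \<open>dl\<close> survives because no leg exceeds 1.\<close>
    have d: "d \<noteq> 0" using Suc(2) by (cases d) auto
    then obtain k where k: "d = Suc k" by (cases d) auto
    have l1: "l i = 1" if "i < d" for i using False Suc(5)[OF that] that by force
    have "\<exists>c p. emb k l c p \<and> conn3 (V - feet k l c p)"
    proof (rule Suc(1))
      show "n = (\<Sum>i<k. l i)" using Suc(2) l1[of k] k by simp
      show "(\<Sum>i<k. (l i + 1) div 2) \<le> t" "Suc (\<Sum>i<k. l i div 2) \<le> t" using Suc(3,4) k by auto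
      show "1 \<le> l j" if "j < k" for j using Suc(5)[of j] that k by simp
      show "2 \<le> k \<or> (\<forall>i<k. l i \<le> 1)" using l1 k by auto
    qed
    then obtain c p where e: "emb k l c p" "conn3 (V - feet k l c p)" by blast
    \<comment> \<open>The smaller star is read as a spider with \<open>d\<close> legs whose last leg
      has length 0, so that the missing leaf is again an extension of a leg.\<close>
    define a where "a = l(k := 0)"
    define q where "q = p(k := \<lambda>_. c)"
    have la: "l = a(k := Suc (a k))" using l1[of k] k unfolding a_def by auto
    have old: "a j = l j" "q j = p j" if "j < k" for j using that unfolding a_def q_def by auto
    have ft: "feet d a c q = feet k l c p"
    proof (rule set_eqI)
      fix x
      have "(\<exists>i s. i < d \<and> 1 \<le> s \<and> s \<le> a i \<and> x = q i s) \<longleftrightarrow> (\<exists>i s. i < k \<and> 1 \<le> s \<and> s \<le> l i \<and> x = p i s)"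
        using old k by (metis a_def fun_upd_same less_Suc_eq not_one_le_zero le_zero_eq)
      then show "x \<in> feet d a c q \<longleftrightarrow> x \<in> feet k l c p" unfolding feet_iff by simp
    qed
    have lt: "i < k" if "i < d" "0 < a i" for i using that k unfolding a_def by (auto split: if_splits simp: less_Suc_eq)
    have "emb d a c q"
    proof (rule embI)
      show "feet d a c q \<subseteq> V" unfolding ft by (rule embD(1)[OF e(1)])
      show "q i 0 = c" if "i < d" for i
        using embD(3)[OF e(1)] that k unfolding q_def by (auto simp: less_Suc_eq)
      show "adj (q i s) (q i (Suc s))" if "i < d" "s < a i" for i s
        using embD(4)[OF e(1) lt, of i s] old[of i] lt[of i] that by auto
      show "q i s \<noteq> c" if "i < d" "1 \<le> s" "s \<le> a i" for i s
        using embD(5)[OF e(1) lt, of i s] old[of i] lt[of i] that by auto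
      show "i = j \<and> s = r" if "i < d" "1 \<le> s" "s \<le> a i" "j < d" "1 \<le> r" "r \<le> a j" "q i s = q j r" for i s j r
        using embD(6)[OF e(1) lt _ _ lt, of i s j r] old[of i] old[of j] lt[of i] lt[of j] that by auto
    qed
    then show ?thesis using ext[of a c q k] e(2) la k unfolding ft by simp
  qed
qed

text \<open>Take one leg through each neighbour of \<open>c\<close> with the largest possible total
  length. Inner leg vertices have degree 2 and see only their leg, tips cannot be extended, and an
  edge between two tips would close a cycle, so the legs exhaust the connected graph and all its
  edges.\<close>

lemma exists_legs:
  assumes conn: "\<And>A. A \<subseteq> V \<Longrightarrow> A \<noteq> {} \<Longrightarrow> (\<And>a b. a \<in> A \<Longrightarrow> b \<in> V \<Longrightarrow> adj a b \<Longrightarrow> b \<in> A) \<Longrightarrow> A = V"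
    and c: "c \<in> V" "\<And>v. v \<in> V \<Longrightarrow> v \<noteq> c \<Longrightarrow> card (nb V v) \<le> 2"
      "\<And>v. v \<in> V \<Longrightarrow> card (nb V v) \<le> card (nb V c)"
    and acyc: "\<And>q n. 3 \<le> n \<Longrightarrow> (\<And>s. s < n \<Longrightarrow> adj (q s) (q (Suc s))) \<Longrightarrow> inj_on q {1..n} \<Longrightarrow>
      q 0 = q n \<Longrightarrow> q ` {..n} \<subseteq> V \<Longrightarrow> False"
  shows "\<exists>d l p. emb d l c p \<and> feet d l c p = V \<and> (\<forall>i<d. 1 \<le> l i) \<and> (2 \<le> d \<or> (\<forall>i<d. l i \<le> 1)) \<and>
    (\<forall>u\<in>V. \<forall>v\<in>V. adj u v \<longrightarrow> (\<exists>i s. i < d \<and> s < l i \<and> {u, v} = {p i s, p i (Suc s)}))"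
proof -
  define d where "d = card (nb V c)"
  have fin: "finite (nb V v)" for v using finite_V by (simp add: finite_nb)
  obtain h where h: "bij_betw h {..<d} (nb V c)"
    using ex_bij_betw_nat_finite[OF fin, of c] unfolding d_def atLeast0LessThan by blast
  define Q where "Q l \<longleftrightarrow> (\<forall>i<d. 1 \<le> l i) \<and> (\<exists>p. emb d l c p)" for l
  have hV: "h i \<in> V" "adj c (h i)" if "i < d" for i
    using bij_betwE[OF h] that unfolding nb_def by auto
  have hc: "h i \<noteq> c" if "i < d" for i using hV[OF that] adj_col by blast
  have hinj: "i = j" if "i < d" "j < d" "h i = h j" for i j
    using h that unfolding bij_betw_def by (meson inj_onD lessThan_iff)
  have "emb d (\<lambda>_. 1) c (\<lambda>i s. if s = 0 then c else h i)"
  proof (rule embI)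
    show "feet d (\<lambda>_. 1) c (\<lambda>i s. if s = 0 then c else h i) \<subseteq> V"
      using c(1) hV(1) unfolding subset_iff feet_iff by auto
  qed (use hV hc hinj in auto)
  then have Q0: "Q (\<lambda>_. 1)" unfolding Q_def by auto
  have bound: "(\<Sum>i<d. l i) < Suc (card V)" if "Q l" for l
  proof -
    obtain p where p: "emb d l c p" using \<open>Q l\<close> unfolding Q_def by blast
    have "(\<Sum>i<d. l i) = (\<Sum>i<d. (l i + 1) div 2) + (\<Sum>i<d. l i div 2)"
      unfolding sum.distrib[symmetric] by (intro sum.cong) auto
    also have "\<dots> \<le> card {x \<in> feet d l c p. col x \<noteq> col c} + card {x \<in> feet d l c p. col x = col c}"
      unfolding emb_card_other[OF p] emb_card_same[OF p] by simp
    also have "\<dots> = card ({x \<in> feet d l c p. col x \<noteq> col c} \<union> {x \<in> feet d l c p. col x = col c})"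
      by (rule card_Un_disjoint[symmetric]) (auto simp: finite_feet)
    also have "\<dots> \<le> card V" using embD(1)[OF p] finite_V by (intro card_mono) auto
    finally show ?thesis by simp
  qed
  obtain l where l: "Q l" "\<And>a. Q a \<Longrightarrow> (\<Sum>i<d. a i) \<le> (\<Sum>i<d. l i)"
    using ex_has_greatest_nat[of Q "\<lambda>_. 1" "\<lambda>l. \<Sum>i<d. l i" "Suc (card V)"] Q0 bound by blast
  obtain p where p: "emb d l c p" and lpos: "\<And>i. i < d \<Longrightarrow> 1 \<le> l i" using l(1) unfolding Q_def by blast
  note e = embD[OF p]
  let ?F = "feet d l c p"
  have pV: "p i s \<in> V" if "i < d" "s \<le> l i" for i s using e(1) e(8)[OF that] by blast
  have final: "x \<in> ?F" if i: "i < d" and x: "x \<in> V" "adj (p i (l i)) x" for i x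
  proof (rule ccontr)
    assume "x \<notin> ?F"
    from emb_extend(1)[OF p i x(1) this x(2)] have "Q (l(i := Suc (l i)))"
      using lpos unfolding Q_def by auto
    from l(2)[OF this] show False
      using sum_upd_gt[OF i, of "\<lambda>x. x" l "Suc (l i)"] by simp
  qed
  have nbc: "nb V c = (\<lambda>i. p i 1) ` {..<d}"
  proof -
    have "(\<lambda>i. p i 1) ` {..<d} \<subseteq> nb V c"
      using pV[of _ 1] lpos e(3) e(4)[of _ 0] by (force simp: nb_def)
    moreover have "inj_on (\<lambda>i. p i 1) {..<d}" using e(6)[of _ 1 _ 1] lpos by (auto intro: inj_onI)
    then have "card ((\<lambda>i. p i 1) ` {..<d}) = card (nb V c)" by (simp add: card_image d_def)
    ultimately show ?thesis using card_subset_eq[OF fin] by metis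
  qed
  have inner: "x = p i (s - 1) \<or> x = p i (Suc s)"
    if hyp: "i < d" "1 \<le> s" "s < l i" and x: "x \<in> V" "adj (p i s) x" for i s x
  proof -
    have ne: "p i (s - 1) \<noteq> p i (Suc s)"
    proof (cases "s = 1")
      case True
      then show ?thesis using e(3)[OF hyp(1)] e(5)[of i "Suc s"] hyp by simp
    next
      case False
      then have "1 \<le> s - 1" "s - 1 \<le> l i" "s - 1 \<noteq> Suc s" using hyp by auto
      then show ?thesis using e(6)[of i "s - 1" i "Suc s"] hyp by auto
    qed
    have "adj (p i s) (p i (s - 1))" using adj_sym[OF e(4)[of i "s - 1"]] hyp by simp
    moreover have "adj (p i s) (p i (Suc s))" using e(4) hyp by simp
    moreover have "p i (s - 1) \<in> V" "p i (Suc s) \<in> V" using pV hyp by auto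
    ultimately have sub: "{p i (s - 1), p i (Suc s)} \<subseteq> nb V (p i s)" unfolding nb_def by simp
    have "p i s \<in> V" "p i s \<noteq> c" using pV e(5) hyp by auto
    then have "card (nb V (p i s)) \<le> card {p i (s - 1), p i (Suc s)}"
      using c(2) ne by (simp add: numeral_2_eq_2)
    then have "{p i (s - 1), p i (Suc s)} = nb V (p i s)" using card_seteq[OF fin sub] by simp
    moreover have "x \<in> nb V (p i s)" using x unfolding nb_def by simp
    ultimately show ?thesis by blast
  qed
  let ?P = "\<lambda>u v. \<exists>i s. i < d \<and> s < l i \<and> {u, v} = {p i s, p i (Suc s)}"
  have Pc: "?P c x" if "x \<in> V" "adj c x" for x
  proof -
    have "x \<in> nb V c" using that unfolding nb_def by simp
    then obtain i where i: "i < d" "x = p i 1" unfolding nbc by blast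
    then have "0 < l i" "{c, x} = {p i 0, p i (Suc 0)}" using lpos[of i] e(3) by auto
    then show ?thesis using i(1) by blast
  qed
  have Pin: "?P (p i s) x" if "i < d" "1 \<le> s" "s < l i" "x \<in> V" "adj (p i s) x" for i s x
  proof -
    have "s - 1 < l i" "Suc (s - 1) = s" using that by auto
    then show ?thesis using inner[OF that] that(1,3) by (metis insert_commute)
  qed
  have comm: "?P u v \<Longrightarrow> ?P v u" for u v by (simp add: insert_commute)
  have Pend: "?P (p i (l i)) x" if i: "i < d" and x: "x \<in> V" "adj (p i (l i)) x" for i x
  proof -
    have pi: "p i (l i) \<in> V" "adj x (p i (l i))" using pV[of i "l i"] i x adj_sym by auto
    consider "x = c" | (leg) j r where "j < d" "1 \<le> r" "r \<le> l j" "x = p j r"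
      using final[OF i x] unfolding feet_iff by blast
    then show ?thesis
    proof cases
      case 1
      then show ?thesis using Pc pi comm by blast
    next
      case leg
      show ?thesis
      proof (cases "r < l j")
        case True
        then show ?thesis using Pin[of j r "p i (l i)"] leg pi comm by blast
      next
        case False
        then have r: "r = l j" using leg by simp
        have ij: "i \<noteq> j" using x(2) adj_col leg(4) r by blast
        \<comment> \<open>The only remaining possibility is an edge between the tips of two
          different legs: out along leg \<open>i\<close> and back along leg \<open>j\<close> it
          closes a cycle through \<open>c\<close> of length \<open>l i + l j + 1\<close>.\<close>
        define q where "q s = (if s \<le> l i then p i s else p j (l i + l j + 1 - s))" for s
        define n where "n = l i + l j + 1"
        have "3 \<le> n" using lpos[of i] lpos[of j] leg i unfolding n_def by simp
        moreover have "adj (q s) (q (Suc s))" if "s < n" for s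
        proof -
          consider "s < l i" | "s = l i" | "l i < s" by linarith
          then show ?thesis
          proof cases
            case 1
            then show ?thesis using e(4)[OF i] unfolding q_def by simp
          next
            case 2
            then show ?thesis using x(2) leg(4) r unfolding q_def by simp
          next
            case 3
            then have "l i + l j + 1 - s = Suc (l i + l j + 1 - Suc s)" "l i + l j + 1 - Suc s < l j"
              using that unfolding n_def by auto
            then show ?thesis using 3 adj_sym[OF e(4)[OF leg(1)]] unfolding q_def by simp
          qed
        qed
        moreover have q0: "q 0 = c" "q n = c" using e(3)[OF i] e(3)[OF leg(1)] unfolding q_def n_def by auto
        moreover have "inj_on q {1..n}"
        proof (rule inj_onI)
          have qc: "q s \<noteq> c" if "1 \<le> s" "s < n" for s
            using e(5)[OF i, of s] e(5)[OF leg(1), of "l i + l j + 1 - s"] that unfolding q_def n_def by auto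
          fix s s' assume s: "s \<in> {1..n}" "s' \<in> {1..n}" "q s = q s'"
          show "s = s'"
          proof (cases "s = n \<or> s' = n")
            case True
            then show ?thesis using qc[of s] qc[of s'] q0 s
              by (metis atLeastAtMost_iff le_neq_implies_less)
          next
            case False
            then have *: "1 \<le> s" "s < n" "1 \<le> s'" "s' < n" using s(1,2) by auto
            have far: "1 \<le> l i + l j + 1 - r" "l i + l j + 1 - r \<le> l j" if "l i < r" "r < n" for r
              using that unfolding n_def by auto
            show ?thesis
            proof (cases "s \<le> l i"; cases "s' \<le> l i")
              assume "s \<le> l i" "s' \<le> l i"
              then show ?thesis using s(3) e(6)[OF i _ _ i, of s s'] * unfolding q_def by auto
            next
              assume "s \<le> l i" "\<not> s' \<le> l i"
              then show ?thesis
                using s(3) e(6)[OF i _ _ leg(1) far, of s s'] * ij unfolding q_def by auto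
            next
              assume "\<not> s \<le> l i" "s' \<le> l i"
              then show ?thesis
                using s(3) e(6)[OF i _ _ leg(1) far, of s' s] * ij unfolding q_def by auto
            next
              assume gt: "\<not> s \<le> l i" "\<not> s' \<le> l i"
              then have "l i + l j + 1 - s = l i + l j + 1 - s'"
                using s(3) e(6)[OF leg(1) far leg(1) far, of s s'] * unfolding q_def by auto
              then show ?thesis using * unfolding n_def by simp
            qed
          qed
        qed
        moreover have "q s \<in> V" if "s \<le> n" for s
          using pV[OF i, of s] pV[OF leg(1), of "l i + l j + 1 - s"] that unfolding q_def n_def by auto
        then have "q ` {..n} \<subseteq> V" by auto
        ultimately have False using acyc[of n q] by simp
        then show ?thesis ..
      qed
    qed
  qed
  have arcs: "?P u v" if u: "u \<in> ?F" and v: "v \<in> V" "adj u v" for u v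
  proof -
    consider "u = c" | (leg) i s where "i < d" "1 \<le> s" "s \<le> l i" "u = p i s"
      using u unfolding feet_iff by blast
    then show ?thesis
    proof cases
      case 1
      then show ?thesis using Pc v by blast
    next
      case leg
      then show ?thesis using Pin[OF leg(1,2), of v] Pend[OF leg(1), of v] v by (cases "s = l i") auto
    qed
  qed
  have F: "?F = V"
  proof (rule conn)
    show "b \<in> ?F" if ab: "a \<in> ?F" "b \<in> V" "adj a b" for a b
    proof -
      obtain i s where "i < d" "s < l i" "{a, b} = {p i s, p i (Suc s)}" using arcs[OF ab] by blast
      then have "b = p i s \<or> b = p i (Suc s)" "s \<le> l i" "Suc s \<le> l i" by (auto simp: doubleton_eq_iff)
      then show ?thesis using e(8)[OF \<open>i < d\<close>] by blast
    qed
    show "?F \<noteq> {}" using feet_iff[of c] by blast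
  qed (rule e(1))
  have "2 \<le> d \<or> (\<forall>i<d. l i \<le> 1)"
  proof (rule ccontr)
    assume "\<not> ?thesis"
    then obtain i where i: "i < d" "2 \<le> l i" "d \<le> 1" by force
    \<comment> \<open>On a single leg of length at least 2 the vertex \<open>p i 1\<close> would
      have degree 2, more than the maximum degree attained at \<open>c\<close>.\<close>
    have ne: "p i 0 \<noteq> p i 2" using e(3)[OF i(1)] e(5)[OF i(1), of 2] i by simp
    have "adj (p i 1) (p i 0)" using adj_sym[OF e(4)[of i 0]] i by simp
    moreover have "adj (p i 1) (p i 2)" using e(4)[of i 1] i by (simp add: numeral_2_eq_2)
    moreover have "p i 0 \<in> V" "p i 2 \<in> V" using pV i by auto
    ultimately have "{p i 0, p i 2} \<subseteq> nb V (p i 1)" unfolding nb_def by simp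
    from card_mono[OF fin this] have "2 \<le> card (nb V (p i 1))" using ne by simp
    moreover have "p i 1 \<in> V" using pV i by auto
    ultimately show False using c(3)[of "p i 1"] i(3) unfolding d_def by simp
  qed
  then show ?thesis using p F lpos arcs by blast
qed

end

section \<open>Pair graphs\<close>

text \<open>Replaces reachability by the absence of proper nonempty closed sets, the form in which
  boundaries \<open>bd\<close> express separation.\<close>

lemma connected_iff_closed:
  "connected H \<longleftrightarrow> verts H \<noteq> {} \<and> (\<forall>A\<subseteq>verts H. A \<noteq> {} \<longrightarrow>
    (\<forall>a\<in>A. \<forall>b\<in>verts H. (a, b) \<in> (arcs_ends H)\<^sup>s \<longrightarrow> b \<in> A) \<longrightarrow> A = verts H)"
  (is "_ \<longleftrightarrow> _ \<and> ?R")
proof -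
  let ?r = "rtrancl_on (verts H) ((arcs_ends H)\<^sup>s)"
  have "(\<forall>u\<in>verts H. \<forall>v\<in>verts H. (u, v) \<in> ?r) \<longleftrightarrow> ?R"
  proof
    assume L: "\<forall>u\<in>verts H. \<forall>v\<in>verts H. (u, v) \<in> ?r"
    show ?R
    proof (intro allI impI)
      fix A assume A: "A \<subseteq> verts H" "A \<noteq> {}"
        "\<forall>a\<in>A. \<forall>b\<in>verts H. (a, b) \<in> (arcs_ends H)\<^sup>s \<longrightarrow> b \<in> A"
      obtain a where a: "a \<in> A" using A(2) by blast
      have "v \<in> A" if "v \<in> verts H" for v
      proof -
        have "(a, v) \<in> ?r" using L A(1) a that by blast
        then show ?thesis by (induction rule: rtrancl_on_induct) (use a A(3) in blast)+
      qed
      then show "A = verts H" using A(1) by auto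
    qed
  next
    assume R: ?R
    show "\<forall>u\<in>verts H. \<forall>v\<in>verts H. (u, v) \<in> ?r"
    proof
      fix u assume u: "u \<in> verts H"
      let ?A = "{v \<in> verts H. (u, v) \<in> ?r}"
      have "\<forall>a\<in>?A. \<forall>b\<in>verts H. (a, b) \<in> (arcs_ends H)\<^sup>s \<longrightarrow> b \<in> ?A"
        by (auto intro: rtrancl_on_into_rtrancl_on)
      moreover have "?A \<subseteq> verts H" "?A \<noteq> {}" using u by auto
      ultimately have "?A = verts H" 
        using R[THEN spec, of ?A, THEN mp, THEN mp, THEN mp] by (simp del: mem_Collect_eq)
      then show "\<forall>v\<in>verts H. (u, v) \<in> ?r" by blast
    qed
  qed
  then show ?thesis unfolding connected_conv by simp
qed

lemma (in pair_graph) connected_induce_iff: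
  "connected (with_proj G \<restriction> W) \<longleftrightarrow> W \<noteq> {} \<and> (\<forall>A\<subseteq>W. A \<noteq> {} \<longrightarrow>
    (\<forall>a\<in>A. \<forall>b\<in>W. (a, b) \<in> parcs G \<longrightarrow> b \<in> A) \<longrightarrow> A = W)"
proof -
  have "arcs_ends (with_proj G \<restriction> W) = {(u, v) \<in> parcs G. u \<in> W \<and> v \<in> W}"
    by (auto simp: arcs_ends_conv image_iff)
  moreover have "R\<^sup>s = R" if "sym R" for R :: "'a rel"
    using that unfolding symcl_def by (auto dest: symD)
  moreover have "sym {(u, v) \<in> parcs G. u \<in> W \<and> v \<in> W}" by (rule symI) (use arcs_symmetric in auto)
  ultimately have eq: "(arcs_ends (with_proj G \<restriction> W))\<^sup>s = {(u, v) \<in> parcs G. u \<in> W \<and> v \<in> W}" by simp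
  have "(\<forall>a\<in>A. \<forall>b\<in>W. (a, b) \<in> {(u, v) \<in> parcs G. u \<in> W \<and> v \<in> W} \<longrightarrow> b \<in> A) \<longleftrightarrow>
      (\<forall>a\<in>A. \<forall>b\<in>W. (a, b) \<in> parcs G \<longrightarrow> b \<in> A)" if "A \<subseteq> W" for A
    using that by auto
  then show ?thesis
    unfolding connected_iff_closed[of "with_proj G \<restriction> W"] eq induce_subgraph_verts by (simp cong: imp_cong)
qed

lemma delete_verts_delete_verts:
  "delete_verts (delete_verts G S) R = G \<restriction> (verts G - S - R)"
  unfolding delete_verts_def induce_subgraph_def by auto

lemma verts_delete_verts: "verts (delete_verts G S) = verts G - S"
  by (simp add: delete_verts_def)

locale pair_bip_graph = pair_graph G + bip_graph "pverts G" "\<lambda>u v. (u, v) \<in> parcs G" col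
  for G :: "'a pair_pre_digraph" and col
begin

lemma degree_eq: "degree (with_proj G) v = card (nb (pverts G) v)"
proof -
  have "out_arcs (with_proj G) v = Pair v ` nb (pverts G) v"
    using in_arcsD2 unfolding out_arcs_def nb_def by force
  then show ?thesis unfolding degree_def out_degree_def by (simp add: card_image inj_on_def)
qed

lemma conn3_if_k_connected:
  assumes "k_connected 3 (with_proj G)"
  shows "conn3 (pverts G)"
  unfolding conn3_def
proof (intro allI impI)
  fix F assume F: "F \<subseteq> pverts G" "F \<noteq> {}" "card (bd (pverts G) F) \<le> 2"
  let ?S = "bd (pverts G) F"
  have S: "?S \<subseteq> pverts G" "?S \<inter> F = {}" unfolding bd_def by auto
  show "F \<union> ?S = pverts G"
  proof (rule ccontr)
    assume ne: "F \<union> ?S \<noteq> pverts G"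
    have "\<not> connected (with_proj G \<restriction> (pverts G - ?S))"
    proof
      assume "connected (with_proj G \<restriction> (pverts G - ?S))"
      then have "F \<subseteq> pverts G - ?S \<Longrightarrow> F \<noteq> {} \<Longrightarrow>
          \<forall>a\<in>F. \<forall>b\<in>pverts G - ?S. (a, b) \<in> parcs G \<longrightarrow> b \<in> F \<Longrightarrow> F = pverts G - ?S"
        unfolding connected_induce_iff by blast
      moreover have "\<forall>a\<in>F. \<forall>b\<in>pverts G - ?S. (a, b) \<in> parcs G \<longrightarrow> b \<in> F"
        unfolding bd_def by blast
      ultimately have "F = pverts G - ?S" using F S by blast
      then show False using ne S by blast
    qed
    then have "connectivity (with_proj G) \<le> card ?S"
      unfolding connectivity_def using S(1) by (intro Least_le) (auto simp: delete_verts_def)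
    then show False using assms F(3) unfolding k_connected_def by simp
  qed
qed

text \<open>Minimum degree 3 forces at least four vertices. Deleting two leaves at least two, so the
  one-vertex alternative in \<open>connectivity\<close> cannot occur, and a disconnection
  contradicts \<open>conn3\<close>.\<close>

lemma k_connected_delete_verts:
  assumes c3: "conn3 (pverts G - Z)" and ne: "pverts G - Z \<noteq> {}"
    and deg: "\<And>h. h \<in> pverts G - Z \<Longrightarrow> 3 \<le> card (nb (pverts G - Z) h)"
  shows "k_connected 3 (delete_verts (with_proj G) Z)"
proof (rule ccontr)
  let ?H = "pverts G - Z" and ?K = "delete_verts (with_proj G) Z"
  let ?P = "\<lambda>k. \<exists>S \<subseteq> verts ?K. card S = k \<and>
     (\<not> connected (delete_verts ?K S) \<or> card (verts (delete_verts ?K S)) = 1)"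
  assume "\<not> k_connected 3 ?K"
  then have small: "connectivity ?K \<le> 2" unfolding k_connected_def by simp
  have fin: "finite ?H" using finite_V by simp
  obtain h where h: "h \<in> ?H" using ne by blast
  have "?H - (?H - {h}) = {h}" using h by blast
  \<comment> \<open>Deleting all vertices but one shows that the minimum in
    \<open>connectivity\<close> is taken over a nonempty set, hence attained.\<close>
  then have "?P (card (?H - {h}))" by (intro exI[of _ "?H - {h}"]) (auto simp: verts_delete_verts)
  then have "?P (connectivity ?K)" unfolding connectivity_def by (rule LeastI)
  then obtain S where S': "S \<subseteq> verts ?K" "card S = connectivity ?K"
      "\<not> connected (delete_verts ?K S) \<or> card (verts (delete_verts ?K S)) = 1" by blast
  have S: "S \<subseteq> ?H" "card S \<le> 2" "\<not> connected (with_proj G \<restriction> (?H - S)) \<or> card (?H - S) = 1"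
    using S' small unfolding delete_verts_delete_verts by (simp_all add: verts_delete_verts)
  have "insert h (nb ?H h) \<subseteq> ?H" using h unfolding nb_def by auto
  from card_mono[OF fin this] have "Suc (card (nb ?H h)) \<le> card ?H"
    using no_loops' finite_nb[OF fin, of h] by (subst (asm) card_insert_disjoint) (auto simp: nb_def)
  then have "4 \<le> card ?H" using deg[OF h] by simp
  moreover have "card (?H - S) = card ?H - card S" using card_Diff_subset[OF finite_subset[OF S(1) fin] S(1)] .
  ultimately have big: "2 \<le> card (?H - S)" using S(2) by simp
  then have "?H - S \<noteq> {}" by (metis card.empty not_numeral_le_zero)
  moreover have "\<not> connected (with_proj G \<restriction> (?H - S))" using S(3) big by auto
  ultimately obtain A where A: "A \<subseteq> ?H - S" "A \<noteq> {}" "A \<noteq> ?H - S"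
      "\<forall>a\<in>A. \<forall>b\<in>?H - S. (a, b) \<in> parcs G \<longrightarrow> b \<in> A"
    unfolding connected_induce_iff by blast
  have bS: "bd ?H A \<subseteq> S" using A(4) unfolding bd_def by blast
  have "card (bd ?H A) \<le> 2" using card_mono[OF finite_subset[OF S(1) fin] bS] S(2) by simp
  then have "A \<union> bd ?H A = ?H" using c3 A(1,2) unfolding conn3_def by blast
  then show False using A(1,3) bS by blast
qed

end

section \<open>Transport of spiders along isomorphisms and embeddings\<close>

lemma spider_app_iso:
  assumes "fin_digraph H" "pre_digraph.digraph_isomorphism H h" "spider H"
  shows "spider (app_iso h H)"
proof -
  interpret H: fin_digraph H by fact
  let ?K = "app_iso h H"
  interpret K: fin_digraph ?K by (rule H.fin_digraphI_app_iso[OF assms(2)])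
  let ?g = "H.inv_iso h"
  note hom = assms(2) H.digraph_isomorphism_invI[OF assms(2)]
  have gK: "app_iso ?g ?K = H" using hom(1) by simp
  have "connected ?K"
    using H.connectedI_app_iso[OF _ hom(1)] assms(3) unfolding spider_def undirected_tree_def by blast
  moreover have "\<not> (K.cycle p \<and> 3 \<le> length p)" for p
  proof
    assume p: "K.cycle p \<and> 3 \<le> length p"
    then obtain u where u: "K.awalk u p u" "distinct (tl (K.awalk_verts u p))" "p \<noteq> []"
      unfolding K.cycle_def by blast
    let ?q = "map (iso_arcs ?g) p" and ?v = "iso_verts ?g u"
    \<comment> \<open>A cycle of the image is pulled back along the inverse isomorphism to one of
      the same length.\<close>
    have w: "H.awalk ?v ?q ?v" using K.awalk_app_isoI[OF u(1) hom(2)] unfolding gK .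
    have eq: "H.awalk_verts ?v ?q = map (iso_verts ?g) (K.awalk_verts u p)"
      using K.awalk_verts_app_iso_eq[OF hom(2) u(1)] unfolding gK .
    have "set (tl (K.awalk_verts u p)) \<subseteq> verts ?K"
      using u(1) unfolding K.awalk_conv by (cases "K.awalk_verts u p") auto
    then have "inj_on (iso_verts ?g) (set (tl (K.awalk_verts u p)))"
      using K.digraph_isomorphism_inj_on_verts[OF hom(2)] inj_on_subset by blast
    then have "distinct (tl (H.awalk_verts ?v ?q))"
      unfolding eq map_tl[symmetric] distinct_map using u(2) by blast
    then have "H.cycle ?q" using w u(3) unfolding H.cycle_def by auto
    then show False using assms(3) p unfolding spider_def undirected_tree_def by (metis length_map)
  qed
  moreover have "card {v \<in> verts ?K. 2 < degree ?K v} \<le> 1"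
  proof -
    have "{v \<in> verts ?K. 2 < degree ?K v} = iso_verts h ` {v \<in> verts H. 2 < degree H v}"
      using H.out_degree_app_iso_eq[OF hom(1)] unfolding degree_def by auto
    moreover have "card {v \<in> verts H. 2 < degree H v} \<le> 1" using assms(3) unfolding spider_def by blast
    moreover have "finite {v \<in> verts H. 2 < degree H v}" by simp
    ultimately show ?thesis using card_image_le le_trans by metis
  qed
  ultimately show ?thesis unfolding spider_def undirected_tree_def by simp
qed

text \<open>The copy consists of the images of the edges of \<open>T\<close> only. The subgraph of
  \<open>G\<close> induced on the same vertices may have more edges and need not be a
  spider.\<close>

lemma spider_copy:
  assumes T: "pair_graph T" "spider (with_proj T)" and G: "pair_graph G"
    and f: "inj_on f (pverts T)" "f ` pverts T \<subseteq> pverts G"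
      "\<And>u v. (u, v) \<in> parcs T \<Longrightarrow> (f u, f v) \<in> parcs G"
  shows "\<exists>T'. pair_graph T' \<and> subgraph T' G \<and> spider T' \<and> digraph_iso T T' \<and> verts T' = f ` pverts T"
proof -
  interpret T: pair_graph T by fact
  interpret G: pair_graph G by fact
  define T' where "T' = \<lparr>pverts = f ` pverts T, parcs = map_prod f f ` parcs T\<rparr>"
  define h where "h = \<lparr>iso_verts = f, iso_arcs = map_prod f f, iso_head = snd, iso_tail = fst\<rparr>"
  have T': "pverts T' = f ` pverts T" "parcs T' = map_prod f f ` parcs T" unfolding T'_def by auto
  have sub: "pverts T' \<subseteq> pverts G" "parcs T' \<subseteq> parcs G" using f(2,3) unfolding T' by auto
  have wf: "u \<in> pverts T'" "v \<in> pverts T'" if "(u, v) \<in> parcs T'" for u v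
    using that T.in_arcsD1 T.in_arcsD2 unfolding T' by auto
  have gT': "pair_graph T'"
  proof
    show "finite (pverts T')" "finite (parcs T')"
      using T.pair_finite_verts T.pair_finite_arcs unfolding T' by auto
    show "symmetric (with_proj T')"
      unfolding symmetric_def with_proj_simps T' by (rule symI) (use T.arcs_symmetric in force)
  qed (use wf sub(2) G.no_loops' in auto)
  have sg: "subgraph (with_proj T') (with_proj G)"
  proof -
    interpret T': pair_graph T' by (rule gT')
    show ?thesis using sub T'.wf_digraph G.wf_digraph by (simp add: subgraph_def compatible_def)
  qed
  have inj: "inj_on (map_prod f f) (parcs T)"
    by (rule inj_on_subset[OF map_prod_inj_on[OF f(1) f(1)]]) (use T.in_arcsD1 T.in_arcsD2 in auto)
  have hom: "T.digraph_isomorphism h"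
    unfolding pre_digraph.digraph_isomorphism_def h_def using f(1) inj T.wf_digraph by auto
  have app: "with_proj T' = app_iso h (with_proj T)"
    unfolding with_proj_def app_iso_def h_def T' by simp
  have "digraph_iso T T'" using hom app unfolding digraph_iso_def by blast
  moreover have "spider T'" unfolding app using spider_app_iso[OF T.fin_digraph_axioms hom T(2)] .
  moreover have "verts (with_proj T') = f ` pverts T" using T'(1) by simp
  ultimately show ?thesis using gT' sg by (intro exI[of _ T'] conjI)
qed

lemma pawalk_verts_map_upt:
  "pawalk_verts (q a) (map (\<lambda>s. (q s, q (Suc s))) [a..<a + n]) = map q [a..<Suc (a + n)]"
proof (induction n arbitrary: a)
  case (Suc n)
  show ?case using Suc[of "Suc a"] by (simp add: upt_conv_Cons del: upt_Suc)
qed simp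

lemma (in pair_wf_digraph) awalk_map_upt:
  assumes "q a \<in> pverts G" "\<And>s. a \<le> s \<Longrightarrow> s < a + n \<Longrightarrow> (q s, q (Suc s)) \<in> parcs G"
  shows "awalk (q a) (map (\<lambda>s. (q s, q (Suc s))) [a..<a + n]) (q (a + n))"
  using assms
proof (induction n arbitrary: a)
  case 0
  then show ?case by (simp add: awalk_Nil_iff)
next
  case (Suc n)
  have "(q a, q (Suc a)) \<in> parcs G" using Suc(3)[of a] by simp
  moreover from in_arcsD2[OF this] have "awalk (q (Suc a)) (map (\<lambda>s. (q s, q (Suc s))) [Suc a..<Suc a + n]) (q (Suc a + n))"
    by (rule Suc(1)) (use Suc(3) in simp)
  ultimately show ?case
    by (simp add: upt_conv_Cons awalk_Cons_iff del: upt_Suc)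
qed

lemma (in pair_bip_graph) spider_legs:
  assumes "spider (with_proj G)"
  shows "\<exists>d l c p. emb d l c p \<and> feet d l c p = pverts G \<and> (\<forall>i<d. 1 \<le> l i) \<and>
    (2 \<le> d \<or> (\<forall>i<d. l i \<le> 1)) \<and>
    (\<forall>u v. (u, v) \<in> parcs G \<longrightarrow> (\<exists>i s. i < d \<and> s < l i \<and> {u, v} = {p i s, p i (Suc s)}))"
proof -
  let ?deg = "\<lambda>v. card (nb (pverts G) v)"
  let ?B = "{v \<in> pverts G. 2 < ?deg v}"
  have conn: "connected (with_proj G)" and big: "card ?B \<le> 1"
    and acyc: "\<And>p. cycle p \<Longrightarrow> 3 \<le> length p \<Longrightarrow> False"
    using assms unfolding spider_def undirected_tree_def degree_eq by auto
  have "with_proj G \<restriction> pverts G = with_proj G"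
    using in_arcsD1 in_arcsD2 unfolding induce_subgraph_def with_proj_def by auto
  then have ne: "pverts G \<noteq> {}" and
    closed: "\<And>A. A \<subseteq> pverts G \<Longrightarrow> A \<noteq> {} \<Longrightarrow> \<forall>a\<in>A. \<forall>b\<in>pverts G. (a, b) \<in> parcs G \<longrightarrow> b \<in> A \<Longrightarrow> A = pverts G"
    using conn connected_induce_iff[of "pverts G"] by simp_all
  \<comment> \<open>A vertex of maximum degree serves as centre. It is the branching vertex if there
    is one, and on a path with at least three vertices it is an inner vertex.\<close>
  have "Max (?deg ` pverts G) \<in> ?deg ` pverts G" using finite_V ne by (intro Max_in) auto
  then obtain c where c: "c \<in> pverts G" "?deg c = Max (?deg ` pverts G)" by auto
  have cmax: "?deg v \<le> ?deg c" if "v \<in> pverts G" for v unfolding c(2) using finite_V that by (intro Max_ge) auto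
  have "?deg v \<le> 2" if "v \<in> pverts G" "v \<noteq> c" for v
  proof (rule ccontr)
    assume "\<not> ?deg v \<le> 2"
    then have "{v, c} \<subseteq> ?B" using that c(1) cmax[OF that(1)] by auto
    from card_mono[OF _ this] show False using big that(2) finite_V by simp
  qed
  moreover have False
    if q: "3 \<le> n" "\<And>s. s < n \<Longrightarrow> (q s, q (Suc s)) \<in> parcs G" "inj_on q {1..n}" "q 0 = q n"
      "q ` {..n} \<subseteq> pverts G" for q and n :: nat
  proof (rule acyc)
    let ?p = "map (\<lambda>s. (q s, q (Suc s))) [0..<n]"
    have "awalk (q 0) ?p (q 0)" using awalk_map_upt[of q 0 n] q(2,4,5) by auto
    moreover have "pawalk_verts (q 0) ?p = q 0 # map q [1..<Suc n]"
      using pawalk_verts_map_upt[of q 0 n] by (simp add: upt_conv_Cons del: upt_Suc)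
    moreover have "distinct (map q [1..<Suc n])"
      using q(3) by (simp add: distinct_map atLeastLessThanSuc_atLeastAtMost del: upt_Suc)
    moreover have "?p \<noteq> []" using q(1) by simp
    ultimately show "cycle ?p" unfolding cycle_def by (intro exI[of _ "q 0"]) simp
    show "3 \<le> length ?p" using q(1) by simp
  qed
  ultimately have "\<exists>d l p. emb d l c p \<and> feet d l c p = pverts G \<and> (\<forall>i<d. 1 \<le> l i) \<and>
      (2 \<le> d \<or> (\<forall>i<d. l i \<le> 1)) \<and> (\<forall>u\<in>pverts G. \<forall>v\<in>pverts G. (u, v) \<in> parcs G \<longrightarrow>
      (\<exists>i s. i < d \<and> s < l i \<and> {u, v} = {p i s, p i (Suc s)}))"
    by (intro exists_legs closed c(1) cmax) blast+
  then show ?thesis using in_arcsD1 in_arcsD2 by blast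
qed

lemma pair_bip_graph_if_bipartition:
  assumes "pair_graph G" "bipartition (with_proj G) X Y"
  shows "pair_bip_graph G (\<lambda>v. v \<in> X)"
proof -
  interpret pair_graph G by fact
  show ?thesis
  proof
    show "finite (pverts G)" by (rule pair_finite_verts)
    show "(v, u) \<in> parcs G" if "(u, v) \<in> parcs G" for u v using arcs_symmetric that .
    show "(u \<in> X) \<noteq> (v \<in> X)" if "(u, v) \<in> parcs G" for u v
    proof -
      have "u \<in> X \<union> Y" "v \<in> X \<union> Y"
        using assms(2) in_arcsD1[OF that] in_arcsD2[OF that] unfolding bipartition_def by auto
      moreover have "\<not> (u \<in> X \<and> v \<in> X)" "\<not> (u \<in> Y \<and> v \<in> Y)" "X \<inter> Y = {}"
        using assms(2) that unfolding bipartition_def independent_def by auto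
      ultimately show ?thesis by blast
    qed
  qed
qed

text \<open>Embeddings with the same leg lengths in two different graphs are matched position by
  position; the vertex set of the first need not be an induced spider.\<close>

lemma emb_transfer:
  assumes T: "bip_graph VT adjT colT" "bip_graph.emb VT adjT d l c p"
    and G: "bip_graph V adj col" "bip_graph.emb V adj d l c' p'"
  shows "\<exists>f. inj_on f (feet d l c p) \<and> f ` feet d l c p = feet d l c' p' \<and>
    (\<forall>i<d. \<forall>s\<le>l i. f (p i s) = p' i s)"
proof -
  interpret T: bip_graph VT adjT colT by fact
  interpret G: bip_graph V adj col by fact
  note t = T.embD[OF T(2)] and g = G.embD[OF G(2)]
  \<comment> \<open>The choice is well defined: a vertex other than the centre occupies exactly one
    position.\<close>
  define f where "f x = (if x = c then c' else
    case SOME (i, s). i < d \<and> 1 \<le> s \<and> s \<le> l i \<and> x = p i s of (i, s) \<Rightarrow> p' i s)" for x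
  have fc: "f c = c'" unfolding f_def by simp
  have fp: "f (p i s) = p' i s" if i: "i < d" "s \<le> l i" for i s
  proof (cases "s = 0")
    case True
    then show ?thesis using t(3)[OF i(1)] g(3)[OF i(1)] fc by simp
  next
    case False
    then have s: "1 \<le> s" by simp
    have "(SOME (j, r). j < d \<and> 1 \<le> r \<and> r \<le> l j \<and> p i s = p j r) = (i, s)"
    proof (rule some_equality)
      show "case (i, s) of (j, r) \<Rightarrow> j < d \<and> 1 \<le> r \<and> r \<le> l j \<and> p i s = p j r" using i s by simp
      show "x = (i, s)" if "case x of (j, r) \<Rightarrow> j < d \<and> 1 \<le> r \<and> r \<le> l j \<and> p i s = p j r" for x
        using t(6)[OF i(1) s i(2), of "fst x" "snd x"] that by (cases x) auto
    qed
    then show ?thesis unfolding f_def using t(5)[OF i(1) s i(2)] by simp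
  qed
  have "f ` feet d l c p = feet d l c' p'"
  proof (rule subset_antisym; rule subsetI)
    fix y assume "y \<in> f ` feet d l c p"
    then obtain x where "x \<in> feet d l c p" "y = f x" by blast
    then consider "y = f c" | i s where "i < d" "1 \<le> s" "s \<le> l i" "y = f (p i s)"
      unfolding feet_iff by blast
    then show "y \<in> feet d l c' p'"
    proof cases
      case 1
      then show ?thesis using fc feet_iff[of c'] by simp
    next
      case 2
      then show ?thesis using fp[of i s] g(8)[of i s] by simp
    qed
  next
    fix y assume "y \<in> feet d l c' p'"
    then consider "y = c'" | i s where "i < d" "1 \<le> s" "s \<le> l i" "y = p' i s" unfolding feet_iff by blast
    then show "y \<in> f ` feet d l c p"
    proof cases
      case 1
      then show ?thesis using fc feet_iff[of c] by (metis imageI)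
    next
      case 2
      then show ?thesis using fp[of i s] t(8)[of i s] by (metis imageI)
    qed
  qed
  moreover have "inj_on f (feet d l c p)"
  proof (rule inj_onI)
    fix x y assume xy: "x \<in> feet d l c p" "y \<in> feet d l c p" "f x = f y"
    have ne: "f (p i s) \<noteq> c'" if "i < d" "1 \<le> s" "s \<le> l i" for i s
      using fp[OF that(1,3)] g(5)[OF that] by simp
    consider "x = c" "y = c" | i s where "x = c" "y = p i s" "i < d" "1 \<le> s" "s \<le> l i"
      | i s where "y = c" "x = p i s" "i < d" "1 \<le> s" "s \<le> l i"
      | i s j r where "x = p i s" "i < d" "1 \<le> s" "s \<le> l i" "y = p j r" "j < d" "1 \<le> r" "r \<le> l j"
      using xy(1,2) unfolding feet_iff by blast
    then show "x = y"
    proof cases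
      case 2
      then show ?thesis using ne[of i s] xy(3) fc by simp
    next
      case 3
      then show ?thesis using ne[of i s] xy(3) fc by simp
    next
      case 4
      then have "p' i s = p' j r" using xy(3) fp by simp
      then show ?thesis using g(6)[of i s j r] 4 by simp
    qed simp
  qed
  ultimately show ?thesis using fp by blast
qed

theorem theorem4p2:
  fixes T :: "'a pair_pre_digraph" and G :: "'b pair_pre_digraph"
    and X Y :: "'a set" and t :: nat
  assumes "pair_graph T" and "spider T" and "bipartition T X Y"
    and "t = max (card X) (card Y)"
    and "pair_graph G" and "bipartite G" and "k_connected 3 G"
    and "min_degree G \<ge> t + 3"
  shows "\<exists>T' :: 'b pair_pre_digraph. pair_graph T' \<and> subgraph T' G \<and> spider T' \<and>
           digraph_iso T T' \<and> k_connected 3 (delete_verts G (verts T'))"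
proof -
  interpret T: pair_bip_graph T "\<lambda>v. v \<in> X" by (rule pair_bip_graph_if_bipartition[OF assms(1,3)])
  obtain X' Y' where "bipartition G X' Y'" using assms(6) unfolding bipartite_def by blast
  then interpret G: pair_bip_graph G "\<lambda>v. v \<in> X'" by (rule pair_bip_graph_if_bipartition[OF assms(5)])
  obtain d l c p where e: "T.emb d l c p" and cover: "feet d l c p = pverts T"
    and l: "\<And>i. i < d \<Longrightarrow> 1 \<le> l i" "2 \<le> d \<or> (\<forall>i<d. l i \<le> 1)"
    and arcs: "\<And>u v. (u, v) \<in> parcs T \<Longrightarrow> \<exists>i s. i < d \<and> s < l i \<and> {u, v} = {p i s, p i (Suc s)}"
    using T.spider_legs[OF assms(2)] by blast
  have classes: "{x \<in> pverts T. x \<in> X} = X" "{x \<in> pverts T. x \<notin> X} = Y"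
    using assms(3) unfolding bipartition_def by auto
  \<comment> \<open>The two sums are the sizes of \<open>X\<close> and \<open>Y\<close>, in an order
    that depends on the colour of the centre.\<close>
  have t: "(\<Sum>i<d. (l i + 1) div 2) \<le> t" "Suc (\<Sum>i<d. l i div 2) \<le> t"
    using T.emb_card_other[OF e] T.emb_card_same[OF e] classes assms(4) unfolding cover
    by (cases "c \<in> X"; simp)+
  have deg: "t + 3 \<le> card (G.nb (pverts G) v)" if "v \<in> pverts G" for v
  proof -
    have "min_degree G \<le> degree G v"
      unfolding min_degree_def using that G.finite_V by (intro Min_le) auto
    then show ?thesis using assms(8) unfolding G.degree_eq by simp
  qed
  have "pverts G \<noteq> {}"
  proof
    assume "pverts G = {}"
    then have "\<not> connected (delete_verts G {})"
      unfolding delete_verts_def G.connected_induce_iff by simp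
    then have "connectivity G \<le> 0" unfolding connectivity_def by (intro Least_le exI[of _ "{}"]) simp
    then show False using assms(7) unfolding k_connected_def by simp
  qed
  then obtain c' p' where e': "G.emb d l c' p'" and c3: "G.conn3 (pverts G - feet d l c' p')"
    using G.exists_spider[OF G.conn3_if_k_connected[OF assms(7)] deg _ t l] by blast
  let ?F = "feet d l c' p'"
  obtain f where f: "inj_on f (pverts T)" "f ` pverts T = ?F" "\<forall>i<d. \<forall>s\<le>l i. f (p i s) = p' i s"
    using emb_transfer[OF T.bip_graph_axioms e G.bip_graph_axioms e'] unfolding cover by blast
  have "(f u, f v) \<in> parcs G" if uv: "(u, v) \<in> parcs T" for u v
  proof -
    obtain i s where leg: "i < d" "s < l i" "{u, v} = {p i s, p i (Suc s)}" using arcs[OF uv] by blast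
    have "(p' i s, p' i (Suc s)) \<in> parcs G" using G.embD(4)[OF e' leg(1,2)] .
    then show ?thesis using f(3) leg G.arcs_symmetric by (auto simp: doubleton_eq_iff)
  qed
  moreover have FG: "?F \<subseteq> pverts G" by (rule G.embD(1)[OF e'])
  ultimately obtain T' where T': "pair_graph T'" "subgraph T' G" "spider T'" "digraph_iso T T'"
    "verts T' = ?F"
    using spider_copy[OF assms(1,2,5) f(1)] unfolding f(2) by blast
  have H: "3 \<le> card (G.nb (pverts G - ?F) h)" if h: "h \<in> pverts G" for h
  proof -
    have "card (G.nb ?F h) \<le> t"
      using G.emb_nb_same[OF e', of h] G.emb_nb_other[OF e', of h] t by (cases "(h \<in> X') = (c' \<in> X')") auto
    moreover have "G.nb (pverts G) h \<subseteq> G.nb ?F h \<union> G.nb (pverts G - ?F) h" unfolding G.nb_def by blast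
    then have "card (G.nb (pverts G) h) \<le> card (G.nb ?F h) + card (G.nb (pverts G - ?F) h)"
      by (rule order_trans[OF card_mono card_Un_le, rotated]) (simp add: G.finite_nb finite_feet G.finite_V)
    ultimately show ?thesis using deg[OF h] by simp
  qed
  \<comment> \<open>The remainder is nonempty because the centre of the copy itself has at least
    three neighbours outside the copy.\<close>
  have "c' \<in> pverts G" by (rule G.embD(2)[OF e'])
  from H[OF this] have "G.nb (pverts G - ?F) c' \<noteq> {}" by auto
  then have "pverts G - ?F \<noteq> {}" unfolding G.nb_def by blast
  then have "k_connected 3 (delete_verts G (verts T'))"
    unfolding T'(5) by (rule G.k_connected_delete_verts[OF c3]) (use H in blast)
  then show ?thesis using T' by blast
qed

end
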